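(* Let $L:\mathbb{R}\times\mathbb{R}^n\times\mathbb{R}^n\times\mathbb{R}\to\mathbb{R}$ be of class $C^1$ and satisfy conditions (L1), (L2), (L3) together with either (L4) or (L4') listed in the context, and let $$H(t,x,p,r)=\sup_{v\in\mathbb{R}^n}\{p\cdot v-L(t,x,v,r)\}$$ be the associated Hamiltonian. Let $\phi:\mathbb{R}^n\to\mathbb{R}$ be lower semi-continuous and $(\kappa_1,\kappa_2)$-Lipschitz in the large for some $\kappa_1,\kappa_2\geqslant0$. Then the function $$u(t,x)=\inf_{y\in\mathbb{R}^n}\{\phi(y)+h_L(0,t,y,x,\phi(y))\},\quad t>0,\ x\in\mathbb{R}^n,\qquad u(0,x)=\phi(x),$$ is finite-valued and is a viscosity solution of $$D_tu(t,x)+H(t,x,D_xu(t,x),u(t,x))=0\quad (t>0,\ x\in\mathbb{R}^n),\qquad u(0,x)=\phi(x).$$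
   Context: Write $L=L(t,x,v,r)$; $L_t,L_x,L_v,L_r$ are the partial derivatives. A function $\theta:[0,+\infty)\to[0,+\infty)$ is superlinear if $\theta(r)/r\to+\infty$ as $r\to+\infty$. Conditions: (L1) $L(t,x,\cdot,r)$ is strictly convex for all $(t,x,r)$. (L2) There exist two superlinear functions $\overline\theta_0,\theta_0:[0,+\infty)\to[0,+\infty)$ and two $L^\infty_{\rm loc}$ functions $c_0,c_1:\mathbb{R}\to[0,+\infty)$ such that $\overline\theta_0(|v|)+c_1(t)\geqslant L(t,x,v,0)\geqslant\theta_0(|v|)-c_0(t)$ for all $(t,x,v)\in\mathbb{R}\times\mathbb{R}^n\times\mathbb{R}^n$. (L3) There exists an $L^\infty_{\rm loc}$ function $K:\mathbb{R}\to[0,+\infty)$ such that $|L_r(t,x,v,r)|\leqslant K(t)$ for all $(t,x,v,r)$. (L4) There exist two $L^\infty_{\rm loc}$ functions $C_1,C_2:\mathbb{R}\to[0,+\infty)$ such that $|L_t(t,x,v,r)|\leqslant C_1(t)+C_2(t)L(t,x,v,r)$ for all $(t,x,v,r)$. (L4') There exist two $L^\infty_{\rm loc}$ functions $C_1,C_2:\mathbb{R}\to[0,+\infty)$ such that $\max\{|L_x(t,x,v,r)|,|L_v(t,x,v,r)|\}\leqslant C_1(t)+C_2(t)L(t,x,v,r)$ for all $(t,x,v,r)$. For $t_1<t_2$, $x,y\in\mathbb{R}^n$, $w\in\mathbb{R}$, let $\mathcal{A}^{t_1,t_2,w}_{x,y}$ be the set of $\xi\in W^{1,1}([t_1,t_2],\mathbb{R}^n)$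 with $\xi(t_1)=x$, $\xi(t_2)=y$ for which the problem $\dot u_\xi(s)=L(s,\xi(s),\dot\xi(s),u_\xi(s))$ a.e. on $[t_1,t_2]$, $u_\xi(t_1)=w$, admits an absolutely continuous solution $u_\xi$ (which is then unique). Define $$h_L(t_1,t_2,x,y,w)=\inf_{\xi\in\mathcal{A}^{t_1,t_2,w}_{x,y}}\int_{t_1}^{t_2}L(s,\xi(s),\dot\xi(s),u_\xi(s))\,ds.$$ $\phi:\mathbb{R}^n\to\mathbb{R}$ is $(\kappa_1,\kappa_2)$-Lipschitz in the large if $|\phi(y)-\phi(x)|\leqslant\kappa_1+\kappa_2|x-y|$ for all $x,y\in\mathbb{R}^n$. Viscosity solution is meant in the standard (Crandall–Lions) sense on $(0,\infty)\times\mathbb{R}^n$: for every $C^1$ function $\varphi$ on $(0,\infty)\times\mathbb{R}^n$, if $u-\varphi$ has a local maximum (resp. minimum) at $(t,x)$, then $D_t\varphi(t,x)+H(t,x,D_x\varphi(t,x),u(t,x))\leqslant0$ (resp. $\geqslant0$). *)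

theory Defs
  imports "HOL-Analysis.Analysis"
begin

section \<open>Function classes\<close>

definition C1_on :: "'a::real_normed_vector set \<Rightarrow> ('a \<Rightarrow> 'b::real_normed_vector) \<Rightarrow> bool" where
  "C1_on S f \<longleftrightarrow> open S \<and>
     (\<exists>f' :: 'a \<Rightarrow> 'a \<Rightarrow>\<^sub>L 'b.
        (\<forall>z\<in>S. (f has_derivative blinfun_apply (f' z)) (at z)) \<and> continuous_on S f')"

(* Only applied to differentiable functions, for which the gradient exists and is unique. *)
definition gradient :: "('a::real_inner \<Rightarrow> real) \<Rightarrow> 'a \<Rightarrow> 'a" where
  "gradient f x = (THE D. GDERIV f x :> D)"

definition strictly_convex :: "('a::real_vector \<Rightarrow> real) \<Rightarrow> bool" where
  "strictly_convex f \<longleftrightarrow>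
     (\<forall>x y. \<forall>c\<in>{0<..<1}. x \<noteq> y \<longrightarrow>
        f ((1 - c) *\<^sub>R x + c *\<^sub>R y) < (1 - c) * f x + c * f y)"

definition lower_semicont :: "('a::topological_space \<Rightarrow> real) \<Rightarrow> bool" where
  "lower_semicont f \<longleftrightarrow> (\<forall>x. \<forall>a < f x. \<forall>\<^sub>F y in nhds x. a < f y)"

definition lipschitz_in_the_large ::
    "real \<Rightarrow> real \<Rightarrow> ('a::real_normed_vector \<Rightarrow> real) \<Rightarrow> bool" where
  "lipschitz_in_the_large \<kappa>1 \<kappa>2 f \<longleftrightarrow> (\<forall>x y. \<bar>f y - f x\<bar> \<le> \<kappa>1 + \<kappa>2 * norm (x - y))"

(* A function [0,\<infinity>) \<rightarrow> [0,\<infinity>) is a function on the reals; its values at negative arguments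
   are irrelevant. *)
definition superlinear :: "(real \<Rightarrow> real) \<Rightarrow> bool" where
  "superlinear \<theta> \<longleftrightarrow> (\<forall>r\<ge>0. 0 \<le> \<theta> r) \<and> filterlim (\<lambda>r. \<theta> r / r) at_top at_top"

definition nonneg_Linf_loc :: "(real \<Rightarrow> real) \<Rightarrow> bool" where
  "nonneg_Linf_loc f \<longleftrightarrow> (\<forall>t. 0 \<le> f t) \<and> f \<in> borel_measurable lebesgue \<and>
     (\<forall>S. compact S \<longrightarrow> (\<exists>M. AE t in lebesgue. t \<in> S \<longrightarrow> \<bar>f t\<bar> \<le> M))"

definition abs_continuous_on :: "real \<Rightarrow> real \<Rightarrow> (real \<Rightarrow> real) \<Rightarrow> bool" where
  "abs_continuous_on a b u \<longleftrightarrow>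
     (\<forall>\<epsilon>>0. \<exists>\<delta>>0. \<forall>(I :: nat set) \<alpha> \<beta>.
        finite I \<longrightarrow> (\<forall>i\<in>I. a \<le> \<alpha> i \<and> \<alpha> i \<le> \<beta> i \<and> \<beta> i \<le> b) \<longrightarrow>
        disjoint_family_on (\<lambda>i. {\<alpha> i<..<\<beta> i}) I \<longrightarrow>
        (\<Sum>i\<in>I. \<beta> i - \<alpha> i) < \<delta> \<longrightarrow> (\<Sum>i\<in>I. \<bar>u (\<beta> i) - u (\<alpha> i)\<bar>) < \<epsilon>)"

definition test_function :: "real \<Rightarrow> real \<Rightarrow> (real \<Rightarrow> real) \<Rightarrow> bool" where
  "test_function a b \<eta> \<longleftrightarrow> \<eta> C1_differentiable_on UNIV \<and>
     (\<exists>K. compact K \<and> K \<subseteq> {a<..<b} \<and> (\<forall>s. s \<notin> K \<longrightarrow> \<eta> s = 0))"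

definition has_weak_derivative ::
    "real \<Rightarrow> real \<Rightarrow> (real \<Rightarrow> 'a::euclidean_space) \<Rightarrow> (real \<Rightarrow> 'a) \<Rightarrow> bool" where
  "has_weak_derivative a b \<xi> g \<longleftrightarrow> g absolutely_integrable_on {a..b} \<and>
     (\<forall>\<eta>. test_function a b \<eta> \<longrightarrow>
        (LINT s:{a..b}|lebesgue. deriv \<eta> s *\<^sub>R \<xi> s) = - (LINT s:{a..b}|lebesgue. \<eta> s *\<^sub>R g s))"

(* Elements of W^{1,1}([a,b]) are identified with their continuous representatives, which is
   what gives the endpoint conditions a meaning. *)
definition W11 :: "real \<Rightarrow> real \<Rightarrow> (real \<Rightarrow> 'a::euclidean_space) set" where
  "W11 a b = {\<xi>. continuous_on {a..b} \<xi> \<and> (\<exists>g. has_weak_derivative a b \<xi> g)}"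

(* Unique up to a null set of [a,b]; it is only used inside almost-everywhere conditions and
   integrals over [a,b]. *)
definition weak_derivative ::
    "real \<Rightarrow> real \<Rightarrow> (real \<Rightarrow> 'a::euclidean_space) \<Rightarrow> (real \<Rightarrow> 'a)" where
  "weak_derivative a b \<xi> = (SOME g. has_weak_derivative a b \<xi> g)"

section \<open>Conditions on the Lagrangian\<close>

type_synonym 'n lagrangian = "real \<Rightarrow> real^'n \<Rightarrow> real^'n \<Rightarrow> real \<Rightarrow> real"

definition C1_lagrangian :: "'n::finite lagrangian \<Rightarrow> bool" where
  "C1_lagrangian L \<longleftrightarrow> C1_on UNIV (\<lambda>(t, x, v, r). L t x v r)"

definition cond_L1 :: "'n::finite lagrangian \<Rightarrow> bool" where
  "cond_L1 L \<longleftrightarrow> (\<forall>t x r. strictly_convex (\<lambda>v. L t x v r))"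

definition cond_L2 :: "'n::finite lagrangian \<Rightarrow> bool" where
  "cond_L2 L \<longleftrightarrow> (\<exists>\<Theta> \<theta> c0 c1.
     superlinear \<Theta> \<and> superlinear \<theta> \<and> nonneg_Linf_loc c0 \<and> nonneg_Linf_loc c1 \<and>
     (\<forall>t x v. \<Theta> (norm v) + c1 t \<ge> L t x v 0 \<and> L t x v 0 \<ge> \<theta> (norm v) - c0 t))"

definition cond_L3 :: "'n::finite lagrangian \<Rightarrow> bool" where
  "cond_L3 L \<longleftrightarrow> (\<exists>K. nonneg_Linf_loc K \<and>
     (\<forall>t x v r. \<bar>deriv (\<lambda>r'. L t x v r') r\<bar> \<le> K t))"

definition cond_L4 :: "'n::finite lagrangian \<Rightarrow> bool" where
  "cond_L4 L \<longleftrightarrow> (\<exists>C1 C2. nonneg_Linf_loc C1 \<and> nonneg_Linf_loc C2 \<and>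
     (\<forall>t x v r. \<bar>deriv (\<lambda>t'. L t' x v r) t\<bar> \<le> C1 t + C2 t * L t x v r))"

definition cond_L4' :: "'n::finite lagrangian \<Rightarrow> bool" where
  "cond_L4' L \<longleftrightarrow> (\<exists>C1 C2. nonneg_Linf_loc C1 \<and> nonneg_Linf_loc C2 \<and>
     (\<forall>t x v r. max (norm (gradient (\<lambda>x'. L t x' v r) x)) (norm (gradient (\<lambda>v'. L t x v' r) v))
        \<le> C1 t + C2 t * L t x v r))"

(* A real supremum: under (L2) and (L3) the set is bounded above, so it is the true supremum. *)
definition hamiltonian ::
    "'n::finite lagrangian \<Rightarrow> real \<Rightarrow> real^'n \<Rightarrow> real^'n \<Rightarrow> real \<Rightarrow> real" where
  "hamiltonian L t x p r = (SUP v. p \<bullet> v - L t x v r)"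

section \<open>Herglotz' variational problem\<close>

definition herglotz_solution :: "'n::finite lagrangian \<Rightarrow> real \<Rightarrow> real \<Rightarrow> real \<Rightarrow>
    (real \<Rightarrow> real^'n) \<Rightarrow> (real \<Rightarrow> real) \<Rightarrow> bool" where
  "herglotz_solution L t1 t2 w \<xi> u \<longleftrightarrow> abs_continuous_on t1 t2 u \<and> u t1 = w \<and>
     (AE s in lebesgue. s \<in> {t1..t2} \<longrightarrow>
        (u has_real_derivative L s (\<xi> s) (weak_derivative t1 t2 \<xi> s) (u s)) (at s within {t1..t2}))"

definition admissible :: "'n::finite lagrangian \<Rightarrow> real \<Rightarrow> real \<Rightarrow> real \<Rightarrow>
    real^'n \<Rightarrow> real^'n \<Rightarrow> (real \<Rightarrow> real^'n) set" where
  "admissible L t1 t2 w x y =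
     {\<xi> \<in> W11 t1 t2. \<xi> t1 = x \<and> \<xi> t2 = y \<and> (\<exists>u. herglotz_solution L t1 t2 w \<xi> u)}"

(* Under (L3) the solution is unique on [t1,t2]. *)
definition herglotz_sol :: "'n::finite lagrangian \<Rightarrow> real \<Rightarrow> real \<Rightarrow> real \<Rightarrow>
    (real \<Rightarrow> real^'n) \<Rightarrow> (real \<Rightarrow> real)" where
  "herglotz_sol L t1 t2 w \<xi> = (SOME u. herglotz_solution L t1 t2 w \<xi> u)"

(* Extended-real valued, since finiteness of the infimum is not known a priori. The integrand
   is a.e. the derivative of an absolutely continuous function, hence integrable. *)
definition h_L :: "'n::finite lagrangian \<Rightarrow> real \<Rightarrow> real \<Rightarrow> real^'n \<Rightarrow> real^'n \<Rightarrow> real \<Rightarrow> ereal" where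
  "h_L L t1 t2 x y w = (INF \<xi> \<in> admissible L t1 t2 w x y.
     ereal (LINT s:{t1..t2}|lebesgue.
       L s (\<xi> s) (weak_derivative t1 t2 \<xi> s) (herglotz_sol L t1 t2 w \<xi> s)))"

definition value_function ::
    "'n::finite lagrangian \<Rightarrow> (real^'n \<Rightarrow> real) \<Rightarrow> real \<Rightarrow> real^'n \<Rightarrow> ereal" where
  "value_function L \<phi> t x =
     (if t = 0 then ereal (\<phi> x) else (INF y. ereal (\<phi> y) + h_L L 0 t y x (\<phi> y)))"

section \<open>Viscosity solutions\<close>

definition local_max_at :: "('a::topological_space \<Rightarrow> real) \<Rightarrow> 'a \<Rightarrow> bool" where
  "local_max_at f z \<longleftrightarrow> (\<forall>\<^sub>F z' in nhds z. f z' \<le> f z)"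

definition local_min_at :: "('a::topological_space \<Rightarrow> real) \<Rightarrow> 'a \<Rightarrow> bool" where
  "local_min_at f z \<longleftrightarrow> (\<forall>\<^sub>F z' in nhds z. f z \<le> f z')"

(* Since t > 0 is an interior point of the domain, neighbourhoods in the whole space and in
   (0,\<infinity>) \<times> R^n yield the same local extrema. *)
definition viscosity_solution ::
    "(real \<Rightarrow> real^'n::finite \<Rightarrow> real^'n \<Rightarrow> real \<Rightarrow> real) \<Rightarrow> (real \<Rightarrow> real^'n \<Rightarrow> real) \<Rightarrow> bool" where
  "viscosity_solution H u \<longleftrightarrow>
     (\<forall>\<phi> :: real \<times> (real^'n) \<Rightarrow> real. C1_on ({0<..} \<times> UNIV) \<phi> \<longrightarrow>
       (\<forall>t>0. \<forall>x.
         (local_max_at (\<lambda>(s, y). u s y - \<phi> (s, y)) (t, x) \<longrightarrow>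
            deriv (\<lambda>s. \<phi> (s, x)) t + H t x (gradient (\<lambda>y. \<phi> (t, y)) x) (u t x) \<le> 0) \<and>
         (local_min_at (\<lambda>(s, y). u s y - \<phi> (s, y)) (t, x) \<longrightarrow>
            deriv (\<lambda>s. \<phi> (s, x)) t + H t x (gradient (\<lambda>y. \<phi> (t, y)) x) (u t x) \<ge> 0)))"

definition viscosity_solution_cauchy ::
    "(real \<Rightarrow> real^'n::finite \<Rightarrow> real^'n \<Rightarrow> real \<Rightarrow> real) \<Rightarrow> (real^'n \<Rightarrow> real) \<Rightarrow>
     (real \<Rightarrow> real^'n \<Rightarrow> real) \<Rightarrow> bool" where
  "viscosity_solution_cauchy H \<phi> u \<longleftrightarrow> viscosity_solution H u \<and> (\<forall>x. u 0 x = \<phi> x)"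

end

theory Submission
  imports Defs
begin

text \<open>Since the integral of \<open>L\<close> along a curve is the increment of the Herglotz solution, \<open>u t x\<close> is the
  infimum of the terminal values \<open>U t\<close> over all curves ending in \<open>x\<close> whose Herglotz solution \<open>U\<close> starts from \<open>\<phi>\<close>.
  A Gronwall argument shows that \<open>U t \<le> M\<close> bounds \<open>U\<close> on the whole of \<open>[0, t]\<close>: superlinear growth in
  the velocity beats the linear growth of \<open>\<phi>\<close>. This gives finiteness, and then superlinearity makes the
  velocities of almost optimal curves uniformly integrable, so that these curves stay near \<open>x\<close> on \<open>[t - h, t]\<close>.

  Subsolution: extend an almost optimal curve ending in \<open>x - h v\<close> at time \<open>t - h\<close> by a straight segment with
  velocity \<open>v\<close> and compare its Herglotz solution with an affine barrier. Supersolution: if the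
  inequality failed at \<open>(t, x)\<close>, superlinearity would make it fail strictly, uniformly in the
  velocity, in a neighbourhood of \<open>(t, x, u t x)\<close>; integrating along an almost optimal curve over
  \<open>[t - h, t]\<close> contradicts its almost optimality. Neither part needs minimizers.\<close>

section \<open>Absolutely continuous functions\<close>

text \<open>\<open>abs_continuous_on\<close> and \<open>W11\<close> are given by their raw
  definitions and \<open>weak_derivative\<close> is an arbitrary choice. The calculus along a curve
  is therefore built on two facts: the fundamental theorem for absolutely continuous functions, and
  the identification of \<open>W11\<close> with primitives of integrable functions. Both are
  obtained through gauge integrals. The obstacle in the viscosity part is that nothing beyond
  finiteness of the value function is at hand, neither continuity nor a local bound. Closeness to
  \<open>u t x\<close> must come from the curve under consideration, through integral bounds, or
  from an explicit barrier. Near-optimality up to \<open>h * \<delta>\<close> can replace minimizers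
  because the strict gap in a violated viscosity inequality, integrated over a time interval of
  length \<open>h\<close>, is of the same order \<open>h\<close>.\<close>

lemma abs_continuous_on_imp_continuous_on:
  assumes "abs_continuous_on a b u"
  shows "continuous_on {a..b} u"
  unfolding continuous_on_iff
proof (intro ballI allI impI)
  fix x e :: real assume x: "x \<in> {a..b}" and "0 < e"
  from assms[unfolded abs_continuous_on_def, rule_format, OF \<open>0 < e\<close>]
  obtain d where d: "d > 0" and *: "\<And>(I :: nat set) \<alpha> \<beta>.
        finite I \<Longrightarrow> (\<forall>i\<in>I. a \<le> \<alpha> i \<and> \<alpha> i \<le> \<beta> i \<and> \<beta> i \<le> b) \<Longrightarrow>
        disjoint_family_on (\<lambda>i. {\<alpha> i<..<\<beta> i}) I \<Longrightarrow>
        (\<Sum>i\<in>I. \<beta> i - \<alpha> i) < d \<Longrightarrow> (\<Sum>i\<in>I. \<bar>u (\<beta> i) - u (\<alpha> i)\<bar>) < e"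
    by blast
  show "\<exists>d>0. \<forall>x'\<in>{a..b}. dist x' x < d \<longrightarrow> dist (u x') (u x) < e"
  proof (intro exI conjI ballI impI)
    fix y assume y: "y \<in> {a..b}" "dist y x < d"
    have "(\<Sum>i\<in>{0::nat}. \<bar>u (max x y) - u (min x y)\<bar>) < e"
      using x y by (intro *) (auto simp: disjoint_family_on_def dist_real_def)
    then show "dist (u y) (u x) < e"
      by (auto simp: dist_real_def max_def min_def split: if_splits)
  qed (rule d)
qed

lemma abs_continuous_on_subset:
  assumes "abs_continuous_on a b u" "a \<le> c" "d \<le> b"
  shows "abs_continuous_on c d u"
  unfolding abs_continuous_on_def
proof (intro allI impI)
  fix e :: real assume "e > 0"
  from assms(1)[unfolded abs_continuous_on_def, rule_format, OF this]
  obtain \<delta> where \<delta>: "\<delta> > 0" and *: "\<And>(I :: nat set) \<alpha> \<beta>.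
        finite I \<Longrightarrow> (\<forall>i\<in>I. a \<le> \<alpha> i \<and> \<alpha> i \<le> \<beta> i \<and> \<beta> i \<le> b) \<Longrightarrow>
        disjoint_family_on (\<lambda>i. {\<alpha> i<..<\<beta> i}) I \<Longrightarrow>
        (\<Sum>i\<in>I. \<beta> i - \<alpha> i) < \<delta> \<Longrightarrow> (\<Sum>i\<in>I. \<bar>u (\<beta> i) - u (\<alpha> i)\<bar>) < e"
    by blast
  show "\<exists>\<delta>>0. \<forall>(I :: nat set) \<alpha> \<beta>.
           finite I \<longrightarrow> (\<forall>i\<in>I. c \<le> \<alpha> i \<and> \<alpha> i \<le> \<beta> i \<and> \<beta> i \<le> d) \<longrightarrow>
           disjoint_family_on (\<lambda>i. {\<alpha> i<..<\<beta> i}) I \<longrightarrow>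
           (\<Sum>i\<in>I. \<beta> i - \<alpha> i) < \<delta> \<longrightarrow> (\<Sum>i\<in>I. \<bar>u (\<beta> i) - u (\<alpha> i)\<bar>) < e"
    using assms(2,3) by (intro exI[of _ \<delta>] conjI \<delta> allI impI *) force+
qed

text \<open>A single epsilon-delta argument behind the closure properties below: Lipschitz
  functions, differences, products, gluing and congruence only need an increment bound of this
  shape.\<close>

lemma abs_continuous_on_dominated:
  assumes u: "abs_continuous_on a b u" and v: "abs_continuous_on a b v"
    and C: "C \<ge> 0"
    and le: "\<And>\<alpha> \<beta>. a \<le> \<alpha> \<Longrightarrow> \<alpha> \<le> \<beta> \<Longrightarrow> \<beta> \<le> b \<Longrightarrow>
      \<bar>w \<beta> - w \<alpha>\<bar> \<le> C * (\<bar>u \<beta> - u \<alpha>\<bar> + \<bar>v \<beta> - v \<alpha>\<bar> + (\<beta> - \<alpha>))"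
  shows "abs_continuous_on a b w"
  unfolding abs_continuous_on_def
proof (intro allI impI)
  fix e :: real assume "e > 0"
  \<comment> \<open>One share for each of the three sums; \<open>C + 1\<close> keeps the denominator
    positive and the final bound strict even for \<open>C = 0\<close>.\<close>
  define e' where "e' = e / (3 * (C + 1))"
  have e': "e' > 0" and Ce: "C * (3 * e') < e"
    using \<open>e > 0\<close> C by (auto simp: e'_def field_simps)
  from u[unfolded abs_continuous_on_def, rule_format, OF e']
  obtain \<delta>1 where \<delta>1: "\<delta>1 > 0" and 1: "\<And>(I :: nat set) \<alpha> \<beta>.
        finite I \<Longrightarrow> (\<forall>i\<in>I. a \<le> \<alpha> i \<and> \<alpha> i \<le> \<beta> i \<and> \<beta> i \<le> b) \<Longrightarrow>
        disjoint_family_on (\<lambda>i. {\<alpha> i<..<\<beta> i}) I \<Longrightarrow>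
        (\<Sum>i\<in>I. \<beta> i - \<alpha> i) < \<delta>1 \<Longrightarrow> (\<Sum>i\<in>I. \<bar>u (\<beta> i) - u (\<alpha> i)\<bar>) < e'"
    by blast
  from v[unfolded abs_continuous_on_def, rule_format, OF e']
  obtain \<delta>2 where \<delta>2: "\<delta>2 > 0" and 2: "\<And>(I :: nat set) \<alpha> \<beta>.
        finite I \<Longrightarrow> (\<forall>i\<in>I. a \<le> \<alpha> i \<and> \<alpha> i \<le> \<beta> i \<and> \<beta> i \<le> b) \<Longrightarrow>
        disjoint_family_on (\<lambda>i. {\<alpha> i<..<\<beta> i}) I \<Longrightarrow>
        (\<Sum>i\<in>I. \<beta> i - \<alpha> i) < \<delta>2 \<Longrightarrow> (\<Sum>i\<in>I. \<bar>v (\<beta> i) - v (\<alpha> i)\<bar>) < e'"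
    by blast
  show "\<exists>\<delta>>0. \<forall>(I :: nat set) \<alpha> \<beta>.
           finite I \<longrightarrow> (\<forall>i\<in>I. a \<le> \<alpha> i \<and> \<alpha> i \<le> \<beta> i \<and> \<beta> i \<le> b) \<longrightarrow>
           disjoint_family_on (\<lambda>i. {\<alpha> i<..<\<beta> i}) I \<longrightarrow>
           (\<Sum>i\<in>I. \<beta> i - \<alpha> i) < \<delta> \<longrightarrow> (\<Sum>i\<in>I. \<bar>w (\<beta> i) - w (\<alpha> i)\<bar>) < e"
  proof (intro exI[of _ "min e' (min \<delta>1 \<delta>2)"] conjI allI impI)
    fix I :: "nat set" and \<alpha> \<beta> :: "nat \<Rightarrow> real"
    assume I: "finite I" "\<forall>i\<in>I. a \<le> \<alpha> i \<and> \<alpha> i \<le> \<beta> i \<and> \<beta> i \<le> b"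
      "disjoint_family_on (\<lambda>i. {\<alpha> i<..<\<beta> i}) I" "(\<Sum>i\<in>I. \<beta> i - \<alpha> i) < min e' (min \<delta>1 \<delta>2)"
    have "(\<Sum>i\<in>I. \<bar>w (\<beta> i) - w (\<alpha> i)\<bar>) \<le>
        (\<Sum>i\<in>I. C * (\<bar>u (\<beta> i) - u (\<alpha> i)\<bar> + \<bar>v (\<beta> i) - v (\<alpha> i)\<bar> + (\<beta> i - \<alpha> i)))"
      using I(2) by (intro sum_mono le) auto
    also have "\<dots> = C * ((\<Sum>i\<in>I. \<bar>u (\<beta> i) - u (\<alpha> i)\<bar>) + (\<Sum>i\<in>I. \<bar>v (\<beta> i) - v (\<alpha> i)\<bar>)
        + (\<Sum>i\<in>I. \<beta> i - \<alpha> i))"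
      by (simp add: sum.distrib flip: sum_distrib_left)
    also have "\<dots> \<le> C * (3 * e')"
      using 1[OF I(1,2,3)] 2[OF I(1,2,3)] I(4) C by (intro mult_left_mono) auto
    also note Ce
    finally show "(\<Sum>i\<in>I. \<bar>w (\<beta> i) - w (\<alpha> i)\<bar>) < e" .
  qed (use e' \<delta>1 \<delta>2 in auto)
qed

lemma abs_continuous_on_const: "abs_continuous_on a b (\<lambda>_. c)"
  unfolding abs_continuous_on_def by (auto intro: exI[of _ 1])

lemma abs_continuous_on_lipschitz:
  assumes "C \<ge> 0" "\<And>x y. x \<in> {a..b} \<Longrightarrow> y \<in> {a..b} \<Longrightarrow> \<bar>u y - u x\<bar> \<le> C * \<bar>y - x\<bar>"
  shows "abs_continuous_on a b u"
proof (rule abs_continuous_on_dominated[OF abs_continuous_on_const[of _ _ 0] abs_continuous_on_const[of _ _ 0] assms(1)])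
  show "\<bar>u \<beta> - u \<alpha>\<bar> \<le> C * (\<bar>0 - 0\<bar> + \<bar>0 - 0\<bar> + (\<beta> - \<alpha>))" if "a \<le> \<alpha>" "\<alpha> \<le> \<beta>" "\<beta> \<le> b" for \<alpha> \<beta>
    using assms(2)[of \<alpha> \<beta>] that by auto
qed

lemma abs_continuous_on_diff:
  assumes "abs_continuous_on a b u" "abs_continuous_on a b v"
  shows "abs_continuous_on a b (\<lambda>s. u s - v s)"
  by (rule abs_continuous_on_dominated[OF assms, of 1]) auto

lemma abs_continuous_on_mult:
  assumes u: "abs_continuous_on a b u" and v: "abs_continuous_on a b v"
  shows "abs_continuous_on a b (\<lambda>s. u s * v s)"
proof -
  have "bounded (u ` {a..b})" "bounded (v ` {a..b})"
    using u v by (auto intro!: compact_imp_bounded compact_continuous_image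
        abs_continuous_on_imp_continuous_on)
  then obtain B C where B: "B > 0" "\<And>s. s \<in> {a..b} \<Longrightarrow> \<bar>u s\<bar> \<le> B"
    and C: "C > 0" "\<And>s. s \<in> {a..b} \<Longrightarrow> \<bar>v s\<bar> \<le> C"
    unfolding bounded_pos by auto
  show ?thesis
  proof (rule abs_continuous_on_dominated[OF u v, of "B + C"])
    fix x y assume "a \<le> x" "x \<le> y" "y \<le> b"
    then have "x \<in> {a..b}" "y \<in> {a..b}" by auto
    have "\<bar>u y * v y - u x * v x\<bar> = \<bar>v y * (u y - u x) + u x * (v y - v x)\<bar>"
      by (simp add: algebra_simps)
    also have "\<dots> \<le> \<bar>v y\<bar> * \<bar>u y - u x\<bar> + \<bar>u x\<bar> * \<bar>v y - v x\<bar>"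
      by (metis abs_mult abs_triangle_ineq)
    also have "\<dots> \<le> (B + C) * \<bar>u y - u x\<bar> + (B + C) * \<bar>v y - v x\<bar>"
      using B C \<open>x \<in> _\<close> \<open>y \<in> _\<close> by (intro add_mono mult_right_mono) (auto simp: add_increasing add_increasing2)
    also have "\<dots> \<le> (B + C) * (\<bar>u y - u x\<bar> + \<bar>v y - v x\<bar> + (y - x))"
      using B(1) C(1) \<open>x \<le> y\<close> by (simp add: distrib_left)
    finally show "\<bar>u y * v y - u x * v x\<bar> \<le> (B + C) * (\<bar>u y - u x\<bar> + \<bar>v y - v x\<bar> + (y - x))" .
  qed (use B C in auto)
qed

lemma abs_continuous_on_C1:
  assumes der: "\<And>s. s \<in> {a..b} \<Longrightarrow> (u has_real_derivative u' s) (at s within {a..b})"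
    and cont: "continuous_on {a..b} u'"
  shows "abs_continuous_on a b u"
proof -
  have "bounded (u' ` {a..b})"
    using cont by (auto intro!: compact_imp_bounded compact_continuous_image)
  then obtain B where B: "B > 0" "\<And>s. s \<in> {a..b} \<Longrightarrow> \<bar>u' s\<bar> \<le> B"
    unfolding bounded_pos by auto
  show ?thesis
  proof (rule abs_continuous_on_lipschitz)
    show "\<bar>u y - u x\<bar> \<le> B * \<bar>y - x\<bar>" if "x \<in> {a..b}" "y \<in> {a..b}" for x y
      using field_differentiable_bound[of "{a..b}" u u' B y x] der B that by auto
  qed (use B in auto)
qed

text \<open>A family of intervals may contain one that straddles \<open>b\<close>. Instead of
  splitting it, \<open>u\<close> is truncated: \<open>u (min s b)\<close> and
  \<open>u (max s b)\<close> are absolutely continuous on all of \<open>[a, c]\<close>, and the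
  increments of \<open>u\<close> are at most the sum of theirs.\<close>

lemma abs_continuous_on_combine:
  assumes u: "abs_continuous_on a b u" and v: "abs_continuous_on b c u" and "a \<le> b" "b \<le> c"
  shows "abs_continuous_on a c u"
proof -
  \<comment> \<open>The second condition on \<open>k\<close> joins monotonicity with not leaving the
    original interval, so an admissible family is mapped to one that is still disjoint and has no
    larger total length.\<close>
  have *: "abs_continuous_on a c (\<lambda>s. u (k s))"
    if u: "abs_continuous_on p q u" and k: "\<And>s. s \<in> {a..c} \<Longrightarrow> k s \<in> {p..q}" and
      k2: "\<And>s s'. s \<le> s' \<Longrightarrow> k s \<le> k s' \<and> {k s<..<k s'} \<subseteq> {s<..<s'}" for p q k
    unfolding abs_continuous_on_def
  proof (intro allI impI)
    fix e :: real assume "e > 0"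
    from u[unfolded abs_continuous_on_def, rule_format, OF this]
    obtain \<delta> where \<delta>: "\<delta> > 0" and *: "\<And>(I :: nat set) \<alpha> \<beta>.
        finite I \<Longrightarrow> (\<forall>i\<in>I. p \<le> \<alpha> i \<and> \<alpha> i \<le> \<beta> i \<and> \<beta> i \<le> q) \<Longrightarrow>
        disjoint_family_on (\<lambda>i. {\<alpha> i<..<\<beta> i}) I \<Longrightarrow>
        (\<Sum>i\<in>I. \<beta> i - \<alpha> i) < \<delta> \<Longrightarrow> (\<Sum>i\<in>I. \<bar>u (\<beta> i) - u (\<alpha> i)\<bar>) < e"
      by blast
    have k3: "k s' - k s \<le> s' - s" if "s \<le> s'" for s s'
    proof (cases "k s < k s'")
      case True
      with k2[OF that] show ?thesis by (simp add: greaterThanLessThan_subseteq_greaterThanLessThan)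
    qed (use that in auto)
    show "\<exists>\<delta>>0. \<forall>(I :: nat set) \<alpha> \<beta>.
           finite I \<longrightarrow> (\<forall>i\<in>I. a \<le> \<alpha> i \<and> \<alpha> i \<le> \<beta> i \<and> \<beta> i \<le> c) \<longrightarrow>
           disjoint_family_on (\<lambda>i. {\<alpha> i<..<\<beta> i}) I \<longrightarrow>
           (\<Sum>i\<in>I. \<beta> i - \<alpha> i) < \<delta> \<longrightarrow> (\<Sum>i\<in>I. \<bar>u (k (\<beta> i)) - u (k (\<alpha> i))\<bar>) < e"
    proof (intro exI[of _ \<delta>] conjI \<delta> allI impI)
      fix I :: "nat set" and \<alpha> \<beta> :: "nat \<Rightarrow> real"
      assume I: "finite I" "\<forall>i\<in>I. a \<le> \<alpha> i \<and> \<alpha> i \<le> \<beta> i \<and> \<beta> i \<le> c"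
        "disjoint_family_on (\<lambda>i. {\<alpha> i<..<\<beta> i}) I" "(\<Sum>i\<in>I. \<beta> i - \<alpha> i) < \<delta>"
      show "(\<Sum>i\<in>I. \<bar>u (k (\<beta> i)) - u (k (\<alpha> i))\<bar>) < e"
      proof (rule *[where \<alpha> = "\<lambda>i. k (\<alpha> i)" and \<beta> = "\<lambda>i. k (\<beta> i)"])
        show "disjoint_family_on (\<lambda>i. {k (\<alpha> i)<..<k (\<beta> i)}) I"
          unfolding disjoint_family_on_def
        proof (intro ballI impI)
          fix i j assume ij: "i \<in> I" "j \<in> I" "i \<noteq> j"
          have "{k (\<alpha> i)<..<k (\<beta> i)} \<subseteq> {\<alpha> i<..<\<beta> i}" "{k (\<alpha> j)<..<k (\<beta> j)} \<subseteq> {\<alpha> j<..<\<beta> j}"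
            using k2[of "\<alpha> i" "\<beta> i"] k2[of "\<alpha> j" "\<beta> j"] I(2) ij by blast+
          moreover have "{\<alpha> i<..<\<beta> i} \<inter> {\<alpha> j<..<\<beta> j} = {}"
            using I(3) ij by (auto simp: disjoint_family_on_def)
          ultimately show "{k (\<alpha> i)<..<k (\<beta> i)} \<inter> {k (\<alpha> j)<..<k (\<beta> j)} = {}" by blast
        qed
        have "(\<Sum>i\<in>I. k (\<beta> i) - k (\<alpha> i)) \<le> (\<Sum>i\<in>I. \<beta> i - \<alpha> i)"
          using I(2) by (intro sum_mono k3) auto
        then show "(\<Sum>i\<in>I. k (\<beta> i) - k (\<alpha> i)) < \<delta>" using I(4) by linarith
        show "\<forall>i\<in>I. p \<le> k (\<alpha> i) \<and> k (\<alpha> i) \<le> k (\<beta> i) \<and> k (\<beta> i) \<le> q"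
        proof
          fix i assume "i \<in> I"
          then have "\<alpha> i \<in> {a..c}" "\<beta> i \<in> {a..c}" "\<alpha> i \<le> \<beta> i" using I(2) by force+
          then show "p \<le> k (\<alpha> i) \<and> k (\<alpha> i) \<le> k (\<beta> i) \<and> k (\<beta> i) \<le> q"
            using k[of "\<alpha> i"] k[of "\<beta> i"] k2[of "\<alpha> i" "\<beta> i"] by auto
        qed
      qed (rule I(1))
    qed
  qed
  have 1: "abs_continuous_on a c (\<lambda>s. u (min s b))"
    by (rule *[OF u]) (use assms(3,4) in \<open>auto simp: min_def\<close>)
  have 2: "abs_continuous_on a c (\<lambda>s. u (max s b))"
    by (rule *[OF v]) (use assms(3,4) in \<open>auto simp: max_def\<close>)
  show ?thesis
  proof (rule abs_continuous_on_dominated[OF 1 2, of 1])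
    show "\<bar>u y - u x\<bar> \<le> 1 * (\<bar>u (min y b) - u (min x b)\<bar> + \<bar>u (max y b) - u (max x b)\<bar> + (y - x))"
      if "a \<le> x" "x \<le> y" "y \<le> c" for x y
      using that by (cases "x \<le> b"; cases "y \<le> b") (auto simp: min_def max_def)
  qed auto
qed

lemma abs_continuous_on_cong:
  assumes "abs_continuous_on a b u" "\<And>s. s \<in> {a..b} \<Longrightarrow> u s = v s"
  shows "abs_continuous_on a b v"
proof (rule abs_continuous_on_dominated[OF assms(1) assms(1), of 1])
  show "\<bar>v y - v x\<bar> \<le> 1 * (\<bar>u y - u x\<bar> + \<bar>u y - u x\<bar> + (y - x))" if "a \<le> x" "x \<le> y" "y \<le> b" for x y
    using assms(2)[of x] assms(2)[of y] that by auto
qed auto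

section \<open>The fundamental theorem of calculus for absolutely continuous functions\<close>

lemma AE_lebesgue_iff_negligible:
  "(AE s in lebesgue. P s) \<longleftrightarrow> negligible {s. \<not> P s}"
proof
  assume "AE s in lebesgue. P s"
  then obtain N where "{s. \<not> P s} \<subseteq> N" "N \<in> null_sets lebesgue"
    by (auto simp: eventually_ae_filter)
  then show "negligible {s. \<not> P s}"
    by (metis negligible_iff_null_sets negligible_subset)
next
  assume "negligible {s. \<not> P s}"
  then show "AE s in lebesgue. P s"
    unfolding eventually_ae_filter negligible_iff_null_sets by auto
qed

text \<open>In a fine Riemann sum, tags outside the exceptional null set \<open>N\<close> are
  handled by differentiability, as in the classical gauge proof. Tags in \<open>N\<close> contribute
  nothing to the sum once \<open>f\<close> is set to 0 there, and their intervals have small total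
  length, so absolute continuity bounds the increments of \<open>u\<close> over them. Integrability
  of \<open>f\<close> is a conclusion, not a hypothesis.\<close>

lemma abs_continuous_on_has_integral:
  assumes ab: "a \<le> b" and ac: "abs_continuous_on a b u"
    and der: "AE s in lebesgue. s \<in> {a..b} \<longrightarrow>
      (u has_real_derivative f s) (at s within {a..b})"
  shows "(f has_integral (u b - u a)) {a..b}"
proof -
  define N where "N = {s \<in> {a..b}. \<not> (u has_real_derivative f s) (at s within {a..b})}"
  have N: "negligible N"
    using der unfolding AE_lebesgue_iff_negligible by (simp add: N_def)
  define f0 where "f0 = (\<lambda>s. if s \<in> N then 0 else f s)"
  have "(f0 has_integral (u b - u a)) (cbox a b)"
    unfolding has_integral
  proof (intro allI impI)
    fix e :: real assume "e > 0"
    then have "e/2 > 0" by simp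
    from ac[unfolded abs_continuous_on_def, rule_format, OF this]
    obtain \<delta> where \<delta>: "\<delta> > 0" and *: "\<And>(I :: nat set) \<alpha> \<beta>.
        finite I \<Longrightarrow> (\<forall>i\<in>I. a \<le> \<alpha> i \<and> \<alpha> i \<le> \<beta> i \<and> \<beta> i \<le> b) \<Longrightarrow>
        disjoint_family_on (\<lambda>i. {\<alpha> i<..<\<beta> i}) I \<Longrightarrow>
        (\<Sum>i\<in>I. \<beta> i - \<alpha> i) < \<delta> \<Longrightarrow> (\<Sum>i\<in>I. \<bar>u (\<beta> i) - u (\<alpha> i)\<bar>) < e/2"
      by blast
    have "N \<in> sets lebesgue" using N by (simp add: negligible_imp_sets)
    \<comment> \<open>The null set is covered by an open set of measure below the \<delta> of
      absolute continuity; this set will be the gauge at every tag in \<open>N\<close>.\<close>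
    then obtain T where T: "open T" "N \<subseteq> T" "T - N \<in> lmeasurable"
        "emeasure lebesgue (T - N) < ennreal \<delta>"
      using sets_lebesgue_outer_open \<delta> by metis
    have Tm: "T \<in> lmeasurable"
    proof -
      have "T = (T - N) \<union> N" using T(2) by auto
      then show ?thesis
        using T(3) N by (metis fmeasurable.Un negligible_imp_measurable)
    qed
    have "measure lebesgue T = measure lebesgue (T - N)"
      using measure_Diff_null_set[of T lebesgue N] N Tm by (simp add: negligible_iff_null_sets fmeasurableD)
    also have "\<dots> < \<delta>"
      using T(3,4) \<delta> by (simp add: emeasure_eq_measure2 fmeasurableD2 emeasure_eq_ennreal_measure ennreal_less_iff)
    finally have Tmeas: "measure lebesgue T < \<delta>" .
    define e1 where "e1 = e / (2 * (b - a) + 2)"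
    have e1: "e1 > 0" and e1b: "e1 * (b - a) < e/2"
      using \<open>e > 0\<close> ab by (auto simp: e1_def field_simps)
    have "\<forall>x. \<exists>d>0. x \<in> {a..b} - N \<longrightarrow>
         (\<forall>y\<in>{a..b}. norm (y-x) < d \<longrightarrow> norm (u y - u x - (y-x) * f x) \<le> e1 * norm (y-x))"
    proof
      fix x
      show "\<exists>d>0. x \<in> {a..b} - N \<longrightarrow>
         (\<forall>y\<in>{a..b}. norm (y-x) < d \<longrightarrow> norm (u y - u x - (y-x) * f x) \<le> e1 * norm (y-x))"
      proof (cases "x \<in> {a..b} - N")
        case True
        then have "(u has_real_derivative f x) (at x within {a..b})" by (auto simp: N_def)
        then show ?thesis
          using e1 unfolding has_field_derivative_def has_derivative_within_alt
          by (auto simp: mult.commute)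
      qed (auto intro: exI[of _ 1])
    qed
    then obtain d where d: "\<And>x. 0 < d x"
                 "\<And>x y. \<lbrakk>x \<in> {a..b} - N; y \<in> {a..b}; norm (y-x) < d x\<rbrakk>
                        \<Longrightarrow> norm (u y - u x - (y-x) * f x) \<le> e1 * norm (y-x)"
      by metis
    define \<gamma> where "\<gamma> = (\<lambda>x. if x \<in> N then T else ball x (d x))"
    show "\<exists>\<gamma>. gauge \<gamma> \<and> (\<forall>p. p tagged_division_of cbox a b \<and> \<gamma> fine p \<longrightarrow>
          norm ((\<Sum>(x, k)\<in>p. measure lborel k *\<^sub>R f0 x) - (u b - u a)) < e)"
    proof (intro exI[of _ \<gamma>] conjI allI impI)
      show "gauge \<gamma>" using T(1,2) d(1) by (auto simp: gauge_def \<gamma>_def)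
      fix p assume p: "p tagged_division_of cbox a b \<and> \<gamma> fine p"
      then have ptag: "p tagged_division_of cbox a b" and fine: "\<gamma> fine p" by auto
      have fin: "finite p" using ptag by blast
      have K: "\<exists>l r. K = {l..r} \<and> l \<le> x \<and> x \<le> r \<and> a \<le> l \<and> r \<le> b \<and> Inf K = l \<and> Sup K = r \<and> measure lborel K = r - l
           \<and> interior K = {l<..<r}" if "(x, K) \<in> p" for x K
      proof -
        have "x \<in> K" "K \<subseteq> {a..b}" "\<exists>l r. K = {l..r}" using tagged_division_ofD(2-4)[OF ptag that] by auto
        then show ?thesis by auto
      qed
      have ba: "b - a = (\<Sum>(x,K)\<in>p. Sup K - Inf K)" "u b - u a = (\<Sum>(x,K)\<in>p. u(Sup K) - u(Inf K))"
        using additive_tagged_division_1[where f= "\<lambda>x. x"] additive_tagged_division_1[where f= u]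
            \<open>a \<le> b\<close> ptag by auto
      define p1 where "p1 = {z \<in> p. fst z \<in> N}"
      define p2 where "p2 = {z \<in> p. fst z \<notin> N}"
      have p12: "p = p1 \<union> p2" "p1 \<inter> p2 = {}" "finite p1" "finite p2" "p1 \<subseteq> p" "p2 \<subseteq> p"
        using fin by (auto simp: p1_def p2_def)
      define F where "F = (\<lambda>(x,K). measure lborel K *\<^sub>R f0 x - (u(Sup K) - u(Inf K)))"
      have "norm (sum F p2) \<le> (\<Sum>(x,K)\<in>p2. e1 * (Sup K - Inf K))"
      proof (rule sum_norm_le, clarify)
        fix x K assume xK: "(x, K) \<in> p2"
        then have xp: "(x, K) \<in> p" "x \<notin> N" by (auto simp: p2_def)
        obtain l r where lr: "K = {l..r}" "l \<le> x" "x \<le> r" "a \<le> l" "r \<le> b" "Inf K = l" "Sup K = r" "measure lborel K = r - l"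
          using K[OF xp(1)] by blast
        have "K \<subseteq> \<gamma> x" using fineD[OF fine xp(1)] .
        then have "K \<subseteq> ball x (d x)" using xp(2) by (simp add: \<gamma>_def)
        moreover have "l \<in> K" "r \<in> K" using lr by auto
        ultimately have "l \<in> ball x (d x)" "r \<in> ball x (d x)" by blast+
        then have "norm (l - x) < d x" "norm (r - x) < d x"
          by (auto simp: dist_norm norm_minus_commute)
        then have "norm (u l - u x - (l-x) * f x) \<le> e1 * norm (l-x)"
          "norm (u r - u x - (r-x) * f x) \<le> e1 * norm (r-x)"
          using d(2)[of x l] d(2)[of x r] lr xp by auto
        moreover have "e1 * norm (l-x) + e1 * norm (r-x) = e1 * (r - l)"
          using lr by (simp add: algebra_simps)
        moreover have "F (x, K) = (u l - u x - (l-x) * f x) - (u r - u x - (r-x) * f x)"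
          using lr xp by (simp add: F_def f0_def algebra_simps)
        ultimately show "norm (F (x, K)) \<le> e1 * (Sup K - Inf K)"
          using lr by (smt (verit) real_norm_def)
      qed
      also have "\<dots> \<le> (\<Sum>(x,K)\<in>p. e1 * (Sup K - Inf K))"
      proof (rule sum_mono2[OF fin p12(6)])
        fix z assume "z \<in> p - p2"
        then obtain x k where "z = (x, k)" "(x, k) \<in> p" by (cases z) auto
        then show "0 \<le> (case z of (x, K) \<Rightarrow> e1 * (Sup K - Inf K))"
          using K[of x k] e1 by auto
      qed
      also have "\<dots> = e1 * (b - a)"
        unfolding ba by (simp add: sum_distrib_left case_prod_unfold)
      also note e1b
      finally have good: "norm (sum F p2) < e/2" .
      \<comment> \<open>Absolute continuity is stated for families indexed by sets of naturals, so
        the intervals with tag in \<open>N\<close> are enumerated.\<close>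
      obtain h where h: "bij_betw h {0..<card p1} p1"
        using ex_bij_betw_nat_finite[OF p12(3)] by blast
      have disj: "disjoint_family_on (\<lambda>z. interior (snd z)) p1"
        unfolding disjoint_family_on_def
        using tagged_division_ofD(5)[OF ptag] p12(5) by (metis prod.collapse subsetD)
      have int1: "interior (snd z) = {Inf (snd z)<..<Sup (snd z)} \<and> Inf (snd z) \<le> Sup (snd z)
          \<and> a \<le> Inf (snd z) \<and> Sup (snd z) \<le> b \<and> interior (snd z) \<subseteq> T" if zp: "z \<in> p1" for z
      proof -
        obtain x k where z: "z = (x, k)" "(x, k) \<in> p" "x \<in> N" using zp by (cases z) (auto simp: p1_def)
        have "k \<subseteq> T" using fineD[OF fine z(2)] z(3) by (simp add: \<gamma>_def)
        then show ?thesis using K[OF z(2)] z(1) by auto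
      qed
      have "(\<Sum>z\<in>p1. Sup (snd z) - Inf (snd z)) = (\<Sum>z\<in>p1. measure lebesgue (interior (snd z)))"
        by (rule sum.cong) (use int1 in auto)
      also have "\<dots> = measure lebesgue (\<Union>z\<in>p1. interior (snd z))"
      proof (rule measure_finite_Union[symmetric, OF p12(3) _ disj])
        show "emeasure lebesgue (interior (snd i)) \<noteq> \<infinity>" if "i \<in> p1" for i
          using int1[OF that] by simp
      qed auto
      also have "\<dots> \<le> measure lebesgue T"
        using int1 Tm by (intro measure_mono_fmeasurable) (auto intro!: sets.finite_UN p12)
      also note Tmeas
      finally have len: "(\<Sum>z\<in>p1. Sup (snd z) - Inf (snd z)) < \<delta>" .
      define \<alpha> where "\<alpha> = (\<lambda>i. Inf (snd (h i)))"
      define \<beta> where "\<beta> = (\<lambda>i. Sup (snd (h i)))"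
      have hI: "interior (snd (h i)) = {\<alpha> i<..<\<beta> i} \<and> a \<le> \<alpha> i \<and> \<alpha> i \<le> \<beta> i \<and> \<beta> i \<le> b \<and> h i \<in> p1"
        if "i \<in> {0..<card p1}" for i
        using int1[OF bij_betw_apply[OF h that]] bij_betw_apply[OF h that] by (simp add: \<alpha>_def \<beta>_def)
      have bnds: "\<forall>i\<in>{0..<card p1}. a \<le> \<alpha> i \<and> \<alpha> i \<le> \<beta> i \<and> \<beta> i \<le> b"
        using hI by simp
      have disj': "disjoint_family_on (\<lambda>i. {\<alpha> i<..<\<beta> i}) {0..<card p1}"
        unfolding disjoint_family_on_def
      proof (intro ballI impI)
        fix i j assume ij: "i \<in> {0..<card p1}" "j \<in> {0..<card p1}" "i \<noteq> j"
        then have "h i \<noteq> h j"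
          using h by (auto simp: bij_betw_def inj_on_def)
        then have "interior (snd (h i)) \<inter> interior (snd (h j)) = {}"
          using disj hI[OF ij(1)] hI[OF ij(2)] unfolding disjoint_family_on_def by blast
        then show "{\<alpha> i<..<\<beta> i} \<inter> {\<alpha> j<..<\<beta> j} = {}"
          using hI[OF ij(1)] hI[OF ij(2)] by simp
      qed
      have "(\<Sum>i = 0..<card p1. \<beta> i - \<alpha> i) < \<delta>"
        using len sum.reindex_bij_betw[OF h, of "\<lambda>z. Sup (snd z) - Inf (snd z)"]
        unfolding \<alpha>_def \<beta>_def by linarith
      note *[OF finite_atLeastLessThan bnds disj' this]
      then have "(\<Sum>z\<in>p1. \<bar>u (Sup (snd z)) - u (Inf (snd z))\<bar>) < e/2"
        using sum.reindex_bij_betw[OF h, of "\<lambda>z. \<bar>u (Sup (snd z)) - u (Inf (snd z))\<bar>"]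
        unfolding \<alpha>_def \<beta>_def by linarith
      moreover have "norm (sum F p1) \<le> (\<Sum>z\<in>p1. \<bar>u (Sup (snd z)) - u (Inf (snd z))\<bar>)"
        by (rule sum_norm_le) (auto simp: F_def f0_def p1_def)
      ultimately have bad: "norm (sum F p1) < e/2" by linarith
      have "(\<Sum>(x, k)\<in>p. measure lborel k *\<^sub>R f0 x) - (u b - u a) = sum F p"
        unfolding ba(2) F_def by (simp add: sum_subtractf case_prod_unfold)
      also have "\<dots> = sum F p1 + sum F p2"
        using p12 by (metis sum.union_disjoint)
      finally have eq: "(\<Sum>(x, k)\<in>p. measure lborel k *\<^sub>R f0 x) - (u b - u a) = sum F p1 + sum F p2" .
      show "norm ((\<Sum>(x, k)\<in>p. measure lborel k *\<^sub>R f0 x) - (u b - u a)) < e"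
        unfolding eq using good bad norm_triangle_ineq[of "sum F p1" "sum F p2"] by linarith
    qed
  qed
  then show ?thesis
    unfolding box_real by (rule has_integral_spike[OF N, rotated]) (auto simp: f0_def)
qed

section \<open>Weak derivatives\<close>

text \<open>Gives membership in \<open>W11\<close> for every curve that is written as a primitive.
  This is integration by parts against test functions, whose boundary values vanish.\<close>

lemma weak_derivative_indefinite_integral:
  fixes g :: "real \<Rightarrow> 'a::euclidean_space"
  assumes ab: "a \<le> b" and g: "g absolutely_integrable_on {a..b}"
    and \<xi>: "\<And>s. s \<in> {a..b} \<Longrightarrow> \<xi> s = \<xi> a + integral {a..s} g"
  shows "continuous_on {a..b} \<xi>" "has_weak_derivative a b \<xi> g"
proof -
  have gi: "g integrable_on {a..b}" and ngi: "(\<lambda>s. norm (g s)) integrable_on {a..b}"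
    using g by (auto simp: absolutely_integrable_on_def)
  have "continuous_on {a..b} (\<lambda>s. \<xi> a + integral {a..s} g)"
    by (intro continuous_intros indefinite_integral_continuous_1 gi)
  then show cont: "continuous_on {a..b} \<xi>"
    using \<xi> by (metis (no_types, lifting) continuous_on_cong)
  show "has_weak_derivative a b \<xi> g"
    unfolding has_weak_derivative_def
  proof (intro conjI g allI impI)
    fix \<eta> assume "test_function a b \<eta>"
    then obtain K where \<eta>: "\<eta> C1_differentiable_on UNIV" and K: "K \<subseteq> {a<..<b}" "\<And>s. s \<notin> K \<Longrightarrow> \<eta> s = 0"
      by (auto simp: test_function_def)
    have \<eta>d: "(\<eta> has_vector_derivative deriv \<eta> s) (at s)" for s
      using \<eta> by (simp add: C1_differentiable_on_eq field_differentiable_derivI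
          real_differentiable_def vector_derivative_works[symmetric] flip: has_real_derivative_iff_has_vector_derivative)
        (metis DERIV_imp_deriv UNIV_I real_differentiableE)
    then have \<eta>d': "vector_derivative \<eta> (at s) = deriv \<eta> s" for s
      by (simp add: vector_derivative_at)
    have \<eta>c: "continuous_on S (deriv \<eta>)" for S
      using \<eta> unfolding C1_differentiable_on_eq \<eta>d' by (meson continuous_on_subset subset_UNIV)
    have \<eta>c0: "continuous_on S \<eta>" for S
      using \<eta>d by (meson continuous_at_imp_continuous_on has_vector_derivative_continuous)
    have i1: "(\<lambda>s. deriv \<eta> s *\<^sub>R \<xi> s) absolutely_integrable_on {a..b}"
      by (intro absolutely_integrable_continuous_real continuous_intros \<eta>c cont)
    have i2: "(\<lambda>s. \<eta> s *\<^sub>R g s) absolutely_integrable_on {a..b}"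
      by (rule absolutely_integrable_bounded_measurable_product[OF bilinear_conv_bounded_bilinear[THEN iffD2, OF bounded_bilinear_scaleR] _ _ _ g])
        (auto intro!: compact_imp_bounded compact_continuous_image \<eta>c0 continuous_imp_measurable_on_sets_lebesgue)
    have i12: "(\<lambda>s. deriv \<eta> s *\<^sub>R \<xi> s + \<eta> s *\<^sub>R g s) integrable_on {a..b}"
      using i1 i2 by (auto simp: absolutely_integrable_on_def intro!: integrable_add)
    \<comment> \<open>Integration by parts without differentiating \<open>\<xi>\<close>: the increment of \<open>F\<close> over \<open>[p, q]\<close> is at most
      \<open>2 E (q - p) (G q - G p)\<close> with \<open>G\<close> continuous, so \<open>F\<close> has derivative zero everywhere.\<close>
    define F where "F = (\<lambda>s. integral {a..s} (\<lambda>s. deriv \<eta> s *\<^sub>R \<xi> s + \<eta> s *\<^sub>R g s) - \<eta> s *\<^sub>R \<xi> s)"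
    define G where "G = (\<lambda>s. integral {a..s} (\<lambda>s. norm (g s)))"
    have Gc: "continuous_on {a..b} G"
      unfolding G_def by (intro indefinite_integral_continuous_1 ngi)
    have "bounded (deriv \<eta> ` {a..b})"
      by (auto intro!: compact_imp_bounded compact_continuous_image \<eta>c)
    then obtain E where E: "E > 0" "\<And>s. s \<in> {a..b} \<Longrightarrow> \<bar>deriv \<eta> s\<bar> \<le> E"
      unfolding bounded_pos by auto
    have sub: "integral {a..q} f - integral {a..p} f = integral {p..q} f" "f integrable_on {p..q}"
      if "f integrable_on {a..b}" "a \<le> p" "p \<le> q" "q \<le> b" for f :: "real \<Rightarrow> 'c::euclidean_space" and p q
    proof -
      have "f integrable_on {a..q}" using that by (meson atLeastatMost_subset_iff integrable_on_subinterval order_refl)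
      from Henstock_Kurzweil_Integration.integral_combine[OF that(2,3) this]
      show "integral {a..q} f - integral {a..p} f = integral {p..q} f" by (simp add: algebra_simps)
      show "f integrable_on {p..q}" using that by (meson atLeastatMost_subset_iff integrable_on_subinterval)
    qed
    have key: "norm (F q - F p) \<le> 2 * E * (q - p) * (G q - G p)" if pq: "a \<le> p" "p \<le> q" "q \<le> b" for p q
    proof -
      have \<eta>int: "(deriv \<eta> has_integral (\<eta> s' - \<eta> s)) {s..s'}" if "s \<le> s'" for s s'
        by (rule fundamental_theorem_of_calculus[OF that])
          (auto intro: has_vector_derivative_at_within \<eta>d)
      have gint: "(g has_integral (\<xi> q - \<xi> s)) {s..q}" if "s \<in> {p..q}" for s
        using sub[OF gi, of s q] \<xi>[of s] \<xi>[of q] pq that by (simp add: has_integral_iff)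
      have Ginc: "integral {s..q} (\<lambda>s. norm (g s)) \<le> G q - G p" if "s \<in> {p..q}" for s
      proof -
        have "integral {s..q} (\<lambda>s. norm (g s)) \<le> integral {p..q} (\<lambda>s. norm (g s))"
          using that pq sub(2)[OF ngi] by (intro integral_subset_le) auto
        then show ?thesis using sub(1)[OF ngi, of p q] pq by (simp add: G_def)
      qed
      have \<xi>q: "norm (\<xi> s - \<xi> q) \<le> G q - G p" if s: "s \<in> {p..q}" for s
      proof -
        have "norm (integral {s..q} g) \<le> integral {s..q} (\<lambda>s. norm (g s))"
          using sub(2)[OF gi] sub(2)[OF ngi] s pq by (intro integral_norm_bound_integral) auto
        moreover have "integral {s..q} g = \<xi> q - \<xi> s" using gint[OF s] by (simp add: integral_unique)
        ultimately show ?thesis using Ginc[OF s] by (simp add: norm_minus_commute)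
      qed
      \<comment> \<open>Freezing \<xi> at \<open>q\<close> and \<eta> at \<open>p\<close> gives an
        integrand whose integral is exactly the increment of
        \<open>\<eta> s *\<^sub>R \<xi> s\<close>. The remainder consists of two terms, each with
        integral of norm at most \<open>E * (q - p) * (G q - G p)\<close>.\<close>
      have "((\<lambda>s. deriv \<eta> s *\<^sub>R \<xi> q) has_integral (\<eta> q - \<eta> p) *\<^sub>R \<xi> q) {p..q}"
        by (intro has_integral_scaleR_left \<eta>int pq)
      moreover have "((\<lambda>s. \<eta> p *\<^sub>R g s) has_integral \<eta> p *\<^sub>R (\<xi> q - \<xi> p)) {p..q}"
        by (intro has_integral_cmul gint) (use pq in auto)
      ultimately have 1: "((\<lambda>s. deriv \<eta> s *\<^sub>R \<xi> q + \<eta> p *\<^sub>R g s) has_integral (\<eta> q *\<^sub>R \<xi> q - \<eta> p *\<^sub>R \<xi> p)) {p..q}"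
        by (drule_tac has_integral_add) (auto simp: algebra_simps)
      have 2: "((\<lambda>s. deriv \<eta> s *\<^sub>R \<xi> s + \<eta> s *\<^sub>R g s) has_integral
          (integral {p..q} (\<lambda>s. deriv \<eta> s *\<^sub>R \<xi> s + \<eta> s *\<^sub>R g s))) {p..q}"
        using sub(2)[OF i12] pq by (auto intro: integrable_integral)
      have Fint: "((\<lambda>s. (deriv \<eta> s *\<^sub>R \<xi> s + \<eta> s *\<^sub>R g s) - (deriv \<eta> s *\<^sub>R \<xi> q + \<eta> p *\<^sub>R g s)) has_integral (F q - F p)) {p..q}"
        using has_integral_diff[OF 2 1] sub(1)[OF i12, of p q] pq by (simp add: F_def algebra_simps)
      have Bint: "((\<lambda>s. E * (G q - G p) + E * (q - p) * norm (g s)) has_integral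
           ((q - p) * (E * (G q - G p)) + E * (q - p) * (G q - G p))) {p..q}"
      proof (intro has_integral_add has_integral_mult_right)
        show "((\<lambda>s. E * (G q - G p)) has_integral ((q - p) * (E * (G q - G p)))) {p..q}"
          using has_integral_const_real[of "E * (G q - G p)" p q] pq by simp
        show "((\<lambda>s. norm (g s)) has_integral (G q - G p)) {p..q}"
          using sub[OF ngi, of p q] pq by (simp add: has_integral_iff G_def)
      qed
      have "norm (F q - F p) \<le> (q - p) * (E * (G q - G p)) + E * (q - p) * (G q - G p)"
      proof (subst integral_unique[OF Fint, symmetric], subst integral_unique[OF Bint, symmetric],
          rule integral_norm_bound_integral)
        fix s assume s: "s \<in> {p..q}"
        have "\<bar>\<eta> s - \<eta> p\<bar> \<le> E * (s - p)"
          using field_differentiable_bound[of "{p..q}" \<eta> "deriv \<eta>" E s p] E(2) \<eta>d s pq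
          by (auto simp: has_real_derivative_iff_has_vector_derivative intro: has_vector_derivative_at_within)
        also have "\<dots> \<le> E * (q - p)" using s E(1) by auto
        finally have "norm ((\<eta> s - \<eta> p) *\<^sub>R g s) \<le> E * (q - p) * norm (g s)"
          by (simp add: mult_right_mono)
        moreover have "norm (deriv \<eta> s *\<^sub>R (\<xi> s - \<xi> q)) \<le> E * (G q - G p)"
          using E \<xi>q[OF s] s pq by (auto intro!: mult_mono)
        moreover have "(deriv \<eta> s *\<^sub>R \<xi> s + \<eta> s *\<^sub>R g s) - (deriv \<eta> s *\<^sub>R \<xi> q + \<eta> p *\<^sub>R g s)
            = deriv \<eta> s *\<^sub>R (\<xi> s - \<xi> q) + (\<eta> s - \<eta> p) *\<^sub>R g s"
          by (simp add: algebra_simps)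
        ultimately show "norm ((deriv \<eta> s *\<^sub>R \<xi> s + \<eta> s *\<^sub>R g s) - (deriv \<eta> s *\<^sub>R \<xi> q + \<eta> p *\<^sub>R g s))
            \<le> E * (G q - G p) + E * (q - p) * norm (g s)"
          by (metis norm_triangle_le add_mono)
      qed (use Fint Bint in auto)
      then show ?thesis by (simp add: algebra_simps)
    qed
    have "(F has_vector_derivative 0) (at p within {a..b})" if p: "p \<in> {a..b}" for p
      unfolding has_vector_derivative_def has_derivative_within_alt
    proof (intro conjI allI impI)
      fix e :: real assume "e > 0"
      then have "e / (2 * E) > 0" using E by simp
      then obtain d where d: "d > 0" "\<And>q. q \<in> {a..b} \<Longrightarrow> dist q p < d \<Longrightarrow> dist (G q) (G p) < e / (2 * E)"
        using Gc p unfolding continuous_on_iff by blast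
      show "\<exists>d>0. \<forall>y\<in>{a..b}. norm (y - p) < d \<longrightarrow>
           norm (F y - F p - (y - p) *\<^sub>R 0) \<le> e * norm (y - p)"
      proof (intro exI conjI ballI impI)
        fix y assume y: "y \<in> {a..b}" "norm (y - p) < d"
        have "norm (F y - F p) \<le> 2 * E * \<bar>y - p\<bar> * \<bar>G y - G p\<bar>"
        proof (cases "p \<le> y")
          case True
          then have "norm (F y - F p) \<le> 2 * E * (y - p) * (G y - G p)" using key[of p y] y p by auto
          also have "\<dots> \<le> 2 * E * (y - p) * \<bar>G y - G p\<bar>" using True E(1) by (intro mult_left_mono) auto
          finally show ?thesis using True by simp
        next
          case False
          then have "norm (F p - F y) \<le> 2 * E * (p - y) * (G p - G y)" using key[of y p] y p by auto
          also have "\<dots> \<le> 2 * E * (p - y) * \<bar>G p - G y\<bar>" using False E(1) by (intro mult_left_mono) auto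
          finally show ?thesis using False by (simp add: norm_minus_commute abs_minus_commute)
        qed
        also have "\<dots> \<le> 2 * E * \<bar>y - p\<bar> * (e / (2 * E))"
          using d(2)[of y] y E by (intro mult_left_mono) (auto simp: dist_real_def)
        finally show "norm (F y - F p - (y - p) *\<^sub>R 0) \<le> e * norm (y - p)"
          using E(1) by (simp add: mult.commute)
      qed (rule d)
    qed (rule bounded_linear_scaleR_left)
    then have "F b = F a"
      using has_vector_derivative_zero_constant[of "{a..b}" F] ab by (auto simp: convex_real_interval)
    moreover have "\<eta> a = 0" "\<eta> b = 0" using K by force+
    ultimately have "integral {a..b} (\<lambda>s. deriv \<eta> s *\<^sub>R \<xi> s + \<eta> s *\<^sub>R g s) = 0"
      by (simp add: F_def)
    moreover have "integral {a..b} (\<lambda>s. deriv \<eta> s *\<^sub>R \<xi> s + \<eta> s *\<^sub>R g s) =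
        (LINT s:{a..b}|lebesgue. deriv \<eta> s *\<^sub>R \<xi> s) + (LINT s:{a..b}|lebesgue. \<eta> s *\<^sub>R g s)"
      unfolding set_lebesgue_integral_eq_integral(2)[OF i1] set_lebesgue_integral_eq_integral(2)[OF i2]
      using i1 i2 by (intro integral_add) (auto simp: absolutely_integrable_on_def)
    ultimately show "(LINT s:{a..b}|lebesgue. deriv \<eta> s *\<^sub>R \<xi> s) = - (LINT s:{a..b}|lebesgue. \<eta> s *\<^sub>R g s)"
      by (simp add: eq_neg_iff_add_eq_0)
  qed
qed

lemma du_Bois_Reymond_real:
  fixes d :: "real \<Rightarrow> real"
  assumes d: "continuous_on {a..b} d" and ab: "a < b"
    and orth: "\<And>\<eta>. test_function a b \<eta> \<Longrightarrow> integral {a..b} (\<lambda>s. deriv \<eta> s * d s) = 0"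
    and p: "p \<in> {a<..<b}" and q: "q \<in> {a<..<b}"
  shows "d p = d q"
proof -
  \<comment> \<open>The support \<open>[a', b']\<close> lies strictly inside \<open>(a, b)\<close>,
    as \<open>test_function\<close> demands, and contains both \<open>p\<close> and \<open>q\<close>
    in its interior.\<close>
  define a' where "a' = (a + min p q) / 2"
  define b' where "b' = (b + max p q) / 2"
  have ab': "a < a'" "a' < p" "a' < q" "p < b'" "q < b'" "b' < b" "a' < b'"
    using p q by (auto simp: a'_def b'_def min_def max_def)
  \<comment> \<open>Test with the primitive of \<open>\<psi> (d - c)\<close>, where \<open>\<psi>\<close> is a cut-off and \<open>c\<close> the \<open>\<psi>\<close>-mean of \<open>d\<close>;
    this gives \<open>\<integral> \<psi> (d - c)\<^sup>2 = 0\<close>.\<close>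
  define \<psi> where "\<psi> = (\<lambda>s. max 0 ((s - a') * (b' - s)))"
  have \<psi>0: "\<psi> s = 0" if "s \<notin> {a'<..<b'}" for s
  proof -
    have "(s - a') * (b' - s) \<le> 0"
    proof (cases "s \<le> a'")
      case True
      then show ?thesis using ab'(7) by (intro mult_nonpos_nonneg) auto
    next
      case False
      then show ?thesis using that by (intro mult_nonneg_nonpos) auto
    qed
    then show ?thesis by (simp add: \<psi>_def)
  qed
  have \<psi>pos: "\<psi> s > 0" if "s \<in> {a'<..<b'}" for s
    using that by (auto simp: \<psi>_def max_def)
  have \<psi>nn: "\<psi> s \<ge> 0" for s by (simp add: \<psi>_def)
  \<comment> \<open>A test function has to be \<open>C1\<close> on the whole line, so
    \<open>d\<close> is extended by constants.\<close>
  define D where "D = (\<lambda>s. d (max a (min b s)))"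
  have Dd: "D s = d s" if "s \<in> {a..b}" for s using that by (auto simp: D_def)
  have Dc: "continuous_on S D" for S
    unfolding D_def using ab
    by (intro continuous_on_compose2[OF d] continuous_intros) auto
  have \<psi>c: "continuous_on S \<psi>" for S unfolding \<psi>_def by (intro continuous_intros)
  define c where "c = integral {a..b} (\<lambda>s. \<psi> s * D s) / integral {a..b} \<psi>"
  have "integral {a..b} \<psi> \<noteq> 0"
    using integral_eq_0_iff[OF \<psi>c ab \<psi>nn] \<psi>pos[of p] ab' p by force
  then have cc: "integral {a..b} (\<lambda>s. \<psi> s * D s) = c * integral {a..b} \<psi>" by (simp add: c_def)
  define k where "k = (\<lambda>s. \<psi> s * (D s - c))"
  have kc: "continuous_on S k" for S unfolding k_def by (intro continuous_intros \<psi>c Dc)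
  have ki: "k integrable_on {u..v}" for u v by (intro integrable_continuous_real kc)
  have k0: "k s = 0" if "s \<notin> {a'<..<b'}" for s using \<psi>0[OF that] by (simp add: k_def)
  \<comment> \<open>This is what the choice of \<open>c\<close> achieves: with total integral zero,
    the primitive \<eta> vanishes again to the right of \<open>b'\<close>.\<close>
  have kab: "integral {a..b} k = 0"
  proof -
    have "integral {a..b} k = integral {a..b} (\<lambda>s. \<psi> s * D s) - integral {a..b} (\<lambda>s. c * \<psi> s)"
      unfolding k_def by (subst integral_diff[symmetric])
        (auto intro!: integrable_continuous_real continuous_intros \<psi>c Dc simp: algebra_simps)
    then show ?thesis by (simp add: cc)
  qed
  define \<eta> where "\<eta> = (\<lambda>s. integral {a..s} k)"
  have \<eta>0: "\<eta> s = 0" if "s \<notin> {a'..b'}" for s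
  proof (cases "s < a'")
    case True
    then have "integral {a..s} k = integral {a..s} (\<lambda>_. 0)"
      by (intro integral_cong k0) auto
    then show ?thesis by (simp add: \<eta>_def)
  next
    case False
    then have s: "s > b'" using that by auto
    have *: "integral {a..v} k = integral {a..b'} k" if "v > b'" for v
    proof -
      have "integral {b'..v} k = integral {b'..v} (\<lambda>_. 0)"
        by (intro integral_cong k0) auto
      moreover have "integral {a..b'} k + integral {b'..v} k = integral {a..v} k"
        using that ab' by (intro Henstock_Kurzweil_Integration.integral_combine ki) auto
      ultimately show ?thesis by simp
    qed
    show ?thesis using *[OF s] *[OF ab'(6)] kab by (simp add: \<eta>_def)
  qed
  have \<eta>d: "(\<eta> has_real_derivative k s) (at s)" for s
  proof (cases "s < a'")
    case True
    have "\<forall>\<^sub>F s' in nhds s. \<eta> s' = 0"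
      using eventually_nhds_in_open[of "{..<a'}" s] True by (auto elim!: eventually_mono intro: \<eta>0)
    then show ?thesis
      using k0[of s] True by (subst DERIV_cong_ev[OF refl _ refl, of _ "\<lambda>_. 0"]) auto
  next
    case False
    then have "s \<in> {a<..<s+1}" using ab' by auto
    moreover have "(\<eta> has_real_derivative k s) (at s within {a..s+1})"
      unfolding \<eta>_def using calculation by (intro integral_has_real_derivative kc) auto
    ultimately show ?thesis
      by (metis at_within_interior interior_atLeastAtMost_real)
  qed
  then have dn: "deriv \<eta> = k" by (auto intro!: DERIV_imp_deriv)
  have "test_function a b \<eta>"
    unfolding test_function_def
  proof (intro conjI exI[of _ "{a'..b'}"])
    show "\<eta> C1_differentiable_on UNIV"
      unfolding C1_differentiable_on_def using \<eta>d kc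
      by (auto simp: has_real_derivative_iff_has_vector_derivative)
  qed (use ab' \<eta>0 in auto)
  from orth[OF this] have kd: "integral {a..b} (\<lambda>s. k s * d s) = 0" by (simp add: dn)
  have "integral {a..b} (\<lambda>s. \<psi> s * (D s - c)\<^sup>2) = integral {a..b} (\<lambda>s. k s * d s - c * k s)"
    by (intro integral_cong) (auto simp: k_def Dd power2_eq_square algebra_simps)
  also have "\<dots> = integral {a..b} (\<lambda>s. k s * d s) - c * integral {a..b} k"
    by (subst integral_diff) (auto intro!: integrable_continuous_real continuous_intros kc d)
  also have "\<dots> = 0" using kd kab by simp
  finally have "\<forall>s\<in>{a..b}. \<psi> s * (D s - c)\<^sup>2 = 0"
    by (subst (asm) integral_eq_0_iff) (auto intro!: continuous_intros \<psi>c Dc ab mult_nonneg_nonneg \<psi>nn)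
  then have "d s = c" if "s \<in> {a'<..<b'}" for s
  proof -
    have s: "s \<in> {a..b}" using that ab' by auto
    then have "\<psi> s * (D s - c)\<^sup>2 = 0" using \<open>\<forall>s\<in>{a..b}. _\<close> by blast
    then show ?thesis using \<psi>pos[OF that] Dd[OF s] by simp
  qed
  then show ?thesis using ab' by force
qed

text \<open>The difference of \<xi> and the primitive of \<open>g\<close> has weak derivative zero.
  Each of its components is constant on the open interval by the du Bois-Reymond argument, and
  continuity extends this to the endpoints.\<close>

lemma has_weak_derivative_indefinite_integral:
  fixes \<xi> :: "real \<Rightarrow> 'a::euclidean_space"
  assumes ab: "a < b" and \<xi>: "continuous_on {a..b} \<xi>" and g: "has_weak_derivative a b \<xi> g"
    and s: "s \<in> {a..b}"
  shows "\<xi> s = \<xi> a + integral {a..s} g"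
proof -
  define \<zeta> where "\<zeta> = (\<lambda>s. integral {a..s} g)"
  have gi: "g absolutely_integrable_on {a..b}" using g by (simp add: has_weak_derivative_def)
  have \<zeta>: "continuous_on {a..b} \<zeta>" "has_weak_derivative a b \<zeta> g"
    using weak_derivative_indefinite_integral[of a b g \<zeta>] ab gi by (auto simp: \<zeta>_def)
  define d where "d = (\<lambda>s. \<xi> s - \<zeta> s)"
  have dc: "continuous_on {a..b} d" unfolding d_def by (intro continuous_intros \<xi> \<zeta>)
  have const: "d p = d q" if pq: "p \<in> {a<..<b}" "q \<in> {a<..<b}" for p q
  proof (rule euclidean_eqI)
    fix i :: 'a assume "i \<in> Basis"
    show "d p \<bullet> i = d q \<bullet> i"
    proof (rule du_Bois_Reymond_real[OF _ ab _ pq])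
      show "continuous_on {a..b} (\<lambda>s. d s \<bullet> i)" by (intro continuous_intros dc)
      fix \<eta> assume \<eta>: "test_function a b \<eta>"
      have \<eta>c: "continuous_on {a..b} (deriv \<eta>)"
      proof -
        obtain D where D: "\<And>s. (\<eta> has_vector_derivative D s) (at s)" "continuous_on UNIV D"
          using \<eta> unfolding test_function_def C1_differentiable_on_def by auto
        then have "deriv \<eta> = D"
          by (auto intro!: DERIV_imp_deriv simp: has_real_derivative_iff_has_vector_derivative)
        then show ?thesis using D(2) continuous_on_subset by blast
      qed
      have i: "(\<lambda>s. deriv \<eta> s *\<^sub>R f s) absolutely_integrable_on {a..b}" if "continuous_on {a..b} f" for f :: "real \<Rightarrow> 'a"
        by (intro absolutely_integrable_continuous_real continuous_intros \<eta>c that)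
      have "integral {a..b} (\<lambda>s. deriv \<eta> s *\<^sub>R \<xi> s) = integral {a..b} (\<lambda>s. deriv \<eta> s *\<^sub>R \<zeta> s)"
        using g \<zeta>(2) \<eta> unfolding has_weak_derivative_def
        by (metis set_lebesgue_integral_eq_integral(2)[OF i[OF \<xi>]] set_lebesgue_integral_eq_integral(2)[OF i[OF \<zeta>(1)]])
      then have "integral {a..b} (\<lambda>s. deriv \<eta> s *\<^sub>R d s) = 0"
        unfolding d_def scaleR_diff_right
        by (subst integral_diff) (auto intro!: integrable_continuous_real continuous_intros \<eta>c \<xi> \<zeta>)
      moreover have "(\<lambda>s. deriv \<eta> s *\<^sub>R d s) integrable_on {a..b}"
        by (intro integrable_continuous_real continuous_intros \<eta>c dc)
      ultimately have "integral {a..b} (\<lambda>s. (deriv \<eta> s *\<^sub>R d s) \<bullet> i) = 0"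
        by (subst integral_component_eq) auto
      then show "integral {a..b} (\<lambda>s. deriv \<eta> s * (d s \<bullet> i)) = 0" by simp
    qed
  qed
  define m where "m = (a + b) / 2"
  have m: "m \<in> {a<..<b}" using ab by (simp add: m_def)
  have cl: "closure {a<..<b} = {a..b}" using ab by (rule closure_greaterThanLessThan)
  have "d s = d m" if "s \<in> {a..b}" for s
  proof (rule continuous_constant_on_closure[of "{a<..<b}"])
    show "d p = d m" if "p \<in> {a<..<b}" for p using that m by (rule const)
  qed (use cl dc that in simp_all)
  from this[OF s] this[of a] ab have "d s = d a" by auto
  moreover have "\<zeta> a = 0" by (simp add: \<zeta>_def)
  ultimately show ?thesis by (simp add: d_def \<zeta>_def algebra_simps)
qed

text \<open>Henstock's lemma makes the sum of
  \<open>norm (measure lborel k *\<^sub>R h x - integral k h)\<close> small. All these integrals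
  vanish, so the sum is a Riemann sum of \<open>norm (h x)\<close>, and \<open>norm (h x)\<close>
  has integral zero.\<close>

lemma indefinite_integral_zero_imp_negligible:
  fixes h :: "real \<Rightarrow> 'a::euclidean_space"
  assumes h: "h absolutely_integrable_on {a..b}"
    and zero: "\<And>s. s \<in> {a..b} \<Longrightarrow> integral {a..s} h = 0"
  shows "AE s in lebesgue. s \<in> {a..b} \<longrightarrow> h s = 0"
proof -
  have hi: "h integrable_on cbox a b" using h by (auto simp: absolutely_integrable_on_def)
  have sub0: "integral {p..q} h = 0" if "a \<le> p" "p \<le> q" "q \<le> b" for p q
  proof -
    have "h integrable_on {a..q}" using hi that by (auto intro: integrable_on_subinterval)
    from Henstock_Kurzweil_Integration.integral_combine[OF that(1,2) this]
    show ?thesis using zero[of p] zero[of q] that by auto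
  qed
  have "((\<lambda>s. norm (h s)) has_integral 0) (cbox a b)"
    unfolding has_integral
  proof (intro allI impI)
    fix e :: real assume "e > 0"
    obtain \<gamma> where \<gamma>: "gauge \<gamma>"
      "\<And>p. \<lbrakk>p tagged_partial_division_of (cbox a b); \<gamma> fine p\<rbrakk> \<Longrightarrow>
             (\<Sum>(x,k)\<in>p. norm (measure lborel k *\<^sub>R h x - integral k h)) < e"
      by (rule Henstock_lemma[OF hi \<open>e > 0\<close>]) blast
    show "\<exists>\<gamma>. gauge \<gamma> \<and> (\<forall>p. p tagged_division_of cbox a b \<and> \<gamma> fine p \<longrightarrow>
          norm ((\<Sum>(x, k)\<in>p. measure lborel k *\<^sub>R norm (h x)) - 0) < e)"
    proof (intro exI[of _ \<gamma>] conjI allI impI \<gamma>(1))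
      fix p assume p: "p tagged_division_of cbox a b \<and> \<gamma> fine p"
      have "(\<Sum>(x, k)\<in>p. measure lborel k *\<^sub>R norm (h x)) =
          (\<Sum>(x,k)\<in>p. norm (measure lborel k *\<^sub>R h x - integral k h))"
      proof (rule sum.cong[OF refl], clarify)
        fix x k assume "(x, k) \<in> p"
        then obtain l r where "k = {l..r}" "x \<in> k" "k \<subseteq> {a..b}"
          using p tagged_division_ofD(2-4)[of p "cbox a b" x k] by auto
        then have "integral k h = 0" using sub0[of l r] by auto
        then show "measure lborel k *\<^sub>R norm (h x) = norm (measure lborel k *\<^sub>R h x - integral k h)"
          by simp
      qed
      moreover have "\<dots> < e"
        using p by (intro \<gamma>(2)) (auto simp: tagged_division_of_def)
      moreover have "0 \<le> (\<Sum>(x, k)\<in>p. measure lborel k *\<^sub>R norm (h x))"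
        by (intro sum_nonneg) auto
      ultimately show "norm ((\<Sum>(x, k)\<in>p. measure lborel k *\<^sub>R norm (h x)) - 0) < e" by simp
    qed
  qed
  then have "integral {a..b} (\<lambda>s. norm (h s)) = 0" by (simp add: integral_unique)
  moreover have nh: "(\<lambda>s. norm (h s)) absolutely_integrable_on {a..b}"
    using h by (rule absolutely_integrable_norm[unfolded o_def])
  ultimately have "(LINT s:{a..b}|lebesgue. norm (h s)) = 0"
    by (simp add: set_lebesgue_integral_eq_integral)
  then have "(LINT s|lebesgue. indicator {a..b} s *\<^sub>R norm (h s)) = 0"
    by (simp add: set_lebesgue_integral_def)
  then have "AE s in lebesgue. indicator {a..b} s *\<^sub>R norm (h s) = 0"
    using nh by (subst (asm) integral_nonneg_eq_0_iff_AE) (auto simp: set_integrable_def)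
  then show ?thesis by eventually_elim (auto simp: indicator_def)
qed

lemma W11_weak_derivative:
  fixes \<xi> :: "real \<Rightarrow> 'a::euclidean_space"
  assumes "a < b" "\<xi> \<in> W11 a b"
  shows "weak_derivative a b \<xi> absolutely_integrable_on {a..b}"
    "\<And>s. s \<in> {a..b} \<Longrightarrow> \<xi> s = \<xi> a + integral {a..s} (weak_derivative a b \<xi>)"
proof -
  have w: "has_weak_derivative a b \<xi> (weak_derivative a b \<xi>)"
    using assms(2) unfolding weak_derivative_def W11_def by (blast intro: someI_ex[of "has_weak_derivative a b \<xi>"])
  show "weak_derivative a b \<xi> absolutely_integrable_on {a..b}"
    using w by (simp add: has_weak_derivative_def)
  show "\<xi> s = \<xi> a + integral {a..s} (weak_derivative a b \<xi>)" if "s \<in> {a..b}" for s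
    using has_weak_derivative_indefinite_integral[OF assms(1) _ w that] assms(2) by (simp add: W11_def)
qed

text \<open>Identifies the arbitrary choice in \<open>weak_derivative\<close> with a given density:
  two densities of the same curve differ by a function whose indefinite integral is zero.\<close>

lemma W11_indefinite_integral:
  fixes \<xi> :: "real \<Rightarrow> 'a::euclidean_space"
  assumes "a < b" "g absolutely_integrable_on {a..b}"
    and \<xi>: "\<And>s. s \<in> {a..b} \<Longrightarrow> \<xi> s = \<xi> a + integral {a..s} g"
  shows "\<xi> \<in> W11 a b" "AE s in lebesgue. s \<in> {a..b} \<longrightarrow> weak_derivative a b \<xi> s = g s"
proof -
  show W: "\<xi> \<in> W11 a b"
    unfolding W11_def
    using weak_derivative_indefinite_integral[OF less_imp_le[OF assms(1)] assms(2) \<xi>] by blast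
  let ?w = "weak_derivative a b \<xi>"
  note w = W11_weak_derivative[OF assms(1) W]
  have "AE s in lebesgue. s \<in> {a..b} \<longrightarrow> ?w s - g s = 0"
  proof (rule indefinite_integral_zero_imp_negligible)
    show "(\<lambda>s. ?w s - g s) absolutely_integrable_on {a..b}"
      using w(1) assms(2) by (rule set_integral_diff)
    fix s assume s: "s \<in> {a..b}"
    then have "?w integrable_on {a..s}" "g integrable_on {a..s}"
      using w(1) assms(2) by (auto simp: absolutely_integrable_on_def intro: integrable_on_subinterval)
    then show "integral {a..s} (\<lambda>s. ?w s - g s) = 0"
      using w(2)[OF s] \<xi>[OF s] by (simp add: integral_diff)
  qed
  then show "AE s in lebesgue. s \<in> {a..b} \<longrightarrow> ?w s = g s" by eventually_elim auto
qed

section \<open>Differential inequalities and ordinary differential equations\<close>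

text \<open>The derivative \<open>f\<close> is explicit data without any integrability demand, since
  the fundamental theorem supplies it. The differential inequalities below are imposed on
  \<open>f\<close> almost everywhere.\<close>

definition ac_with_derivative :: "real \<Rightarrow> real \<Rightarrow> (real \<Rightarrow> real) \<Rightarrow> (real \<Rightarrow> real) \<Rightarrow> bool" where
  "ac_with_derivative a b u f \<longleftrightarrow> abs_continuous_on a b u \<and>
     (AE s in lebesgue. s \<in> {a..b} \<longrightarrow> (u has_real_derivative f s) (at s within {a..b}))"

lemma ac_with_derivative_continuous_on: "ac_with_derivative a b u f \<Longrightarrow> continuous_on {a..b} u"
  by (simp add: ac_with_derivative_def abs_continuous_on_imp_continuous_on)

lemma ac_with_derivative_has_integral:
  "ac_with_derivative a b u f \<Longrightarrow> a \<le> b \<Longrightarrow> (f has_integral (u b - u a)) {a..b}"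
  by (auto simp: ac_with_derivative_def intro: abs_continuous_on_has_integral)

lemma ac_with_derivative_subset:
  assumes "ac_with_derivative a b u f" "a \<le> c" "d \<le> b"
  shows "ac_with_derivative c d u f"
  unfolding ac_with_derivative_def
proof
  show "abs_continuous_on c d u"
    using assms by (auto simp: ac_with_derivative_def intro: abs_continuous_on_subset)
  have "AE s in lebesgue. s \<in> {a..b} \<longrightarrow> (u has_real_derivative f s) (at s within {a..b})"
    using assms(1) by (simp add: ac_with_derivative_def)
  then show "AE s in lebesgue. s \<in> {c..d} \<longrightarrow> (u has_real_derivative f s) (at s within {c..d})"
    by eventually_elim (use assms(2,3) in \<open>auto intro: DERIV_subset\<close>)
qed

lemma ac_with_derivative_cong:
  assumes u: "ac_with_derivative a b u f" and uv: "\<And>s. s \<in> {a..b} \<Longrightarrow> u s = v s"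
    and fg: "AE s in lebesgue. s \<in> {a..b} \<longrightarrow> f s = g s"
  shows "ac_with_derivative a b v g"
  unfolding ac_with_derivative_def
proof
  show "abs_continuous_on a b v"
    using u uv by (auto simp: ac_with_derivative_def intro: abs_continuous_on_cong)
  have "AE s in lebesgue. s \<in> {a..b} \<longrightarrow> (u has_real_derivative f s) (at s within {a..b})"
    using u by (simp add: ac_with_derivative_def)
  with fg show "AE s in lebesgue. s \<in> {a..b} \<longrightarrow> (v has_real_derivative g s) (at s within {a..b})"
  proof eventually_elim
    case (elim s)
    then show ?case
      using has_field_derivative_transform_within[of u "g s" s "{a..b}" 1 v] uv by auto
  qed
qed

lemma ac_with_derivative_diff:
  assumes u: "ac_with_derivative a b u f" and v: "ac_with_derivative a b v g"
  shows "ac_with_derivative a b (\<lambda>s. u s - v s) (\<lambda>s. f s - g s)"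
  unfolding ac_with_derivative_def
proof
  show "abs_continuous_on a b (\<lambda>s. u s - v s)"
    using u v by (auto simp: ac_with_derivative_def intro: abs_continuous_on_diff)
  have "AE s in lebesgue. s \<in> {a..b} \<longrightarrow> (u has_real_derivative f s) (at s within {a..b})"
    "AE s in lebesgue. s \<in> {a..b} \<longrightarrow> (v has_real_derivative g s) (at s within {a..b})"
    using u v by (simp_all add: ac_with_derivative_def)
  then show "AE s in lebesgue. s \<in> {a..b} \<longrightarrow>
      ((\<lambda>s. u s - v s) has_real_derivative f s - g s) (at s within {a..b})"
    by eventually_elim (auto intro: derivative_intros)
qed

text \<open>The integrating factor of the Gronwall arguments; \<open>p\<close> is free so that the
  factor can be normalized at either end of the interval.\<close>

lemma ac_with_derivative_exp:
  assumes u: "ac_with_derivative a b u f"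
  shows "ac_with_derivative a b (\<lambda>s. exp (k * (s - p)) * u s) (\<lambda>s. exp (k * (s - p)) * (k * u s + f s))"
  unfolding ac_with_derivative_def
proof
  have "abs_continuous_on a b (\<lambda>s. exp (k * (s - p)))"
    by (rule abs_continuous_on_C1[where u' = "\<lambda>s. exp (k * (s - p)) * k"])
      (auto intro!: derivative_eq_intros continuous_intros)
  then show "abs_continuous_on a b (\<lambda>s. exp (k * (s - p)) * u s)"
    using u by (auto simp: ac_with_derivative_def intro: abs_continuous_on_mult)
  have "AE s in lebesgue. s \<in> {a..b} \<longrightarrow> (u has_real_derivative f s) (at s within {a..b})"
    using u by (simp add: ac_with_derivative_def)
  then show "AE s in lebesgue. s \<in> {a..b} \<longrightarrow> ((\<lambda>s. exp (k * (s - p)) * u s) has_real_derivative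
      exp (k * (s - p)) * (k * u s + f s)) (at s within {a..b})"
    by eventually_elim (auto intro!: derivative_eq_intros simp: algebra_simps)
qed

lemma AE_lebesgue_neq: "AE s in lebesgue. s \<noteq> (c::real)"
  using AE_lebesgue_iff_negligible[of "\<lambda>s. s \<noteq> c"] by simp

lemma ac_with_derivative_combine:
  assumes 1: "ac_with_derivative a b u f" and 2: "ac_with_derivative b c u f" and "a \<le> b" "b \<le> c"
  shows "ac_with_derivative a c u f"
  unfolding ac_with_derivative_def
proof
  show "abs_continuous_on a c u"
    using assms by (auto simp: ac_with_derivative_def intro: abs_continuous_on_combine)
  have "AE s in lebesgue. s \<in> {a..b} \<longrightarrow> (u has_real_derivative f s) (at s within {a..b})"
    "AE s in lebesgue. s \<in> {b..c} \<longrightarrow> (u has_real_derivative f s) (at s within {b..c})"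
    using 1 2 by (simp_all add: ac_with_derivative_def)
  with AE_lebesgue_neq[of b]
  show "AE s in lebesgue. s \<in> {a..c} \<longrightarrow> (u has_real_derivative f s) (at s within {a..c})"
  proof eventually_elim
    case (elim s)
    show ?case
    proof
      assume s: "s \<in> {a..c}"
      show "(u has_real_derivative f s) (at s within {a..c})"
      proof (cases "s < b")
        case True
        have "at s within {a..c} = at s within {a..b}"
          by (rule at_within_nhd[of s "{..<b}"]) (use True \<open>b \<le> c\<close> in auto)
        then show ?thesis using elim(2) s True by auto
      next
        case False
        then have sb: "b < s" using elim(1) by auto
        have "at s within {a..c} = at s within {b..c}"
          by (rule at_within_nhd[of s "{b<..}"]) (use sb \<open>a \<le> b\<close> in auto)
        then show ?thesis using elim(3) s sb by auto
      qed
    qed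
  qed
qed

lemma has_integral_le_AE:
  fixes f g :: "real \<Rightarrow> real"
  assumes "(f has_integral i) S" "(g has_integral j) S"
    and le: "AE s in lebesgue. s \<in> S \<longrightarrow> f s \<le> g s"
  shows "i \<le> j"
proof -
  define N where "N = {s. \<not> (s \<in> S \<longrightarrow> f s \<le> g s)}"
  have N: "negligible N" using le unfolding AE_lebesgue_iff_negligible N_def .
  have "((\<lambda>s. if s \<in> N then g s else f s) has_integral i) S"
    by (rule has_integral_spike[OF N _ assms(1)]) auto
  then show ?thesis
    using assms(2) by (rule has_integral_le) (auto simp: N_def)
qed

lemma ac_with_derivative_lower:
  assumes "ac_with_derivative a b u f" "a \<le> b" "(g has_integral I) {a..b}"
    and "AE s in lebesgue. s \<in> {a..b} \<longrightarrow> g s \<le> f s"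
  shows "I \<le> u b - u a"
  using has_integral_le_AE[OF assms(3) ac_with_derivative_has_integral[OF assms(1,2)] assms(4)] .

lemma ac_with_derivative_upper:
  assumes "ac_with_derivative a b u f" "a \<le> b" "(g has_integral I) {a..b}"
    and "AE s in lebesgue. s \<in> {a..b} \<longrightarrow> f s \<le> g s"
  shows "u b - u a \<le> I"
  using has_integral_le_AE[OF ac_with_derivative_has_integral[OF assms(1,2)] assms(3,4)] .

text \<open>After the last time \<open>s0\<close> before \<open>t\<close> at which \<open>D\<close>
  is nonpositive, \<open>D\<close> stays positive, so the inequality applies and
  \<open>exp (- K * (s - t)) * D s\<close> cannot increase. This is why the inequality is only asked
  for where \<open>D s > 0\<close>.\<close>

lemma gronwall_nonpos:
  assumes D: "ac_with_derivative a b D f" and Da: "D a \<le> 0" and t: "t \<in> {a..b}"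
    and le: "AE s in lebesgue. s \<in> {a..b} \<longrightarrow> D s > 0 \<longrightarrow> f s \<le> K * D s"
  shows "D t \<le> 0"
proof (rule ccontr)
  assume "\<not> D t \<le> 0"
  have cont: "continuous_on {a..t} D"
    using ac_with_derivative_continuous_on[OF D] t by (auto intro: continuous_on_subset)
  have "compact {r \<in> {a..t}. D r \<le> 0}"
  proof -
    have "closed {r \<in> {a..t}. D r \<le> 0}"
      by (intro continuous_on_closed_Collect_le cont continuous_intros)
    then show ?thesis by (auto simp: compact_eq_bounded_closed intro: bounded_subset[OF bounded_closed_interval[of a t]])
  qed
  moreover have "{r \<in> {a..t}. D r \<le> 0} \<noteq> {}" using Da t by auto
  ultimately obtain s0 where s0: "s0 \<in> {a..t}" "D s0 \<le> 0"
    and max: "\<And>r. r \<in> {a..t} \<Longrightarrow> D r \<le> 0 \<Longrightarrow> r \<le> s0"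
    using compact_attains_sup[of "{r \<in> {a..t}. D r \<le> 0}"] by auto
  have "ac_with_derivative s0 t D f"
    using D s0 t by (auto intro: ac_with_derivative_subset)
  note acd = ac_with_derivative_exp[OF this, of "-K" t]
  have "exp (- K * (t - t)) * D t - exp (- K * (s0 - t)) * D s0 \<le> 0"
  proof (rule ac_with_derivative_upper[OF acd _ has_integral_0])
    from le AE_lebesgue_neq[of s0]
    show "AE s in lebesgue. s \<in> {s0..t} \<longrightarrow> exp (- K * (s - t)) * (- K * D s + f s) \<le> 0"
    proof eventually_elim
      case (elim s)
      show ?case
      proof
        assume s: "s \<in> {s0..t}"
        then have "D s > 0" using elim(2) max[of s] s0(1) by force
        then have "f s \<le> K * D s" using elim(1) s s0 t by auto
        then show "exp (- K * (s - t)) * (- K * D s + f s) \<le> 0"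
          by (intro mult_nonneg_nonpos) auto
      qed
    qed
  qed (use s0 in auto)
  moreover have "exp (- K * (s0 - t)) * D s0 \<le> 0" using s0(2) by (intro mult_nonneg_nonpos) auto
  ultimately show False using \<open>\<not> D t \<le> 0\<close> by simp
qed

text \<open>A lower bound on the derivative controls the past by the future. Up to the first time
  \<open>s1\<close> after \<open>t\<close> at which \<open>U\<close> is at most \<open>M\<close>,
  the bound on \<open>f\<close> applies, and \<open>exp (K * (s - t)) * U s\<close> falls at a rate
  of at most \<open>c * exp (K * (b - a))\<close>. At \<open>s1\<close> this product is at most
  \<open>exp (K * (b - a)) * M\<close>.\<close>

lemma gronwall_backward:
  assumes U: "ac_with_derivative a b U f" and Ub: "U b \<le> M" and t: "t \<in> {a..b}"
    and nonneg: "K \<ge> 0" "c \<ge> 0" "M \<ge> 0"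
    and ge: "AE s in lebesgue. s \<in> {a..b} \<longrightarrow> U s \<ge> M \<longrightarrow> f s \<ge> - c - K * U s"
  shows "U t \<le> exp (K * (b - a)) * (M + c * (b - a))"
proof -
  have cont: "continuous_on {t..b} U"
    using ac_with_derivative_continuous_on[OF U] t by (auto intro: continuous_on_subset)
  have "compact {r \<in> {t..b}. U r \<le> M}"
  proof -
    have "closed {r \<in> {t..b}. U r \<le> M}"
      by (intro continuous_on_closed_Collect_le cont continuous_intros)
    then show ?thesis by (auto simp: compact_eq_bounded_closed intro: bounded_subset[OF bounded_closed_interval[of t b]])
  qed
  moreover have "{r \<in> {t..b}. U r \<le> M} \<noteq> {}" using Ub t by auto
  ultimately obtain s1 where s1: "s1 \<in> {t..b}" "U s1 \<le> M"
    and min: "\<And>r. r \<in> {t..b} \<Longrightarrow> U r \<le> M \<Longrightarrow> s1 \<le> r"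
    using compact_attains_inf[of "{r \<in> {t..b}. U r \<le> M}"] by auto
  have "ac_with_derivative t s1 U f"
    using U s1 t by (auto intro: ac_with_derivative_subset)
  note acd = ac_with_derivative_exp[OF this, of K t]
  let ?E = "exp (K * (b - a))"
  have Ele: "exp (K * (s - t)) \<le> ?E" if "s \<in> {t..s1}" for s
    using that t s1 nonneg by (auto intro!: mult_left_mono)
  have "- (c * ?E) * (s1 - t) \<le> exp (K * (s1 - t)) * U s1 - exp (K * (t - t)) * U t"
  proof (rule ac_with_derivative_lower[OF acd])
    show "((\<lambda>_. - (c * ?E)) has_integral - (c * ?E) * (s1 - t)) {t..s1}"
      using has_integral_const_real[of "- (c * ?E)" t s1] s1 by (simp add: mult.commute)
    from ge AE_lebesgue_neq[of s1]
    show "AE s in lebesgue. s \<in> {t..s1} \<longrightarrow> - (c * ?E) \<le> exp (K * (s - t)) * (K * U s + f s)"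
    proof eventually_elim
      case (elim s)
      show ?case
      proof
        assume s: "s \<in> {t..s1}"
        then have "U s > M" using elim(2) min[of s] s1(1) by force
        then have "- c \<le> K * U s + f s" using elim(1) s s1 t by auto
        then have "exp (K * (s - t)) * (- c) \<le> exp (K * (s - t)) * (K * U s + f s)"
          by (intro mult_left_mono) auto
        moreover have "c * exp (K * (s - t)) \<le> c * ?E" using Ele[OF s] nonneg by (intro mult_left_mono) auto
        ultimately show "- (c * ?E) \<le> exp (K * (s - t)) * (K * U s + f s)"
          by (simp add: mult.commute)
      qed
    qed
  qed (use s1 in auto)
  moreover have "exp (K * (s1 - t)) * U s1 \<le> ?E * M"
  proof -
    have "exp (K * (s1 - t)) * U s1 \<le> exp (K * (s1 - t)) * M" using s1(2) by (intro mult_left_mono) auto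
    also have "\<dots> \<le> ?E * M" using Ele[of s1] s1 nonneg by (intro mult_right_mono) auto
    finally show ?thesis .
  qed
  moreover have "c * ?E * (s1 - t) \<le> c * ?E * (b - a)"
    using s1 t nonneg by (intro mult_left_mono) auto
  ultimately show ?thesis by (simp add: algebra_simps)
qed

section \<open>Global solutions of scalar Lipschitz equations\<close>

lemma picard_global:
  fixes f :: "real \<Rightarrow> real \<Rightarrow> real"
  assumes ab: "a \<le> b" and f: "continuous_on ({a..b} \<times> UNIV) (\<lambda>(s, r). f s r)"
    and K: "K \<ge> 0" and lip: "\<And>s r r'. s \<in> {a..b} \<Longrightarrow> \<bar>f s r - f s r'\<bar> \<le> K * \<bar>r - r'\<bar>"
  obtains U where "U a = w" "\<And>s. s \<in> {a..b} \<Longrightarrow> (U has_real_derivative f s (U s)) (at s within {a..b})"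
proof -
  \<comment> \<open>The weight \<open>exp (m (s - a))\<close> makes the Picard operator a contraction on the whole interval.\<close>
  define m where "m = 2 * K + 1"
  have m: "m > 0" "K / m \<le> 1 / 2" using K by (auto simp: m_def field_simps)
  \<comment> \<open>\<open>V\<close> stands for \<open>exp (- m * (s - a)) * U s\<close>, so that
    the plain sup norm of \<open>V\<close> is the weighted norm of \<open>U\<close>.\<close>
  define F where "F = (\<lambda>(V :: real \<Rightarrow>\<^sub>C real) s. f s (exp (m * (s - a)) * V s))"
  have Fc: "continuous_on {a..b} (F V)" for V
  proof -
    have "continuous_on {a..b} (\<lambda>s. case (s, exp (m * (s - a)) * V s) of (s, r) \<Rightarrow> f s r)"
      by (rule continuous_on_compose2[OF f]) (auto intro!: continuous_intros)
    then show ?thesis by (simp add: F_def)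
  qed
  have Fi: "F V integrable_on {a..s}" if "s \<in> {a..b}" for V s
    using Fc[of V] that by (auto intro!: integrable_continuous_real intro: continuous_on_subset)
  define P where "P = (\<lambda>V s. exp (- m * (s - a)) * (w + integral {a..s} (F V)))"
  have Pc: "continuous_on (cbox a b) (P V)" for V
    unfolding P_def box_real using ab
    by (intro continuous_intros indefinite_integral_continuous_1 Fi) auto
  \<comment> \<open>The fixed point theorem is applied in the bounded continuous functions on the
    whole line; \<open>clamp\<close> extends from \<open>[a, b]\<close> by constants.\<close>
  have "\<exists>g :: real \<Rightarrow>\<^sub>C real. \<forall>s. g s = P V (clamp a b s)" for V
    using continuous_on_cbox_bcontfunE[OF Pc[of V]] by metis
  then obtain \<Phi> :: "(real \<Rightarrow>\<^sub>C real) \<Rightarrow> (real \<Rightarrow>\<^sub>C real)" where \<Phi>: "\<And>V s. \<Phi> V s = P V (clamp a b s)"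
    by metis
  have cl: "clamp a b s \<in> {a..b}" for s :: real
  proof -
    have "clamp a b s \<in> cbox a b" by (rule clamp_in_interval) (use ab in simp)
    then show ?thesis by simp
  qed
  have contr: "dist (\<Phi> V) (\<Phi> W) \<le> 1/2 * dist V W" for V W
  proof (rule dist_bound)
    fix s0 :: real
    define s where "s = clamp a b s0"
    have s: "s \<in> {a..b}" unfolding s_def by (rule cl)
    define N where "N = dist V W"
    have N: "N \<ge> 0" by (simp add: N_def)
    have hi: "((\<lambda>\<tau>. K * N * exp (m * (\<tau> - a))) has_integral
        (K * N * exp (m * (s - a)) / m - K * N * exp (m * (a - a)) / m)) {a..s}"
      using s m by (intro fundamental_theorem_of_calculus)
        (auto intro!: derivative_eq_intros simp flip: has_real_derivative_iff_has_vector_derivative)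
    have "\<bar>integral {a..s} (F V) - integral {a..s} (F W)\<bar> = norm (integral {a..s} (\<lambda>\<tau>. F V \<tau> - F W \<tau>))"
      using Fi[OF s] by (simp add: integral_diff)
    also have "\<dots> \<le> integral {a..s} (\<lambda>\<tau>. K * N * exp (m * (\<tau> - a)))"
    proof (rule integral_norm_bound_integral)
      fix \<tau> assume \<tau>: "\<tau> \<in> {a..s}"
      then have "\<tau> \<in> {a..b}" using s by auto
      then have "norm (F V \<tau> - F W \<tau>) \<le> K * \<bar>exp (m * (\<tau> - a)) * V \<tau> - exp (m * (\<tau> - a)) * W \<tau>\<bar>"
        unfolding F_def real_norm_def by (rule lip)
      also have "\<dots> = K * (exp (m * (\<tau> - a)) * dist (V \<tau>) (W \<tau>))"
        by (simp add: dist_real_def abs_mult flip: right_diff_distrib)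
      also have "\<dots> \<le> K * (exp (m * (\<tau> - a)) * N)"
        unfolding N_def using K by (intro mult_left_mono dist_bounded) auto
      finally show "norm (F V \<tau> - F W \<tau>) \<le> K * N * exp (m * (\<tau> - a))" by (simp add: mult_ac)
    qed (use hi Fi[OF s] in \<open>auto intro: integrable_diff\<close>)
    also have "\<dots> \<le> K * N * exp (m * (s - a)) / m"
      unfolding integral_unique[OF hi] using K N m by simp
    finally have 1: "\<bar>integral {a..s} (F V) - integral {a..s} (F W)\<bar> \<le> K * N * exp (m * (s - a)) / m" .
    have "dist (\<Phi> V s0) (\<Phi> W s0) = \<bar>exp (- m * (s - a)) * (integral {a..s} (F V) - integral {a..s} (F W))\<bar>"
      unfolding \<Phi> P_def s_def[symmetric] dist_real_def by (simp add: algebra_simps)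
    also have "\<dots> = exp (- m * (s - a)) * \<bar>integral {a..s} (F V) - integral {a..s} (F W)\<bar>"
      by (simp add: abs_mult)
    also have "\<dots> \<le> exp (- m * (s - a)) * (K * N * exp (m * (s - a)) / m)"
      using 1 by (intro mult_left_mono) auto
    also have "\<dots> = K / m * N * (exp (- m * (s - a)) * exp (m * (s - a)))" by simp
    also have "\<dots> = K / m * N" by (simp flip: exp_add)
    also have "\<dots> \<le> 1/2 * N" using m N by (intro mult_right_mono) auto
    finally show "dist (\<Phi> V s0) (\<Phi> W s0) \<le> 1/2 * dist V W" by (simp add: N_def)
  qed
  then have "\<exists>!V. \<Phi> V = V"
    by (intro banach_fix_type[of "1/2"]) auto
  then obtain V where V: "\<Phi> V = V" by blast
  have VP: "V s = P V s" if "s \<in> {a..b}" for s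
    using \<Phi>[of V s] V that clamp_cancel_cbox[of s a b] by simp
  define U where "U = (\<lambda>s. w + integral {a..s} (F V))"
  have FU: "F V s = f s (U s)" if "s \<in> {a..b}" for s
  proof -
    have "exp (m * (s - a)) * V s = (exp (m * (s - a)) * exp (- m * (s - a))) * U s"
      unfolding VP[OF that] P_def U_def by simp
    also have "\<dots> = U s" by (simp flip: exp_add)
    finally show ?thesis by (simp add: F_def)
  qed
  show ?thesis
  proof
    show "U a = w" by (simp add: U_def)
    fix s assume s: "s \<in> {a..b}"
    have "((\<lambda>s. integral {a..s} (F V)) has_real_derivative F V s) (at s within {a..b})"
      using Fc s by (rule integral_has_real_derivative)
    then show "(U has_real_derivative f s (U s)) (at s within {a..b})"
      unfolding U_def[abs_def] FU[OF s, unfolded U_def, symmetric]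
      by (auto intro!: derivative_eq_intros)
  qed
qed

section \<open>Curves and the value function\<close>

text \<open>The velocity \<open>g\<close> is carried along instead of
  \<open>weak_derivative a b \<xi>\<close>, which is a choice depending on the interval. Restriction
  and concatenation can then keep the same \<open>g\<close>, and passing to the chosen weak
  derivative happens only in the two conversion lemmas below.\<close>

definition curve :: "'n::finite lagrangian \<Rightarrow> real \<Rightarrow> real \<Rightarrow> (real \<Rightarrow> real^'n) \<Rightarrow>
    (real \<Rightarrow> real^'n) \<Rightarrow> (real \<Rightarrow> real) \<Rightarrow> bool" where
  "curve L a b \<xi> g U \<longleftrightarrow> g absolutely_integrable_on {a..b} \<and>
     (\<forall>s\<in>{a..b}. \<xi> s = \<xi> a + integral {a..s} g) \<and>
     ac_with_derivative a b U (\<lambda>s. L s (\<xi> s) (g s) (U s))"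

definition reachable :: "'n::finite lagrangian \<Rightarrow> (real^'n \<Rightarrow> real) \<Rightarrow> real \<Rightarrow> real^'n \<Rightarrow> real set" where
  "reachable L \<phi> t x = {U t |\<xi> g U. curve L 0 t \<xi> g U \<and> \<xi> t = x \<and> U 0 = \<phi> (\<xi> 0)}"

lemma curveD:
  assumes "curve L a b \<xi> g U"
  shows "g absolutely_integrable_on {a..b}" "\<And>s. s \<in> {a..b} \<Longrightarrow> \<xi> s = \<xi> a + integral {a..s} g"
    "ac_with_derivative a b U (\<lambda>s. L s (\<xi> s) (g s) (U s))"
  using assms unfolding curve_def by blast+

lemma curve_herglotz_solution:
  assumes c: "curve L a b \<xi> g U" and ab: "a < b"
  shows "\<xi> \<in> W11 a b" "herglotz_solution L a b (U a) \<xi> U"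
proof -
  note g = curveD(1,2)[OF c] and U = curveD(3)[OF c]
  show "\<xi> \<in> W11 a b" using W11_indefinite_integral(1)[OF ab g] .
  have w: "AE s in lebesgue. s \<in> {a..b} \<longrightarrow> weak_derivative a b \<xi> s = g s"
    using W11_indefinite_integral(2)[OF ab g] .
  have "ac_with_derivative a b U (\<lambda>s. L s (\<xi> s) (weak_derivative a b \<xi> s) (U s))"
    by (rule ac_with_derivative_cong[OF U refl]) (use w in eventually_elim, auto)
  then show "herglotz_solution L a b (U a) \<xi> U"
    by (simp add: herglotz_solution_def ac_with_derivative_def)
qed

lemma herglotz_solution_curve:
  assumes "a < b" "\<xi> \<in> W11 a b" "herglotz_solution L a b w \<xi> U"
  shows "curve L a b \<xi> (weak_derivative a b \<xi>) U" "U a = w"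
proof -
  show "curve L a b \<xi> (weak_derivative a b \<xi>) U"
    unfolding curve_def
  proof (intro conjI ballI)
    show "weak_derivative a b \<xi> absolutely_integrable_on {a..b}"
      using W11_weak_derivative(1)[OF assms(1,2)] .
    show "\<xi> s = \<xi> a + integral {a..s} (weak_derivative a b \<xi>)" if "s \<in> {a..b}" for s
      using W11_weak_derivative(2)[OF assms(1,2) that] .
    show "ac_with_derivative a b U (\<lambda>s. L s (\<xi> s) (weak_derivative a b \<xi> s) (U s))"
      using assms(3) by (simp add: herglotz_solution_def ac_with_derivative_def)
  qed
  show "U a = w" using assms(3) by (simp add: herglotz_solution_def)
qed

lemma curve_has_integral:
  assumes c: "curve L a b \<xi> g U" and "a \<le> p" "p \<le> q" "q \<le> b"
  shows "(g has_integral (\<xi> q - \<xi> p)) {p..q}"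
    and "(\<lambda>s. norm (g s)) integrable_on {p..q}"
    and "norm (\<xi> q - \<xi> p) \<le> integral {p..q} (\<lambda>s. norm (g s))"
proof -
  have gi: "g integrable_on {a..b}" and ngi: "(\<lambda>s. norm (g s)) integrable_on {a..b}"
    using curveD(1)[OF c] by (auto simp: absolutely_integrable_on_def)
  note \<xi> = curveD(2)[OF c]
  have "g integrable_on {a..q}" "g integrable_on {p..q}"
    using assms by (auto intro: integrable_on_subinterval[OF gi])
  moreover from Henstock_Kurzweil_Integration.integral_combine[OF assms(2,3) this(1)]
  have "integral {p..q} g = \<xi> q - \<xi> p"
    using \<xi>[of p] \<xi>[of q] assms by (simp add: algebra_simps)
  ultimately show 1: "(g has_integral (\<xi> q - \<xi> p)) {p..q}"
    by (simp add: has_integral_iff)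
  show 2: "(\<lambda>s. norm (g s)) integrable_on {p..q}"
    using assms by (auto intro: integrable_on_subinterval[OF ngi])
  show "norm (\<xi> q - \<xi> p) \<le> integral {p..q} (\<lambda>s. norm (g s))"
    using integral_norm_bound_integral[OF has_integral_integrable[OF 1] 2] integral_unique[OF 1] by simp
qed

lemma curve_subset:
  assumes c: "curve L a b \<xi> g U" and "a \<le> p" "p \<le> q" "q \<le> b"
  shows "curve L p q \<xi> g U"
  unfolding curve_def
proof (intro conjI ballI)
  show "g absolutely_integrable_on {p..q}"
    using absolutely_integrable_on_subinterval[OF curveD(1)[OF c]] assms(2,4) by auto
  show "\<xi> s = \<xi> p + integral {p..s} g" if "s \<in> {p..q}" for s
    using curve_has_integral(1)[OF c, of p s] that assms by (auto simp: integral_unique)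
  show "ac_with_derivative p q U (\<lambda>s. L s (\<xi> s) (g s) (U s))"
    using curveD(3)[OF c] assms(2,4) by (rule ac_with_derivative_subset)
qed

lemma curve_combine:
  assumes 1: "curve L a b \<xi> g U" and 2: "curve L b c \<xi>' g' U'" and ab: "a \<le> b" "b \<le> c"
    and eq: "\<xi> b = \<xi>' b" "U b = U' b"
  shows "curve L a c (\<lambda>s. if s \<le> b then \<xi> s else \<xi>' s) (\<lambda>s. if s \<le> b then g s else g' s)
    (\<lambda>s. if s \<le> b then U s else U' s)" (is "curve L a c ?\<xi> ?g ?U")
proof -
  note g = curveD(1)[OF 1] curveD(1)[OF 2] and U = curveD(3)[OF 1] curveD(3)[OF 2]
  have left: "integral {a..s} ?g = integral {a..s} g" if "s \<le> b" for s
    using that by (intro integral_cong) auto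
  have gl: "?g absolutely_integrable_on {a..b}"
    using g(1) by (rule absolutely_integrable_spike[of _ _ "{}"]) auto
  have gr: "?g absolutely_integrable_on {b..c}"
    using g(2) by (rule absolutely_integrable_spike[of _ _ "{b}"]) auto
  have right: "integral {b..s} ?g = integral {b..s} g'" for s
    by (rule integral_spike[of "{b}"]) auto
  have "?g absolutely_integrable_on {a..b} \<union> {b..c}"
    using gl gr by (rule absolutely_integrable_Un)
  then have gac: "?g absolutely_integrable_on {a..c}"
    using ab by (simp add: ivl_disj_un_two_touch)
  show ?thesis
    unfolding curve_def
  proof (intro conjI ballI gac)
    fix s assume s: "s \<in> {a..c}"
    have gi: "?g integrable_on {a..s}"
      using gac s by (auto simp: absolutely_integrable_on_def intro: integrable_on_subinterval)
    show "?\<xi> s = ?\<xi> a + integral {a..s} ?g"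
    proof (cases "s \<le> b")
      case True
      then show ?thesis
        using left[OF True] curve_has_integral(1)[OF 1, of a s] s ab by (simp add: integral_unique)
    next
      case False
      then have "integral {a..s} ?g = integral {a..b} ?g + integral {b..s} ?g"
        using Henstock_Kurzweil_Integration.integral_combine[OF ab(1) _ gi] by simp
      also have "\<dots> = (\<xi> b - \<xi> a) + (\<xi>' s - \<xi>' b)"
        unfolding right left[OF order_refl]
        using curve_has_integral(1)[OF 1, of a b] curve_has_integral(1)[OF 2, of b s] s ab False
        by (simp add: integral_unique)
      finally show ?thesis using False ab eq by simp
    qed
  next
    have "ac_with_derivative a b ?U (\<lambda>s. L s (?\<xi> s) (?g s) (?U s))"
      by (rule ac_with_derivative_cong[OF U(1)]) auto
    moreover have "ac_with_derivative b c ?U (\<lambda>s. L s (?\<xi> s) (?g s) (?U s))"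
    proof (rule ac_with_derivative_cong[OF U(2)])
      show "U' s = ?U s" if "s \<in> {b..c}" for s using that eq by auto
      from AE_lebesgue_neq[of b]
      show "AE s in lebesgue. s \<in> {b..c} \<longrightarrow>
        L s (\<xi>' s) (g' s) (U' s) = L s (?\<xi> s) (?g s) (?U s)"
        by eventually_elim auto
    qed
    ultimately show "ac_with_derivative a c ?U (\<lambda>s. L s (?\<xi> s) (?g s) (?U s))"
      using ab by (rule ac_with_derivative_combine)
  qed
qed

text \<open>One half of the dynamic programming principle: concatenation with an arbitrary
  continuation. The other half, restriction, is \<open>reachable_curve\<close>.\<close>

lemma reachable_extend:
  assumes z: "U s \<in> reachable L \<phi> s (\<zeta> s)" and c: "curve L s t \<zeta> g U" and st: "0 < s" "s \<le> t"
  shows "U t \<in> reachable L \<phi> t (\<zeta> t)"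
proof -
  obtain \<xi>0 g0 U0 where 0: "curve L 0 s \<xi>0 g0 U0" "\<xi>0 s = \<zeta> s" "U0 0 = \<phi> (\<xi>0 0)" "U s = U0 s"
    using z by (auto simp: reachable_def)
  let ?\<xi> = "\<lambda>r. if r \<le> s then \<xi>0 r else \<zeta> r"
  let ?U = "\<lambda>r. if r \<le> s then U0 r else U r"
  have "curve L 0 t ?\<xi> (\<lambda>r. if r \<le> s then g0 r else g r) ?U"
    using 0 st by (intro curve_combine[OF 0(1) c]) auto
  moreover have "?\<xi> t = \<zeta> t" "?U t = U t" "?U 0 = \<phi> (?\<xi> 0)" using 0 st by auto
  ultimately show ?thesis unfolding reachable_def by (smt (verit, best) mem_Collect_eq)
qed

lemma reachable_curve:
  assumes c: "curve L 0 t \<xi> g U" and "U 0 = \<phi> (\<xi> 0)" "s \<in> {0..t}"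
  shows "U s \<in> reachable L \<phi> s (\<xi> s)"
  using curve_subset[OF c, of 0 s] assms(2,3) by (auto simp: reachable_def)

section \<open>From the structure conditions to growth bounds on compact time intervals\<close>

lemma AE_le_imp_le:
  fixes f :: "real \<Rightarrow> real"
  assumes f: "continuous_on UNIV f" and ab: "a < b"
    and le: "AE t in lebesgue. t \<in> {a..b} \<longrightarrow> f t \<le> M" and t: "t \<in> {a..b}"
  shows "f t \<le> M"
proof (rule ccontr)
  assume "\<not> f t \<le> M"
  let ?S = "{s. M < f s}"
  \<comment> \<open>If the open set where \<open>f\<close> exceeds \<open>M\<close> met
    \<open>[a, b]\<close>, it would meet the open interval in a nonempty open set, and such a set is
    not negligible.\<close>
  have S: "open ?S" by (intro open_Collect_less f continuous_intros)
  have "t \<in> ?S \<inter> closure {a<..<b}"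
    using \<open>\<not> f t \<le> M\<close> t unfolding closure_greaterThanLessThan[OF ab] by auto
  then have "?S \<inter> {a<..<b} \<noteq> {}" using open_Int_closure_eq_empty[OF S] by blast
  moreover have "negligible (?S \<inter> {a<..<b})"
    using le unfolding AE_lebesgue_iff_negligible by (rule negligible_subset) auto
  moreover have "open (?S \<inter> {a<..<b})" using S by (rule open_Int) simp
  ultimately show False using open_not_negligible by blast
qed

text \<open>The form in which the conditions enter all later estimates: constants are uniform on
  compact time intervals, and superlinearity appears as a family of linear lower bounds, one for
  each slope \<open>A\<close>. Linear bounds can be integrated along a curve and yield its
  length.\<close>

locale growth_lagrangian =
  fixes L :: "'n::finite lagrangian"
  assumes continuous: "continuous_on UNIV (\<lambda>(t, x, v, r). L t x v r)"
    and lipschitz: "\<And>T. \<exists>K\<ge>0. \<forall>s\<in>{0..T}. \<forall>x v r r'. \<bar>L s x v r - L s x v r'\<bar> \<le> K * \<bar>r - r'\<bar>"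
    and coercive: "\<And>T A. \<exists>c\<ge>0. \<forall>s\<in>{0..T}. \<forall>x v. A * norm v - c \<le> L s x v 0"

lemma growth_lagrangianI:
  fixes L :: "'n::finite lagrangian"
  assumes C1: "C1_lagrangian L" and L2: "cond_L2 L" and L3: "cond_L3 L"
  shows "growth_lagrangian L"
proof
  obtain L' where L': "\<And>z. ((\<lambda>(t, x, v, r). L t x v r) has_derivative blinfun_apply (L' z)) (at z)"
    using C1 by (auto simp: C1_lagrangian_def C1_on_def)
  show cont: "continuous_on UNIV (\<lambda>(t, x, v, r). L t x v r)"
    by (rule differentiable_imp_continuous_on)
      (auto simp: differentiable_on_def differentiable_def intro: L' has_derivative_at_withinI)
  have contt: "continuous_on UNIV (\<lambda>t. L t x v r)" for x v r
  proof -
    have "continuous_on UNIV (\<lambda>t. (t, x, v, r))" by (intro continuous_intros)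
    from continuous_on_compose2[OF cont this] show ?thesis by simp
  qed
  \<comment> \<open>The coefficient \<open>f\<close> is bounded only almost everywhere; continuity
    of \<open>g\<close> in time promotes this to every time. The shape
    \<open>\<alpha> * f t + \<beta>\<close> serves both the Lipschitz estimate, with \<alpha> the
    distance of the two values, and the growth estimate, with \<alpha> equal to 1.
    \<open>max T 0 + 1\<close> keeps the time interval nondegenerate.\<close>
  have bound: "\<exists>M\<ge>0. \<forall>g :: real \<Rightarrow> real. \<forall>\<alpha> \<beta>. continuous_on UNIV g \<longrightarrow> \<alpha> \<ge> 0 \<longrightarrow> (\<forall>t. g t \<le> \<alpha> * f t + \<beta>) \<longrightarrow>
      (\<forall>t\<in>{0..T}. g t \<le> \<alpha> * M + \<beta>)" if nn: "nonneg_Linf_loc f" for f T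
  proof -
    obtain M where M: "AE t in lebesgue. t \<in> {0..max T 0 + 1} \<longrightarrow> \<bar>f t\<bar> \<le> M"
      using nn compact_Icc unfolding nonneg_Linf_loc_def by blast
    show ?thesis
    proof (intro exI[of _ "max M 0"] conjI allI impI ballI)
      fix g :: "real \<Rightarrow> real" and \<alpha> \<beta> t
      assume g: "continuous_on UNIV g" "0 \<le> \<alpha>" "\<forall>t. g t \<le> \<alpha> * f t + \<beta>" and t: "t \<in> {0..T}"
      have "AE t in lebesgue. t \<in> {0..max T 0 + 1} \<longrightarrow> g t \<le> \<alpha> * max M 0 + \<beta>"
        using M
      proof eventually_elim
        case (elim t)
        show ?case
        proof
          assume "t \<in> {0..max T 0 + 1}"
          then have "f t \<le> max M 0" using elim by auto
          then have "\<alpha> * f t \<le> \<alpha> * max M 0" using g(2) by (rule mult_left_mono)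
          then show "g t \<le> \<alpha> * max M 0 + \<beta>" using g(3) by (smt (verit))
        qed
      qed
      from AE_le_imp_le[OF g(1) _ this, of t] t show "g t \<le> \<alpha> * max M 0 + \<beta>" by auto
    qed auto
  qed
  show "\<exists>K\<ge>0. \<forall>s\<in>{0..T}. \<forall>x v r r'. \<bar>L s x v r - L s x v r'\<bar> \<le> K * \<bar>r - r'\<bar>" for T
  proof -
    obtain K where K: "nonneg_Linf_loc K" "\<And>t x v r. \<bar>deriv (\<lambda>r'. L t x v r') r\<bar> \<le> K t"
      using L3 by (auto simp: cond_L3_def)
    have lip: "\<bar>L t x v r - L t x v r'\<bar> \<le> K t * \<bar>r - r'\<bar>" for t x v r r'
    proof -
      have "((\<lambda>r'. L t x v r') has_real_derivative deriv (\<lambda>r'. L t x v r') r) (at r)" for r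
      proof -
        have "((\<lambda>r'. (t, x, v, r')) has_derivative (\<lambda>h. (0, 0, 0, h))) (at r)"
          by (auto intro!: derivative_eq_intros)
        from has_derivative_compose[OF this L'[of "(t, x, v, r)"]]
        have "(\<lambda>r'. L t x v r') differentiable at r" by (auto simp: differentiable_def)
        then show ?thesis by (metis DERIV_imp_deriv real_differentiableE)
      qed
      then show ?thesis
        using field_differentiable_bound[of UNIV "\<lambda>r'. L t x v r'" "deriv (\<lambda>r'. L t x v r')" "K t" r r'] K(2)
        by auto
    qed
    obtain M where M: "M \<ge> 0" "\<And>g :: real \<Rightarrow> real. \<And>\<alpha> \<beta> t. continuous_on UNIV g \<Longrightarrow> \<alpha> \<ge> 0 \<Longrightarrow> (\<forall>t. g t \<le> \<alpha> * K t + \<beta>) \<Longrightarrow>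
      t\<in>{0..T} \<Longrightarrow> g t \<le> \<alpha> * M + \<beta>"
      using bound[OF K(1), of T] by blast
    show ?thesis
    proof (intro exI[of _ M] conjI M(1) ballI allI)
      fix s x v r r' assume s: "s \<in> {0..T}"
      have "\<bar>L s x v r - L s x v r'\<bar> \<le> \<bar>r - r'\<bar> * M + 0"
        using s lip[of _ x v r r'] by (intro M(2)) (auto intro!: continuous_intros contt simp: mult.commute)
      then show "\<bar>L s x v r - L s x v r'\<bar> \<le> M * \<bar>r - r'\<bar>" by (simp add: mult.commute)
    qed
  qed
  show "\<exists>c\<ge>0. \<forall>s\<in>{0..T}. \<forall>x v. A * norm v - c \<le> L s x v 0" for T A
  proof -
    obtain \<theta> c0 where \<theta>: "superlinear \<theta>" and c0: "nonneg_Linf_loc c0"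
      and L: "\<And>t x v. L t x v 0 \<ge> \<theta> (norm v) - c0 t"
      using L2 by (auto simp: cond_L2_def)
    have "eventually (\<lambda>r. \<theta> r / r \<ge> \<bar>A\<bar>) at_top"
      using \<theta> by (auto simp: superlinear_def filterlim_at_top)
    then obtain R0 where R0: "\<And>r. r \<ge> R0 \<Longrightarrow> \<theta> r / r \<ge> \<bar>A\<bar>" by (auto simp: eventually_at_top_linorder)
    define R where "R = max R0 1"
    \<comment> \<open>Beyond \<open>R\<close> the slope comes from superlinearity; below
      \<open>R\<close> nonnegativity of \<theta> suffices, at the cost of the constant
      \<open>\<bar>A\<bar> * R\<close>.\<close>
    have \<theta>A: "\<theta> r \<ge> \<bar>A\<bar> * r - \<bar>A\<bar> * R" if "r \<ge> 0" for r
    proof (cases "r \<ge> R")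
      case True
      then have "\<theta> r \<ge> \<bar>A\<bar> * r" using R0[of r] by (auto simp: R_def field_simps)
      moreover have "\<bar>A\<bar> * R \<ge> 0" by (auto simp: R_def)
      ultimately show ?thesis by linarith
    next
      case False
      then have "\<bar>A\<bar> * r \<le> \<bar>A\<bar> * R" by (intro mult_left_mono) auto
      moreover have "0 \<le> \<theta> r" using \<theta> that by (simp add: superlinear_def)
      ultimately show ?thesis by linarith
    qed
    obtain M where M: "M \<ge> 0" "\<And>g :: real \<Rightarrow> real. \<And>\<alpha> \<beta> t. continuous_on UNIV g \<Longrightarrow> \<alpha> \<ge> 0 \<Longrightarrow> (\<forall>t. g t \<le> \<alpha> * c0 t + \<beta>) \<Longrightarrow>
      t\<in>{0..T} \<Longrightarrow> g t \<le> \<alpha> * M + \<beta>"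
      using bound[OF c0, of T] by blast
    show ?thesis
    proof (intro exI[of _ "M + \<bar>A\<bar> * R"] conjI ballI allI)
      fix s x v assume s: "s \<in> {0..T}"
      have "- L s x v 0 \<le> 1 * M + (\<bar>A\<bar> * R - \<bar>A\<bar> * norm v)"
      proof (rule M(2)[OF _ _ _ s])
        show "\<forall>t. - L t x v 0 \<le> 1 * c0 t + (\<bar>A\<bar> * R - \<bar>A\<bar> * norm v)"
        proof
          fix t show "- L t x v 0 \<le> 1 * c0 t + (\<bar>A\<bar> * R - \<bar>A\<bar> * norm v)"
            using L[where t = t and x = x and v = v] \<theta>A[of "norm v"] by simp
        qed
      qed (auto intro!: continuous_intros contt)
      moreover have "A * norm v \<le> \<bar>A\<bar> * norm v" by (intro mult_right_mono) auto
      ultimately show "A * norm v - (M + \<bar>A\<bar> * R) \<le> L s x v 0" by linarith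
    qed (use M(1) in \<open>auto simp: R_def\<close>)
  qed
qed

section \<open>Herglotz solutions along curves, and the value function as one infimum\<close>

context growth_lagrangian
begin

lemma continuous_along [continuous_intros]:
  assumes "continuous_on S f" "continuous_on S g" "continuous_on S h" "continuous_on S k"
  shows "continuous_on S (\<lambda>s. L (f s) (g s) (h s) (k s))"
  using continuous_on_compose2[OF continuous continuous_on_Pair[OF assms(1) continuous_on_Pair[OF assms(2)
        continuous_on_Pair[OF assms(3,4)]]]]
  by simp

lemma lower_bound:
  obtains c K where "c \<ge> 0" "K \<ge> 0"
    "\<And>s x v r. s \<in> {0..T} \<Longrightarrow> A * norm v - c - K * \<bar>r\<bar> \<le> L s x v r"
proof -
  obtain K where K: "K \<ge> 0" "\<And>s x v r r'. s \<in> {0..T} \<Longrightarrow> \<bar>L s x v r - L s x v r'\<bar> \<le> K * \<bar>r - r'\<bar>"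
    using lipschitz[of T] by blast
  obtain c where c: "c \<ge> 0" "\<And>s x v. s \<in> {0..T} \<Longrightarrow> A * norm v - c \<le> L s x v 0"
    using coercive[of T A] by blast
  show ?thesis
  proof (rule that[OF c(1) K(1)])
    show "A * norm v - c - K * \<bar>r\<bar> \<le> L s x v r" if "s \<in> {0..T}" for s x v r
      using K(2)[OF that, of x v r 0] c(2)[OF that, of v x] by (simp add: abs_le_iff)
  qed
qed

text \<open>Supplies competitors: the constant curve that bounds the value function from above, and
  the straight segment of the subsolution argument.\<close>

lemma line_curve:
  assumes "0 \<le> a" "a \<le> b"
  obtains U where "curve L a b (\<lambda>s. x + (s - a) *\<^sub>R v) (\<lambda>_. v) U" "U a = w"
proof -
  obtain K where K: "K \<ge> 0" "\<And>s x v r r'. s \<in> {0..b} \<Longrightarrow> \<bar>L s x v r - L s x v r'\<bar> \<le> K * \<bar>r - r'\<bar>"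
    using lipschitz[of b] by blast
  let ?\<xi> = "\<lambda>s. x + (s - a) *\<^sub>R v"
  obtain U where U: "U a = w" "\<And>s. s \<in> {a..b} \<Longrightarrow> (U has_real_derivative L s (?\<xi> s) v (U s)) (at s within {a..b})"
  proof (rule picard_global[OF assms(2) _ K(1), where f = "\<lambda>s r. L s (?\<xi> s) v r"])
    show "continuous_on ({a..b} \<times> UNIV) (\<lambda>(s, r). L s (?\<xi> s) v r)"
      unfolding case_prod_unfold by (intro continuous_intros)
    show "\<bar>L s (?\<xi> s) v r - L s (?\<xi> s) v r'\<bar> \<le> K * \<bar>r - r'\<bar>" if "s \<in> {a..b}" for s r r'
      using that assms by (intro K(2)) auto
  qed blast
  have Uc: "continuous_on {a..b} U"
    using U(2) by (meson DERIV_continuous continuous_on_eq_continuous_within)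
  have "curve L a b ?\<xi> (\<lambda>_. v) U"
    unfolding curve_def
  proof (intro conjI ballI)
    show "(\<lambda>_. v) absolutely_integrable_on {a..b}"
      by (intro absolutely_integrable_continuous_real continuous_intros)
    show "?\<xi> s = ?\<xi> a + integral {a..s} (\<lambda>_. v)" if "s \<in> {a..b}" for s
      using that by simp
    show "ac_with_derivative a b U (\<lambda>s. L s (?\<xi> s) v (U s))"
      unfolding ac_with_derivative_def
    proof
      show "abs_continuous_on a b U"
        by (rule abs_continuous_on_C1[OF U(2)]) (auto intro!: continuous_intros Uc)
    qed (simp add: U(2))
  qed
  with U(1) show ?thesis using that by blast
qed

text \<open>The fundamental theorem only yields a gauge integral. Since \<open>U\<close> is bounded,
  \<open>L\<close> is bounded below along the curve; this upgrades the integral to an absolutely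
  convergent one, so the Lebesgue integral in \<open>h_L\<close> has the same value.\<close>

lemma curve_LINT:
  assumes c: "curve L 0 t \<xi> g U" and t: "0 \<le> t"
  shows "(LINT s:{0..t}|lebesgue. L s (\<xi> s) (g s) (U s)) = U t - U 0"
proof -
  let ?f = "\<lambda>s. L s (\<xi> s) (g s) (U s)"
  have acd: "ac_with_derivative 0 t U ?f" by (rule curveD(3)[OF c])
  have hi: "(?f has_integral (U t - U 0)) {0..t}"
    by (rule ac_with_derivative_has_integral[OF acd t])
  have "bounded (U ` {0..t})"
    using ac_with_derivative_continuous_on[OF acd] by (auto intro!: compact_imp_bounded compact_continuous_image)
  then obtain B where B: "\<And>s. s \<in> {0..t} \<Longrightarrow> \<bar>U s\<bar> \<le> B" unfolding bounded_real by blast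
  obtain c K where cK: "c \<ge> 0" "K \<ge> 0" "\<And>s x v r. s \<in> {0..t} \<Longrightarrow> 0 * norm v - c - K * \<bar>r\<bar> \<le> L s x v r"
    using lower_bound[of t 0] by metis
  have "?f absolutely_integrable_on {0..t}"
  proof (rule absolutely_integrable_absolutely_integrable_lbound[where g = "\<lambda>_. - c - K * B"])
    show "?f integrable_on {0..t}" using hi by auto
    show "(\<lambda>_. - c - K * B) absolutely_integrable_on {0..t}"
      by (intro absolutely_integrable_continuous_real continuous_intros)
    fix s assume s: "s \<in> {0..t}"
    have "K * \<bar>U s\<bar> \<le> K * B" using B[OF s] cK(2) by (rule mult_left_mono)
    then show "- c - K * B \<le> ?f s" using cK(3)[OF s, of "g s" "U s" "\<xi> s"] by simp
  qed
  then show ?thesis using hi by (simp add: set_lebesgue_integral_eq_integral integral_unique)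
qed

text \<open>Comparison principle: where \<open>U - V\<close> is positive, the Lipschitz bound in the
  last argument gives a linear differential inequality for it. It serves the barrier of the
  subsolution argument and also compares the arbitrary choice \<open>herglotz_sol\<close> with a
  given solution.\<close>

lemma curve_le:
  assumes U: "ac_with_derivative a b U (\<lambda>s. L s (\<xi> s) (g s) (U s))"
    and V: "ac_with_derivative a b V V'"
    and super: "AE s in lebesgue. s \<in> {a..b} \<longrightarrow> V' s \<ge> L s (\<xi> s) (g s) (V s)"
    and le: "U a \<le> V a" and a: "0 \<le> a" and t: "t \<in> {a..b}"
  shows "U t \<le> V t"
proof -
  obtain K where K: "K \<ge> 0" "\<And>s x v r r'. s \<in> {0..b} \<Longrightarrow> \<bar>L s x v r - L s x v r'\<bar> \<le> K * \<bar>r - r'\<bar>"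
    using lipschitz[of b] by blast
  have "U t - V t \<le> 0"
  proof (rule gronwall_nonpos[OF ac_with_derivative_diff[OF U V] _ t])
    from super show "AE s in lebesgue. s \<in> {a..b} \<longrightarrow> 0 < U s - V s \<longrightarrow>
        L s (\<xi> s) (g s) (U s) - V' s \<le> K * (U s - V s)"
    proof eventually_elim
      case (elim s)
      show ?case
      proof (intro impI)
        assume s: "s \<in> {a..b}" "0 < U s - V s"
        then show "L s (\<xi> s) (g s) (U s) - V' s \<le> K * (U s - V s)"
          using elim K(2)[of s "\<xi> s" "g s" "U s" "V s"] a by auto
      qed
    qed
  qed (use le in simp)
  then show ?thesis by simp
qed

text \<open>The nested infima, over starting points and then over curves, merge into one. Apart from
  that, the chosen \<open>herglotz_sol\<close> has to be matched with the solution carried by the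
  curve, which is done by comparison.\<close>

lemma value_function_eq:
  assumes t: "t > 0"
  shows "value_function L \<phi> t x = (INF z\<in>reachable L \<phi> t x. ereal z)"
proof (rule antisym)
  have sol: "curve L 0 t \<xi> (weak_derivative 0 t \<xi>) (herglotz_sol L 0 t w \<xi>)"
    "herglotz_sol L 0 t w \<xi> 0 = w"
    if "\<xi> \<in> W11 0 t" "herglotz_solution L 0 t w \<xi> U" for \<xi> w U
  proof -
    have "herglotz_solution L 0 t w \<xi> (herglotz_sol L 0 t w \<xi>)"
      unfolding herglotz_sol_def using that(2) by (rule someI[of "herglotz_solution L 0 t w \<xi>"])
    from herglotz_solution_curve[OF t that(1) this]
    show "curve L 0 t \<xi> (weak_derivative 0 t \<xi>) (herglotz_sol L 0 t w \<xi>)"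
      "herglotz_sol L 0 t w \<xi> 0 = w" by auto
  qed
  have lint: "(LINT s:{0..t}|lebesgue. L s (\<xi> s) (weak_derivative 0 t \<xi> s) (herglotz_sol L 0 t w \<xi> s))
      = herglotz_sol L 0 t w \<xi> t - w" if "\<xi> \<in> W11 0 t" "herglotz_solution L 0 t w \<xi> U" for \<xi> w U
    using curve_LINT[OF sol(1)[OF that]] sol(2)[OF that] t by simp
  have V: "value_function L \<phi> t x = (INF y. ereal (\<phi> y) + h_L L 0 t y x (\<phi> y))"
    using t by (simp add: value_function_def)
  show "value_function L \<phi> t x \<le> (INF z\<in>reachable L \<phi> t x. ereal z)"
  proof (rule INF_greatest)
    fix z assume "z \<in> reachable L \<phi> t x"
    then obtain \<xi> g U where c: "curve L 0 t \<xi> g U" "\<xi> t = x" "U 0 = \<phi> (\<xi> 0)" "z = U t"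
      by (auto simp: reachable_def)
    note h = curve_herglotz_solution[OF c(1) t]
    let ?w = "\<phi> (\<xi> 0)" let ?U = "herglotz_sol L 0 t ?w \<xi>"
    have hU: "herglotz_solution L 0 t ?w \<xi> U" using h(2) c(3) by simp
    note c1 = herglotz_solution_curve[OF t h(1) hU] and c2 = sol[OF h(1) hU]
    have "?U t \<le> U t"
      by (rule curve_le[OF curveD(3)[OF c2(1)] curveD(3)[OF c1(1)]]) (use c1(2) c2(2) t in auto)
    have "value_function L \<phi> t x \<le> ereal ?w + h_L L 0 t (\<xi> 0) x ?w"
      unfolding V by (rule INF_lower) simp
    also have "h_L L 0 t (\<xi> 0) x ?w \<le> ereal (?U t - ?w)"
      unfolding h_L_def lint[OF h(1) hU, symmetric]
      by (rule INF_lower) (use h(1) hU c in \<open>auto simp: admissible_def\<close>)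
    finally have "value_function L \<phi> t x \<le> ereal ?w + ereal (?U t - ?w)"
      by (simp add: add_left_mono)
    also have "\<dots> = ereal (?U t)" by simp
    also have "\<dots> \<le> ereal z" using \<open>?U t \<le> U t\<close> c by simp
    finally show "value_function L \<phi> t x \<le> ereal z" .
  qed
  show "(INF z\<in>reachable L \<phi> t x. ereal z) \<le> value_function L \<phi> t x"
    unfolding V
  proof (rule INF_greatest)
    fix y
    \<comment> \<open>The finite number \<open>\<phi> y\<close> is moved to the other side because
      \<open>h_L\<close> is not known to be finite here.\<close>
    have "(INF z\<in>reachable L \<phi> t x. ereal z) - ereal (\<phi> y) \<le> h_L L 0 t y x (\<phi> y)"
      unfolding h_L_def
    proof (rule INF_greatest)
      fix \<xi> assume "\<xi> \<in> admissible L 0 t (\<phi> y) y x"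
      then obtain U where \<xi>: "\<xi> \<in> W11 0 t" "\<xi> 0 = y" "\<xi> t = x" "herglotz_solution L 0 t (\<phi> y) \<xi> U"
        by (auto simp: admissible_def)
      let ?U = "herglotz_sol L 0 t (\<phi> y) \<xi>"
      have "?U t \<in> reachable L \<phi> t x"
        using sol[OF \<xi>(1,4)] \<xi> unfolding reachable_def by (metis (mono_tags, lifting) mem_Collect_eq)
      then have "(INF z\<in>reachable L \<phi> t x. ereal z) \<le> ereal (?U t)" by (rule INF_lower)
      then show "(INF z\<in>reachable L \<phi> t x. ereal z) - ereal (\<phi> y) \<le> ereal (LINT s:{0..t}|lebesgue.
          L s (\<xi> s) (weak_derivative 0 t \<xi> s) (?U s))"
        unfolding lint[OF \<xi>(1,4)] by (simp add: ereal_minus_le_iff)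
    qed
    then show "(INF z\<in>reachable L \<phi> t x. ereal z) \<le> ereal (\<phi> y) + h_L L 0 t y x (\<phi> y)"
      by (simp add: ereal_minus_le_iff add.commute)
  qed
qed

end

section \<open>A priori bounds and finiteness of the value function\<close>

context growth_lagrangian
begin

text \<open>The danger for the lower bound is a remote starting point with a very negative value.
  That value can sink like \<kappa> times the distance, while travelling from there costs
  \<open>\<kappa> + 1\<close> times the length of the curve, up to constants. Together with
  \<open>U t \<le> M\<close> this bounds the length, hence \<open>U 0\<close> from below, and then
  \<open>U s\<close> for every \<open>s\<close>.\<close>

lemma a_priori_bound:
  assumes t: "0 \<le> t" and \<kappa>: "0 \<le> \<kappa>"
  shows "\<exists>B. \<forall>\<xi> g U. curve L 0 t \<xi> g U \<longrightarrow> U 0 \<ge> \<alpha> - \<kappa> * norm (\<xi> t - \<xi> 0) \<longrightarrow> U t \<le> M \<longrightarrow>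
    (\<forall>s\<in>{0..t}. \<bar>U s\<bar> \<le> B)"
proof -
  define M0 where "M0 = max M 0"
  obtain c1 K1 where cK1: "c1 \<ge> 0" "K1 \<ge> 0" "\<And>s x v r. s \<in> {0..t} \<Longrightarrow> 0 * norm v - c1 - K1 * \<bar>r\<bar> \<le> L s x v r"
    using lower_bound[of t 0] by metis
  define M' where "M' = exp (K1 * t) * (M0 + c1 * t)"
  have M': "M' \<ge> 0" using cK1 t by (simp add: M'_def M0_def)
  obtain K where K: "K \<ge> 0" "\<And>s x v r r'. s \<in> {0..t} \<Longrightarrow> \<bar>L s x v r - L s x v r'\<bar> \<le> K * \<bar>r - r'\<bar>"
    using lipschitz[of t] by blast
  define E where "E = exp (K * t)"
  have E: "E \<ge> 1" using K t by (simp add: E_def)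
  \<comment> \<open>\<open>E\<close> makes up for the integrating factor, as
    \<open>exp (- K * r) * E \<ge> 1\<close>. The slope exceeds \<kappa> by one so that one copy of
    the length survives after the drop of the initial value is absorbed.\<close>
  obtain c where c: "c \<ge> 0" "\<And>s x v. s \<in> {0..t} \<Longrightarrow> E * (\<kappa> + 1) * norm v - c \<le> L s x v 0"
    using coercive[of t "E * (\<kappa> + 1)"] by blast
  define c' where "c' = c + 2 * K * M'"
  have c': "c' \<ge> 0" using c K M' by (simp add: c'_def)
  \<comment> \<open>\<open>M0 - \<alpha> + c' * t\<close> is the bound on the length obtained below,
    so \<open>- Q\<close> is the worst initial value minus the largest possible loss
    \<open>c' * t\<close>.\<close>
  define Q where "Q = \<bar>\<alpha>\<bar> + \<kappa> * (M0 - \<alpha> + c' * t) + c' * t"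
  show ?thesis
  proof (intro exI[of _ "max M' (E * \<bar>Q\<bar>)"] allI impI ballI)
    fix \<xi> g U s
    assume cu: "curve L 0 t \<xi> g U" and U0: "\<alpha> - \<kappa> * norm (\<xi> t - \<xi> 0) \<le> U 0" and Ut: "U t \<le> M"
      and s: "s \<in> {0..t}"
    note acd = curveD(3)[OF cu]
    have up: "U s \<le> M'" if s: "s \<in> {0..t}" for s
    proof -
      have "U s \<le> exp (K1 * (t - 0)) * (M0 + c1 * (t - 0))"
      proof (rule gronwall_backward[OF acd _ s cK1(2,1)])
        show "AE s in lebesgue. s \<in> {0..t} \<longrightarrow> M0 \<le> U s \<longrightarrow> - c1 - K1 * U s \<le> L s (\<xi> s) (g s) (U s)"
        proof (intro AE_I2 impI)
          fix s assume s: "s \<in> {0..t}" "M0 \<le> U s"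
          then show "- c1 - K1 * U s \<le> L s (\<xi> s) (g s) (U s)"
            using cK1(3)[OF s(1), of "g s" "U s" "\<xi> s"] by (simp add: M0_def)
        qed
      qed (use Ut in \<open>auto simp: M0_def\<close>)
      then show ?thesis by (simp add: M'_def)
    qed
    \<comment> \<open>Below \<open>M'\<close> the Lipschitz term \<open>- K \<bar>U\<bar>\<close> can be replaced by \<open>K U\<close> up to a constant, which turns
      the equation into a linear differential inequality for \<open>U\<close>.\<close>
    define G where "G = (\<lambda>s. integral {0..s} (\<lambda>s. norm (g s)))"
    have low: "(\<kappa> + 1) * G s - c' * s \<le> exp (- K * s) * U s - U 0" if s: "s \<in> {0..t}" for s
    proof -
      have acd': "ac_with_derivative 0 s U (\<lambda>s. L s (\<xi> s) (g s) (U s))"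
        using acd s by (auto intro: ac_with_derivative_subset)
      have "((\<lambda>s. norm (g s)) has_integral G s) {0..s}"
        unfolding G_def using curve_has_integral(2)[OF cu, of 0 s] s by (auto intro: integrable_integral)
      from has_integral_diff[OF has_integral_mult_right[OF this, of "\<kappa> + 1"] has_integral_const_real[of c' 0 s]]
      have hi: "((\<lambda>s. (\<kappa> + 1) * norm (g s) - c') has_integral ((\<kappa> + 1) * G s - c' * s)) {0..s}"
        using s by (simp add: mult.commute)
      have "(\<kappa> + 1) * G s - c' * s \<le> exp (- K * (s - 0)) * U s - exp (- K * (0 - 0)) * U 0"
      proof (rule ac_with_derivative_lower[OF ac_with_derivative_exp[OF acd'] _ hi], goal_cases)
        case 2
        show ?case
        proof (intro AE_I2 impI)
          fix r assume "r \<in> {0..s}"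
          then have r: "r \<in> {0..t}" using s by auto
          let ?l = "L r (\<xi> r) (g r) (U r)"
          have "E * (\<kappa> + 1) * norm (g r) - c - K * \<bar>U r\<bar> \<le> ?l"
            using K(2)[OF r, of "\<xi> r" "g r" "U r" 0] c(2)[OF r, of "g r" "\<xi> r"] by (simp add: abs_le_iff)
          moreover have "K * \<bar>U r\<bar> \<le> K * (2 * M' - U r)"
            using up[OF r] M' K(1) by (intro mult_left_mono) auto
          ultimately have 1: "E * (\<kappa> + 1) * norm (g r) - c' \<le> - K * U r + ?l"
            by (simp add: c'_def algebra_simps)
          have e: "exp (- K * r) \<le> 1" "1 \<le> exp (- K * r) * E"
            using r K(1) by (auto simp: E_def mult_left_mono simp flip: exp_add)
          have "(\<kappa> + 1) * norm (g r) \<le> (exp (- K * r) * E) * ((\<kappa> + 1) * norm (g r))"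
            using mult_right_mono[OF e(2), of "(\<kappa> + 1) * norm (g r)"] \<kappa> by simp
          moreover have "exp (- K * r) * c' \<le> c'" using e(1) c' by (simp add: mult_left_le_one_le)
          ultimately have "(\<kappa> + 1) * norm (g r) - c' \<le> exp (- K * r) * (E * (\<kappa> + 1) * norm (g r) - c')"
            by (simp add: right_diff_distrib mult.assoc)
          also have "\<dots> \<le> exp (- K * r) * (- K * U r + ?l)" using 1 by (intro mult_left_mono) auto
          finally show "(\<kappa> + 1) * norm (g r) - c' \<le> exp (- K * (r - 0)) * (- K * U r + ?l)" by simp
        qed
      qed (use s in auto)
      then show ?thesis by simp
    qed
    have Gnn: "G s \<ge> 0"
      unfolding G_def using curve_has_integral(2)[OF cu, of 0 s] s by (intro integral_nonneg) auto
    have "norm (\<xi> t - \<xi> 0) \<le> G t"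
      using curve_has_integral(3)[OF cu, of 0 t] t by (simp add: G_def)
    then have xG: "\<kappa> * norm (\<xi> t - \<xi> 0) \<le> \<kappa> * G t" using \<kappa> by (rule mult_left_mono)
    have "exp (- K * t) * U t \<le> M0"
    proof -
      have "exp (- K * t) * U t \<le> exp (- K * t) * M0" using Ut by (intro mult_left_mono) (auto simp: M0_def)
      also have "\<dots> \<le> M0" using K(1) t by (simp add: M0_def mult_left_le_one_le)
      finally show ?thesis .
    qed
    \<comment> \<open>At the final time the term \<open>\<kappa> * G t\<close> from the initial
      value cancels against \<open>(\<kappa> + 1) * G t\<close>.\<close>
    then have Gt: "G t \<le> M0 - \<alpha> + c' * t"
      using low[of t] t U0 xG by (simp add: algebra_simps)
    have "\<kappa> * norm (\<xi> t - \<xi> 0) \<le> \<kappa> * (M0 - \<alpha> + c' * t)"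
      using xG Gt \<kappa> by (meson mult_left_mono order_trans)
    moreover have "c' * s \<le> c' * t" using s c' by (intro mult_left_mono) auto
    moreover have "(\<kappa> + 1) * G s \<ge> 0" using Gnn \<kappa> by simp
    ultimately have "- Q \<le> exp (- K * s) * U s" using low[OF s] U0 by (simp add: Q_def) 
    then have "exp (K * s) * (- Q) \<le> exp (K * s) * (exp (- K * s) * U s)" by (intro mult_left_mono) auto
    also have "\<dots> = U s" by (simp flip: exp_add mult.assoc)
    finally have "- U s \<le> exp (K * s) * Q" by simp
    also have "\<dots> \<le> exp (K * s) * \<bar>Q\<bar>" by (intro mult_left_mono) auto
    also have "\<dots> \<le> E * \<bar>Q\<bar>" using K(1) s by (intro mult_right_mono) (auto simp: E_def mult_left_mono)
    finally show "\<bar>U s\<bar> \<le> max M' (E * \<bar>Q\<bar>)" using up[OF s] by auto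
  qed
qed

text \<open>\<delta> depends on the curve only through the bound \<open>B\<close>. Coercivity with
  slope \<open>A\<close> gives \<open>A\<close> times the length over \<open>[s, t]\<close> minus a
  term of order \<open>t - s\<close> as a lower bound for the increment of \<open>U\<close>, which
  is at most \<open>2 * \<bar>B\<bar>\<close>; a large slope forces a small length.\<close>

lemma curve_equicontinuous:
  assumes t: "0 \<le> t" and e: "0 < \<epsilon>"
  obtains \<delta> where "\<delta> > 0" "\<And>\<xi> g U s. \<lbrakk>curve L 0 t \<xi> g U; \<And>r. r \<in> {0..t} \<Longrightarrow> \<bar>U r\<bar> \<le> B; s \<in> {0..t}; t - s \<le> \<delta>\<rbrakk>
    \<Longrightarrow> integral {s..t} (\<lambda>r. norm (g r)) \<le> \<epsilon>"
proof -
  \<comment> \<open>The numerator is the largest increment of \<open>U\<close> plus 1 for the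
    constant term, which \<open>t - s \<le> 1 / (C + 1)\<close> keeps below 1.\<close>
  define A where "A = (2 * \<bar>B\<bar> + 1) / \<epsilon>"
  obtain c K where cK: "c \<ge> 0" "K \<ge> 0" "\<And>s x v r. s \<in> {0..t} \<Longrightarrow> A * norm v - c - K * \<bar>r\<bar> \<le> L s x v r"
    using lower_bound[of t A] by metis
  define C where "C = c + K * \<bar>B\<bar>"
  have C: "C \<ge> 0" using cK by (simp add: C_def)
  show ?thesis
  proof
    show "1 / (C + 1) > 0" using C by simp
    fix \<xi> g U s
    assume cu: "curve L 0 t \<xi> g U" and B: "\<And>r. r \<in> {0..t} \<Longrightarrow> \<bar>U r\<bar> \<le> B" and s: "s \<in> {0..t}" "t - s \<le> 1 / (C + 1)"
    let ?I = "integral {s..t} (\<lambda>r. norm (g r))"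
    have "((\<lambda>r. norm (g r)) has_integral ?I) {s..t}"
      using curve_has_integral(2)[OF cu, of s t] s by (auto intro: integrable_integral)
    from has_integral_diff[OF has_integral_mult_right[OF this, of A] has_integral_const_real[of C s t]]
    have hi: "((\<lambda>r. A * norm (g r) - C) has_integral (A * ?I - C * (t - s))) {s..t}"
      using s by (simp add: mult.commute)
    have "A * ?I - C * (t - s) \<le> U t - U s"
    proof (rule ac_with_derivative_lower[OF ac_with_derivative_subset[OF curveD(3)[OF cu]] _ hi])
      show "AE r in lebesgue. r \<in> {s..t} \<longrightarrow> A * norm (g r) - C \<le> L r (\<xi> r) (g r) (U r)"
      proof (intro AE_I2 impI)
        fix r assume "r \<in> {s..t}"
        then have r: "r \<in> {0..t}" using s by auto
        have "K * \<bar>U r\<bar> \<le> K * \<bar>B\<bar>" using B[OF r] cK(2) by (intro mult_left_mono) auto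
        then show "A * norm (g r) - C \<le> L r (\<xi> r) (g r) (U r)"
          using cK(3)[OF r, of "g r" "U r" "\<xi> r"] by (simp add: C_def)
      qed
    qed (use s in auto)
    moreover have "\<bar>U t\<bar> \<le> B" "\<bar>U s\<bar> \<le> B" using B[of t] B[of s] s t by auto
    moreover have "C * (t - s) \<le> 1"
    proof -
      have "C * (t - s) \<le> C * (1 / (C + 1))" using s C by (intro mult_left_mono) auto
      also have "\<dots> \<le> 1" using C by simp
      finally show ?thesis .
    qed
    ultimately have "A * ?I \<le> 2 * \<bar>B\<bar> + 1" by linarith
    then have "(2 * \<bar>B\<bar> + 1) * ?I \<le> (2 * \<bar>B\<bar> + 1) * \<epsilon>" using e by (simp add: A_def field_simps)
    then show "?I \<le> \<epsilon>" by (rule mult_left_le_imp_le) simp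
  qed
qed

text \<open>From below, only curves with nonpositive terminal value matter, and for these the a
  priori bound holds with \<open>M = 0\<close>. From above, the constant curve at \<open>x\<close>
  is a competitor.\<close>

lemma value_function_finite:
  assumes t: "0 < t" and \<phi>: "lipschitz_in_the_large \<kappa>1 \<kappa>2 \<phi>" and \<kappa>: "0 \<le> \<kappa>2"
  shows "\<bar>value_function L \<phi> t x\<bar> \<noteq> \<infinity>"
proof -
  have \<phi>0: "\<phi> x - \<kappa>1 - \<kappa>2 * norm (x - y) \<le> \<phi> y" for y
    using \<phi> by (auto simp: lipschitz_in_the_large_def abs_le_iff algebra_simps)
  obtain B where B: "\<And>\<xi> g U. curve L 0 t \<xi> g U \<Longrightarrow> U 0 \<ge> \<phi> x - \<kappa>1 - \<kappa>2 * norm (\<xi> t - \<xi> 0) \<Longrightarrow>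
      U t \<le> 0 \<Longrightarrow> (\<forall>s\<in>{0..t}. \<bar>U s\<bar> \<le> B)"
    using a_priori_bound[of t \<kappa>2 "\<phi> x - \<kappa>1" 0] t \<kappa> by auto
  have "ereal (- \<bar>B\<bar>) \<le> value_function L \<phi> t x"
    unfolding value_function_eq[OF t]
  proof (rule INF_greatest)
    fix z assume "z \<in> reachable L \<phi> t x"
    then obtain \<xi> g U where c: "curve L 0 t \<xi> g U" "\<xi> t = x" "U 0 = \<phi> (\<xi> 0)" "z = U t"
      by (auto simp: reachable_def)
    have "- \<bar>B\<bar> \<le> z"
    proof (cases "U t \<le> 0")
      case True
      have "\<phi> x - \<kappa>1 - \<kappa>2 * norm (\<xi> t - \<xi> 0) \<le> U 0" using \<phi>0[of "\<xi> 0"] c(2,3) by simp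
      from B[OF c(1) this True] have "\<bar>U t\<bar> \<le> B" using t by simp
      then show ?thesis using c by auto
    qed (use c in auto)
    then show "ereal (- \<bar>B\<bar>) \<le> ereal z" by simp
  qed
  moreover obtain U where U: "curve L 0 t (\<lambda>s. x + (s - 0) *\<^sub>R 0) (\<lambda>_. 0) U" "U 0 = \<phi> x"
    using line_curve[of 0 t x 0 "\<phi> x"] t by auto
  then have "U t \<in> reachable L \<phi> t x"
    unfolding reachable_def by force
  then have "value_function L \<phi> t x \<le> ereal (U t)"
    unfolding value_function_eq[OF t] by (rule INF_lower)
  ultimately show ?thesis by auto
qed

lemma value_le:
  assumes t: "0 < t" and fin: "\<bar>value_function L \<phi> t x\<bar> \<noteq> \<infinity>" and z: "z \<in> reachable L \<phi> t x"
  shows "real_of_ereal (value_function L \<phi> t x) \<le> z"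
proof -
  have "value_function L \<phi> t x \<le> ereal z"
    unfolding value_function_eq[OF t] using z by (rule INF_lower)
  then show ?thesis using fin by (cases "value_function L \<phi> t x") auto
qed

lemma value_approx:
  assumes t: "0 < t" and fin: "\<bar>value_function L \<phi> t x\<bar> \<noteq> \<infinity>"
    and less: "real_of_ereal (value_function L \<phi> t x) < b"
  obtains z where "z \<in> reachable L \<phi> t x" "z < b"
proof -
  have "value_function L \<phi> t x < ereal b"
    using less fin by (cases "value_function L \<phi> t x") auto
  then show ?thesis
    unfolding value_function_eq[OF t] INF_less_iff using that by auto
qed

end

section \<open>Viscosity inequalities\<close>

lemma gradient_eq:
  assumes "GDERIV f x :> p"
  shows "gradient f x = p"
  unfolding gradient_def
proof (rule the_equality[where P = "\<lambda>D. GDERIV f x :> D", OF assms])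
  fix q assume "GDERIV f x :> q"
  then have "(\<lambda>h. h \<bullet> q) = (\<lambda>h. h \<bullet> p)"
    using assms unfolding gderiv_def by (rule has_derivative_unique)
  then have "(q - p) \<bullet> q = (q - p) \<bullet> p" by metis
  then have "(q - p) \<bullet> (q - p) = 0" by (simp add: inner_diff_right)
  then show "q = p" by simp
qed

lemma C1_on_partial_derivatives:
  fixes \<psi> :: "real \<times> 'a::euclidean_space \<Rightarrow> real"
  assumes "C1_on S \<psi>" "(t, x) \<in> S"
  shows "(\<psi> has_derivative (\<lambda>(h, k). h * deriv (\<lambda>s. \<psi> (s, x)) t + k \<bullet> gradient (\<lambda>y. \<psi> (t, y)) x)) (at (t, x))"
proof -
  obtain D :: "(real \<times> 'a) \<Rightarrow>\<^sub>L real" where D: "(\<psi> has_derivative blinfun_apply D) (at (t, x))"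
    using assms unfolding C1_on_def by blast
  have "((\<lambda>s. (s, x)) has_derivative (\<lambda>h. (h, 0))) (at t)" by (auto intro!: derivative_eq_intros)
  from has_derivative_compose[OF this, of \<psi> "blinfun_apply D"] D
  have 1: "((\<lambda>s. \<psi> (s, x)) has_derivative (\<lambda>h. D (h, 0))) (at t)" by simp
  define c where "c = D (1, 0)"
  have D1: "D (h, 0) = h * c" for h
    using blinfun.scaleR_right[of D h "(1, 0)"] by (simp add: c_def)
  have "((\<lambda>s. \<psi> (s, x)) has_real_derivative c) (at t)"
  proof -
    have "(\<lambda>h. D (h, 0)) = (*) (c)" by (rule ext) (subst D1, rule mult.commute)
    with 1 show ?thesis by (simp add: has_field_derivative_def)
  qed
  then have d1: "deriv (\<lambda>s. \<psi> (s, x)) t = c" by (rule DERIV_imp_deriv)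
  have "((\<lambda>y. (t, y)) has_derivative (\<lambda>h. (0, h))) (at x)" by (auto intro!: derivative_eq_intros)
  from has_derivative_compose[OF this, of \<psi> "blinfun_apply D"] D
  have 2: "((\<lambda>y. \<psi> (t, y)) has_derivative (\<lambda>h. D (0, h))) (at x)" by simp
  define p where "p = (\<Sum>b\<in>Basis. D (0, b) *\<^sub>R b)"
  have Dp: "D (0, k) = k \<bullet> p" for k
  proof -
    have lin: "linear (\<lambda>k. D (0, k))" using has_derivative_linear[OF 2] .
    have "D (0, k) = D (0, \<Sum>b\<in>Basis. (k \<bullet> b) *\<^sub>R b)" by (simp add: euclidean_representation)
    also have "\<dots> = (\<Sum>b\<in>Basis. (k \<bullet> b) * D (0, b))"
      using linear_sum[OF lin, of "\<lambda>b. (k \<bullet> b) *\<^sub>R b" Basis] linear_scale[OF lin] by simp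
    also have "\<dots> = k \<bullet> p" by (simp add: p_def inner_sum_right mult.commute)
    finally show ?thesis .
  qed
  have "GDERIV (\<lambda>y. \<psi> (t, y)) x :> p" using 2 by (simp add: gderiv_def Dp)
  then have d2: "gradient (\<lambda>y. \<psi> (t, y)) x = p" by (rule gradient_eq)
  have "D (h, k) = h * c + k \<bullet> p" for h k
  proof -
    have "(h, k) = (h, 0) + (0, k)" by simp
    then have "D (h, k) = D (h, 0) + D (0, k)" by (simp only: blinfun.add_right)
    then show ?thesis unfolding D1[of h] Dp[of k] .
  qed
  then have "blinfun_apply D = (\<lambda>(h, k). h * deriv (\<lambda>s. \<psi> (s, x)) t + k \<bullet> gradient (\<lambda>y. \<psi> (t, y)) x)"
    unfolding d1 d2 by (intro ext) (auto split: prod.splits)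
  with D show ?thesis by simp
qed

text \<open>Increments are taken backward from \<open>(t, x)\<close>, since curves arrive there from
  earlier times. In the sum norm, the error along a segment of velocity \<open>v\<close> and
  duration \<open>h\<close> is \<open>e * h * (1 + norm v)\<close>.\<close>

lemma C1_on_expansion:
  fixes \<psi> :: "real \<times> 'a::euclidean_space \<Rightarrow> real"
  assumes "C1_on S \<psi>" "(t, x) \<in> S" "0 < e"
  obtains d where "d > 0" "\<And>s y. \<bar>t - s\<bar> + norm (x - y) < d \<Longrightarrow>
    \<bar>\<psi> (t, x) - \<psi> (s, y) - ((t - s) * deriv (\<lambda>s. \<psi> (s, x)) t + (x - y) \<bullet> gradient (\<lambda>y. \<psi> (t, y)) x)\<bar>
      \<le> e * (\<bar>t - s\<bar> + norm (x - y))"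
proof -
  let ?q = "deriv (\<lambda>s. \<psi> (s, x)) t" and ?p = "gradient (\<lambda>y. \<psi> (t, y)) x"
  have "(\<psi> has_derivative (\<lambda>(h, k). h * ?q + k \<bullet> ?p)) (at (t, x))"
    using assms(1,2) by (rule C1_on_partial_derivatives)
  then obtain d where d: "d > 0" "\<And>z. norm (z - (t, x)) < d \<Longrightarrow>
      norm (\<psi> z - \<psi> (t, x) - (case z - (t, x) of (h, k) \<Rightarrow> h * ?q + k \<bullet> ?p)) \<le> e * norm (z - (t, x))"
    using \<open>0 < e\<close> unfolding has_derivative_at_alt by blast
  show ?thesis
  proof (rule that[OF d(1)])
    fix s y assume less: "\<bar>t - s\<bar> + norm (x - y) < d"
    have le: "norm ((s, y) - (t, x)) \<le> \<bar>t - s\<bar> + norm (x - y)"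
      using norm_Pair_le[of "s - t" "y - x"] by (simp add: norm_minus_commute abs_minus_commute)
    then have "norm (\<psi> (s, y) - \<psi> (t, x) - ((s - t) * ?q + (y - x) \<bullet> ?p)) \<le> e * norm ((s, y) - (t, x))"
      using d(2)[of "(s, y)"] less by simp
    also have "\<dots> \<le> e * (\<bar>t - s\<bar> + norm (x - y))" using le \<open>0 < e\<close> by (intro mult_left_mono) auto
    finally show "\<bar>\<psi> (t, x) - \<psi> (s, y) - ((t - s) * ?q + (x - y) \<bullet> ?p)\<bar> \<le> e * (\<bar>t - s\<bar> + norm (x - y))"
      by (simp add: algebra_simps abs_minus_commute inner_diff_left)
  qed
qed

lemma eventually_nhds_sum_metric:
  fixes x :: "'a::real_normed_vector"
  assumes "\<forall>\<^sub>F z in nhds (t :: real, x). P z"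
  obtains d where "d > 0" "\<And>s y. \<bar>t - s\<bar> + norm (x - y) < d \<Longrightarrow> P (s, y)"
proof -
  obtain d where d: "d > 0" "\<And>z. dist z (t, x) < d \<Longrightarrow> P z"
    using assms unfolding eventually_nhds_metric by blast
  show ?thesis
  proof (rule that[OF d(1)])
    fix s y assume "\<bar>t - s\<bar> + norm (x - y) < d"
    moreover have "dist (s, y) (t, x) \<le> \<bar>t - s\<bar> + norm (x - y)"
      using norm_Pair_le[of "s - t" "y - x"] by (simp add: dist_norm norm_minus_commute abs_minus_commute)
    ultimately show "P (s, y)" by (intro d(2)) simp
  qed
qed

section \<open>The sub- and supersolution inequalities\<close>

context growth_lagrangian
begin

lemma uniformly_near:
  fixes x :: "real^'n"
  assumes e: "0 < e"
  obtains \<rho> where "0 < \<rho>" "\<rho> \<le> 1" "\<And>s y v r. \<lbrakk>\<bar>t - s\<bar> \<le> \<rho>; norm (x - y) \<le> \<rho>; norm v \<le> R; \<bar>r0 - r\<bar> \<le> \<rho>\<rbrakk> \<Longrightarrow>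
    \<bar>L s y v r - L t x v r0\<bar> < e"
proof -
  let ?S = "cball t 1 \<times> cball x 1 \<times> cball (0 :: real^'n) R \<times> cball r0 1"
  have "compact ?S" by (intro compact_Times compact_cball)
  moreover have "continuous_on ?S (\<lambda>(t, x, v, r). L t x v r)"
    using continuous by (rule continuous_on_subset) simp
  ultimately have "uniformly_continuous_on ?S (\<lambda>(t, x, v, r). L t x v r)"
    by (intro compact_uniformly_continuous)
  then obtain d where d: "d > 0" "\<And>z z'. z \<in> ?S \<Longrightarrow> z' \<in> ?S \<Longrightarrow> dist z' z < d \<Longrightarrow>
      dist (case z' of (t, x, v, r) \<Rightarrow> L t x v r) (case z of (t, x, v, r) \<Rightarrow> L t x v r) < e"
    using e unfolding uniformly_continuous_on_def by metis
  \<comment> \<open>Time, position and value each move by at most \<rho> while the velocity is the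
    same in both points, so their distance is at most \<open>3 * \<rho>\<close>.\<close>
  define \<rho> where "\<rho> = min 1 (d / 4)"
  show ?thesis
  proof (rule that)
    show "0 < \<rho>" "\<rho> \<le> 1" using d(1) by (auto simp: \<rho>_def)
    fix s and y v :: "real^'n" and r
    assume *: "\<bar>t - s\<bar> \<le> \<rho>" "norm (x - y) \<le> \<rho>" "norm v \<le> R" "\<bar>r0 - r\<bar> \<le> \<rho>"
    have \<rho>: "\<rho> \<le> 1" "3 * \<rho> < d" using d(1) by (auto simp: \<rho>_def)
    have S: "(t, x, v, r0) \<in> ?S" "(s, y, v, r) \<in> ?S"
      using * \<rho>(1) by (auto simp: dist_norm dist_real_def)
    have "dist (s, y, v, r) (t, x, v, r0) \<le> \<bar>s - t\<bar> + (norm (y - x) + (norm (v - v) + \<bar>r - r0\<bar>))"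
      unfolding dist_norm diff_Pair real_norm_def[symmetric]
      by (intro order_trans[OF norm_Pair_le] add_left_mono order_refl)
    also have "\<dots> < d" using * \<rho>(2) by (simp add: norm_minus_commute abs_minus_commute)
    finally show "\<bar>L s y v r - L t x v r0\<bar> < e"
      using d(2)[OF S] by (simp add: dist_real_def)
  qed
qed

text \<open>The starting value \<open>z\<close> of the segment is controlled from above only, so its
  Herglotz solution may run far below \<open>u0\<close>, where nothing is known about
  \<open>L\<close>. The inequality for \<open>L\<close> is therefore used along the barrier, which
  stays near \<open>u0\<close> by construction, and comparison transfers the bound.\<close>

lemma viscosity_subsolution:
  fixes \<phi> :: "real^'n \<Rightarrow> real"
  defines "u \<equiv> \<lambda>t x. real_of_ereal (value_function L \<phi> t x)"
  assumes fin: "\<And>t x. 0 < t \<Longrightarrow> \<bar>value_function L \<phi> t x\<bar> \<noteq> \<infinity>"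
    and t: "0 < t" and \<psi>: "C1_on ({0<..} \<times> UNIV) \<psi>"
    and max: "local_max_at (\<lambda>(s, y). u s y - \<psi> (s, y)) (t, x)"
  shows "deriv (\<lambda>s. \<psi> (s, x)) t + hamiltonian L t x (gradient (\<lambda>y. \<psi> (t, y)) x) (u t x) \<le> 0"
proof -
  define q where "q = deriv (\<lambda>s. \<psi> (s, x)) t"
  define p where "p = gradient (\<lambda>y. \<psi> (t, y)) x"
  define u0 where "u0 = u t x"
  have main: "q + p \<bullet> v \<le> L t x v u0" for v
  proof (rule ccontr)
    assume "\<not> q + p \<bullet> v \<le> L t x v u0"
    \<comment> \<open>Of the gap \<open>4 * \<delta>\<close>, one part each is spent on the
      expansion of \<psi>, on near-optimality and on the continuity of \<open>L\<close>; the last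
      one gives the contradiction.\<close>
    define \<delta> where "\<delta> = (q + p \<bullet> v - L t x v u0) / 4"
    have \<delta>: "\<delta> > 0" "L t x v u0 = q + p \<bullet> v - 4 * \<delta>"
      using \<open>\<not> _ \<le> _\<close> by (auto simp: \<delta>_def field_simps)
    define e where "e = \<delta> / (1 + norm v)"
    have "1 + norm v > 0" by (simp add: add_pos_nonneg)
    then have e: "e > 0" "e * (1 + norm v) = \<delta>" using \<delta>(1) by (auto simp: e_def)
    obtain d1 where d1: "d1 > 0" "\<And>s y. \<bar>t - s\<bar> + norm (x - y) < d1 \<Longrightarrow>
        \<bar>\<psi> (t, x) - \<psi> (s, y) - ((t - s) * q + (x - y) \<bullet> p)\<bar> \<le> e * (\<bar>t - s\<bar> + norm (x - y))"
      unfolding q_def p_def using C1_on_expansion[OF \<psi> _ e(1), of t x] t by auto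
    obtain d2 where d2: "d2 > 0" "\<And>s y. \<bar>t - s\<bar> + norm (x - y) < d2 \<Longrightarrow> u s y - \<psi> (s, y) \<le> u0 - \<psi> (t, x)"
      using eventually_nhds_sum_metric[OF max[unfolded local_max_at_def]] unfolding u0_def by auto
    obtain \<rho> where \<rho>: "0 < \<rho>" "\<And>s y w r. \<lbrakk>\<bar>t - s\<bar> \<le> \<rho>; norm (x - y) \<le> \<rho>; norm w \<le> norm v; \<bar>u0 - r\<bar> \<le> \<rho>\<rbrakk> \<Longrightarrow>
        \<bar>L s y w r - L t x w u0\<bar> < \<delta>"
      using uniformly_near[OF \<delta>(1), of t x "norm v" u0] by metis
    define l where "l = L t x v u0 + \<delta>"
    \<comment> \<open>Collects every quantity that is multiplied by \<open>h\<close>: the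
      displacement in time and space, and the distance of the barrier from \<open>u0\<close>. One
      condition \<open>h * C < m\<close> then keeps all of them in range.\<close>
    define C where "C = 1 + norm v + (\<bar>q + p \<bullet> v\<bar> + 2 * \<delta> + \<bar>l\<bar>)"
    define m where "m = min (min d1 d2) \<rho>"
    define h where "h = min (t / 2) (m / (2 * C))"
    have C: "C \<ge> 1" using \<delta> by (simp add: C_def)
    have m: "m > 0" using d1 d2 \<rho> by (simp add: m_def)
    have h: "h > 0" "h < t" using t m C by (auto simp: h_def)
    have "h * C \<le> m / (2 * C) * C" unfolding h_def using C by (intro mult_right_mono) auto
    then have hC: "h * C < m" using m C by simp
    have hb: "h * b < m" if "b \<le> C" for b
      using mult_left_mono[OF that less_imp_le[OF h(1)]] hC by linarith
    define y where "y = x - h *\<^sub>R v"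
    \<comment> \<open>The local maximum bounds \<open>u (t - h) y\<close> by
      \<open>w - h * \<delta>\<close>; the extra \<open>h * \<delta>\<close> makes room for a
      reachable value below \<open>w\<close>.\<close>
    define w where "w = u0 + \<psi> (t - h, y) - \<psi> (t, x) + h * \<delta>"
    have nxy: "norm (x - y) = h * norm v" using h by (simp add: y_def)
    have near: "\<bar>t - (t - h)\<bar> + norm (x - y) < m"
      using hb[of "1 + norm v"] \<delta> h by (simp add: nxy C_def algebra_simps)
    have "\<bar>\<psi> (t, x) - \<psi> (t - h, y) - (h * q + (x - y) \<bullet> p)\<bar> \<le> e * (h + norm (x - y))"
      using d1(2)[of "t - h" y] near h by (simp add: m_def)
    also have "\<dots> = h * \<delta>" unfolding nxy e(2)[symmetric] by (simp add: algebra_simps)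
    also have "h * q + (x - y) \<bullet> p = h * (q + p \<bullet> v)" by (simp add: y_def algebra_simps inner_commute)
    finally have exp: "\<bar>\<psi> (t, x) - \<psi> (t - h, y) - h * (q + p \<bullet> v)\<bar> \<le> h * \<delta>" .
    have "u (t - h) y < w"
      using d2(2)[of "t - h" y] near h \<delta> by (simp add: m_def w_def) (smt (verit) mult_pos_pos)
    then obtain z where z: "z \<in> reachable L \<phi> (t - h) y" "z < w"
      unfolding u_def using value_approx[of "t - h" \<phi> y w] fin[of "t - h" y] h by auto
    let ?\<zeta> = "\<lambda>s. y + (s - (t - h)) *\<^sub>R v"
    obtain U where U: "curve L (t - h) t ?\<zeta> (\<lambda>_. v) U" "U (t - h) = z"
      using line_curve[of "t - h" t y v z] h by auto
    have "U t \<in> reachable L \<phi> t (?\<zeta> t)"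
      using z U h by (intro reachable_extend[OF _ U(1)]) auto
    then have "u0 \<le> U t"
      unfolding u0_def u_def using t fin by (intro value_le) (auto simp: y_def)
    \<comment> \<open>An affine strict supersolution near \<open>u0\<close>, used as a barrier for \<open>U\<close>.\<close>
    define \<Psi> where "\<Psi> = (\<lambda>s. w + (s - (t - h)) * l)"
    have \<Psi>: "ac_with_derivative (t - h) t \<Psi> (\<lambda>_. l)"
    proof -
      have d: "(\<Psi> has_real_derivative l) (at s within S)" for s S
        unfolding \<Psi>_def by (auto intro!: derivative_eq_intros)
      then show ?thesis
        unfolding ac_with_derivative_def by (auto intro!: abs_continuous_on_C1[OF d] continuous_intros)
    qed
    have near\<Psi>: "\<bar>u0 - \<Psi> s\<bar> \<le> \<rho>" if s: "s \<in> {t - h..t}" for s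
    proof -
      have Z: "\<bar>(s - (t - h)) * l\<bar> \<le> h * \<bar>l\<bar>" using s by (auto simp: abs_mult intro!: mult_right_mono)
      have Y: "\<bar>h * (q + p \<bullet> v)\<bar> \<le> h * \<bar>q + p \<bullet> v\<bar>" using h by (simp add: abs_mult)
      have tri: "\<bar>X + Y - D - Z\<bar> \<le> \<bar>X\<bar> + \<bar>Y\<bar> + D + \<bar>Z\<bar>" if "0 \<le> D" for X Y D Z :: real
        using that by linarith
      have "u0 - \<Psi> s = (\<psi> (t, x) - \<psi> (t - h, y) - h * (q + p \<bullet> v)) + h * (q + p \<bullet> v)
          - h * \<delta> - (s - (t - h)) * l"
        by (simp add: \<Psi>_def w_def)
      also have "\<bar>\<dots>\<bar> \<le> \<bar>\<psi> (t, x) - \<psi> (t - h, y) - h * (q + p \<bullet> v)\<bar> + \<bar>h * (q + p \<bullet> v)\<bar>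
          + h * \<delta> + \<bar>(s - (t - h)) * l\<bar>"
        by (rule tri) (use h \<delta> in simp)
      also have "\<dots> \<le> h * \<delta> + h * \<bar>q + p \<bullet> v\<bar> + h * \<delta> + h * \<bar>l\<bar>"
        by (intro add_mono exp Y Z order_refl)
      also have "\<dots> = h * (\<bar>q + p \<bullet> v\<bar> + 2 * \<delta> + \<bar>l\<bar>)" by (simp add: algebra_simps)
      also have "\<dots> < m" by (rule hb) (simp add: C_def)
      finally show ?thesis by (simp add: m_def)
    qed
    have "U t \<le> \<Psi> t"
    proof (rule curve_le[OF curveD(3)[OF U(1)] \<Psi>])
      show "AE s in lebesgue. s \<in> {t - h..t} \<longrightarrow> L s (?\<zeta> s) v (\<Psi> s) \<le> l"
      proof (intro AE_I2 impI)
        fix s assume s: "s \<in> {t - h..t}"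
        have "x - ?\<zeta> s = (t - s) *\<^sub>R v" by (simp add: y_def algebra_simps)
        then have "norm (x - ?\<zeta> s) = (t - s) * norm v" using s by simp
        also have "\<dots> \<le> h * norm v" using s by (intro mult_right_mono) auto
        also have "\<dots> \<le> \<rho>" using hb[of "norm v"] \<delta> by (simp add: C_def m_def)
        finally have 1: "norm (x - ?\<zeta> s) \<le> \<rho>" .
        have "h * 1 < m" by (rule hb) (use C in simp)
        then have "\<bar>t - s\<bar> \<le> \<rho>" using s by (simp add: m_def)
        from \<rho>(2)[OF this 1 order_refl near\<Psi>[OF s]]
        show "L s (?\<zeta> s) v (\<Psi> s) \<le> l" by (simp add: l_def)
      qed
      show "U (t - h) \<le> \<Psi> (t - h)" using U(2) z(2) by (simp add: \<Psi>_def)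
    qed (use h in auto)
    with \<open>u0 \<le> U t\<close> have "u0 \<le> w + h * l" by (simp add: \<Psi>_def)
    have l: "l = q + p \<bullet> v - 3 * \<delta>" using \<delta>(2) by (simp add: l_def)
    have "h * (q + p \<bullet> v) - h * \<delta> \<le> h * \<delta> + h * l"
      using exp \<open>u0 \<le> w + h * l\<close> unfolding w_def by linarith
    moreover have "h * l = h * (q + p \<bullet> v) - 3 * (h * \<delta>)"
      unfolding l by (simp add: algebra_simps)
    ultimately have "h * \<delta> \<le> 0" by linarith
    then show False using h \<delta>(1) by (simp add: mult_le_0_iff)
  qed
  have "hamiltonian L t x p u0 \<le> - q"
    unfolding hamiltonian_def
  proof (rule cSUP_least)
    show "p \<bullet> v - L t x v u0 \<le> - q" for v using main[of v] by simp
  qed simp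
  then show ?thesis by (simp add: q_def p_def u0_def)
qed

text \<open>The supremum is a real one, so boundedness has to be checked: slope
  \<open>norm p\<close> in the coercivity bound absorbs \<open>p \<bullet> v\<close>.\<close>

lemma hamiltonian_upper:
  assumes "0 \<le> t"
  shows "p \<bullet> v - L t x v r \<le> hamiltonian L t x p r"
  unfolding hamiltonian_def
proof (rule cSUP_upper)
  obtain c K where cK: "c \<ge> 0" "K \<ge> 0"
    "\<And>s x v r. s \<in> {0..t} \<Longrightarrow> norm p * norm v - c - K * \<bar>r\<bar> \<le> L s x v r"
    using lower_bound[of t "norm p"] by metis
  have "p \<bullet> v - L t x v r \<le> c + K * \<bar>r\<bar>" for v
    using norm_cauchy_schwarz[of p v] cK(3)[of t v r x] assms by simp
  then show "bdd_above (range (\<lambda>v. p \<bullet> v - L t x v r))" by (rule bdd_aboveI2)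
qed simp

text \<open>The term \<open>\<eta> * (1 + norm v)\<close> is the purpose of this form: integrated
  along a curve it dominates the remainder of the test function, which is of order duration plus
  displacement, while the displacement of a near-optimal curve need not be of the order of the
  duration. Bounded velocities are treated by uniform continuity, large ones by coercivity.\<close>

lemma strict_hamiltonian_near:
  assumes t: "0 \<le> t" and less: "q + hamiltonian L t x p r0 < 0"
  obtains \<delta> \<eta> \<rho> where "0 < \<delta>" "0 < \<eta>" "0 < \<rho>"
    "\<And>s y v r. \<lbrakk>s \<in> {0..t}; t - s \<le> \<rho>; norm (x - y) \<le> \<rho>; \<bar>r0 - r\<bar> \<le> \<rho>\<rbrakk> \<Longrightarrow>
      q + p \<bullet> v + \<eta> * (1 + norm v) + \<delta> \<le> L s y v r"
proof -
  define \<delta> where "\<delta> = - (q + hamiltonian L t x p r0) / 4"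
  have \<delta>: "\<delta> > 0" using less by (simp add: \<delta>_def)
  have H: "q + p \<bullet> v + 4 * \<delta> \<le> L t x v r0" for v
    using hamiltonian_upper[OF t, of p v x r0] by (simp add: \<delta>_def field_simps)
  obtain c K where cK: "c \<ge> 0" "K \<ge> 0"
    "\<And>s x v r. s \<in> {0..t} \<Longrightarrow> (norm p + 2) * norm v - c - K * \<bar>r\<bar> \<le> L s x v r"
    using lower_bound[of t "norm p + 2"] by metis
  \<comment> \<open>Of the slope \<open>norm p + 2\<close>, the part \<open>norm p\<close> absorbs
    \<open>p \<bullet> v\<close>, one unit pays for \<open>\<eta> * norm v\<close>, and the other
    exceeds all constants once \<open>norm v > R\<close>.\<close>
  define R where "R = \<bar>q\<bar> + 1 + c + K * (\<bar>r0\<bar> + 1) + \<delta>"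
  have R: "R \<ge> 1" using cK \<delta> by (simp add: R_def)
  define \<eta> where "\<eta> = min 1 (\<delta> / (1 + R))"
  have \<eta>: "\<eta> > 0" "\<eta> \<le> 1" using \<delta> R by (auto simp: \<eta>_def)
  have \<eta>R: "\<eta> * (1 + R) \<le> \<delta>"
  proof -
    have "\<eta> * (1 + R) \<le> \<delta> / (1 + R) * (1 + R)" unfolding \<eta>_def using R by (intro mult_right_mono) auto
    then show ?thesis using R by simp
  qed
  obtain \<rho> where \<rho>: "0 < \<rho>" "\<rho> \<le> 1" "\<And>s y v r. \<lbrakk>\<bar>t - s\<bar> \<le> \<rho>; norm (x - y) \<le> \<rho>; norm v \<le> R; \<bar>r0 - r\<bar> \<le> \<rho>\<rbrakk> \<Longrightarrow>
        \<bar>L s y v r - L t x v r0\<bar> < \<delta>"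
    using uniformly_near[OF \<delta>, of t x R r0] by metis
  show ?thesis
  proof (rule that[OF \<delta> \<eta>(1) \<rho>(1)])
    fix s y v r
    assume *: "s \<in> {0..t}" "t - s \<le> \<rho>" "norm (x - y) \<le> \<rho>" "\<bar>r0 - r\<bar> \<le> \<rho>"
    show "q + p \<bullet> v + \<eta> * (1 + norm v) + \<delta> \<le> L s y v r"
    proof (cases "norm v \<le> R")
      case True
      then have "\<eta> * (1 + norm v) \<le> \<eta> * (1 + R)" using \<eta> by (intro mult_left_mono) auto
      then show ?thesis using \<rho>(3)[of s y v r] * True H[of v] \<eta>R by auto
    next
      case False
      have "K * \<bar>r\<bar> \<le> K * (\<bar>r0\<bar> + 1)" using * \<rho>(2) cK(2) by (intro mult_left_mono) auto
      moreover have "\<eta> * (1 + norm v) \<le> 1 + norm v" using \<eta> by (intro mult_left_le_one_le) auto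
      moreover have "(norm p + 2) * norm v = norm p * norm v + norm v + norm v" by (simp add: algebra_simps)
      ultimately show ?thesis
        using cK(3)[OF *(1), of v r y] norm_cauchy_schwarz[of p v] False unfolding R_def by linarith
    qed
  qed
qed

text \<open>The strict inequality is available only while \<open>U\<close> is near
  \<open>u0\<close>. Restricting the curve and using the local minimum keeps \<open>U\<close> from
  being too low; from above, \<open>U\<close> is kept near \<open>u0\<close> because it cannot fall
  arbitrarily fast before reaching \<open>U t\<close>.\<close>

lemma viscosity_supersolution:
  fixes \<phi> :: "real^'n \<Rightarrow> real"
  defines "u \<equiv> \<lambda>t x. real_of_ereal (value_function L \<phi> t x)"
  assumes \<phi>: "lipschitz_in_the_large \<kappa>1 \<kappa>2 \<phi>" and \<kappa>: "0 \<le> \<kappa>2"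
    and t: "0 < t" and \<psi>: "C1_on ({0<..} \<times> UNIV) \<psi>"
    and min: "local_min_at (\<lambda>(s, y). u s y - \<psi> (s, y)) (t, x)"
  shows "deriv (\<lambda>s. \<psi> (s, x)) t + hamiltonian L t x (gradient (\<lambda>y. \<psi> (t, y)) x) (u t x) \<ge> 0"
proof (rule ccontr)
  note fin = value_function_finite[OF _ \<phi> \<kappa>]
  define q where "q = deriv (\<lambda>s. \<psi> (s, x)) t"
  define p where "p = gradient (\<lambda>y. \<psi> (t, y)) x"
  define u0 where "u0 = u t x"
  assume "\<not> ?thesis"
  then have "q + hamiltonian L t x p u0 < 0" by (simp add: q_def p_def u0_def)
  then obtain \<delta> \<eta> \<rho> where \<delta>: "0 < \<delta>" and \<eta>: "0 < \<eta>" and \<rho>: "0 < \<rho>"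
    and strict: "\<And>s y v r. \<lbrakk>s \<in> {0..t}; t - s \<le> \<rho>; norm (x - y) \<le> \<rho>; \<bar>u0 - r\<bar> \<le> \<rho>\<rbrakk> \<Longrightarrow>
      q + p \<bullet> v + \<eta> * (1 + norm v) + \<delta> \<le> L s y v r"
    using strict_hamiltonian_near[of t q x p u0] t by (metis less_imp_le)
  obtain d1 where d1: "d1 > 0" "\<And>s y. \<bar>t - s\<bar> + norm (x - y) < d1 \<Longrightarrow>
      \<bar>\<psi> (t, x) - \<psi> (s, y) - ((t - s) * q + (x - y) \<bullet> p)\<bar> \<le> \<eta> * (\<bar>t - s\<bar> + norm (x - y))"
    unfolding q_def p_def using C1_on_expansion[OF \<psi> _ \<eta>, of t x] t by auto
  obtain d2 where d2: "d2 > 0" "\<And>s y. \<bar>t - s\<bar> + norm (x - y) < d2 \<Longrightarrow> u0 - \<psi> (t, x) \<le> u s y - \<psi> (s, y)"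
    using eventually_nhds_sum_metric[OF min[unfolded local_min_at_def]] unfolding u0_def by auto
  define C where "C = \<bar>q\<bar> + norm p + \<eta>"
  have C: "C > 0" using \<eta> by (simp add: C_def add_nonneg_pos)
  \<comment> \<open>The third leaves room for
    \<open>\<bar>t - s\<bar> + norm (x - \<xi> s) \<le> 2 * m\<close> to be strictly below
    \<open>d1\<close> and \<open>d2\<close>; \<open>\<rho> / C\<close> keeps the variation of \<psi>
    within \<rho>.\<close>
  define m where "m = min (min d1 d2) (min \<rho> (\<rho> / C)) / 3"
  have m: "m > 0" using d1 d2 \<rho> C by (simp add: m_def)
  have m3: "3 * m \<le> d1" "3 * m \<le> d2" "3 * m \<le> \<rho>" "3 * m \<le> \<rho> / C" by (auto simp: m_def)
  have mC: "2 * m * C \<le> \<rho>"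
  proof -
    have "2 * m * C \<le> \<rho> / C * C" using m3(4) m C by (intro mult_right_mono) auto
    then show ?thesis using C by simp
  qed
  \<comment> \<open>The threshold \<open>u0 + 1\<close> is fixed before \<open>h\<close>, so that
    \<open>B\<close> and the resulting \<sigma> do not depend on \<open>h\<close>;
    \<open>h * \<delta> \<le> 1\<close> below makes the bound applicable.\<close>
  obtain B where B: "\<And>\<xi> g U. curve L 0 t \<xi> g U \<Longrightarrow> U 0 \<ge> \<phi> x - \<kappa>1 - \<kappa>2 * norm (\<xi> t - \<xi> 0) \<Longrightarrow>
      U t \<le> u0 + 1 \<Longrightarrow> (\<forall>s\<in>{0..t}. \<bar>U s\<bar> \<le> B)"
    using a_priori_bound[of t \<kappa>2 "\<phi> x - \<kappa>1" "u0 + 1"] t \<kappa> by auto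
  obtain \<sigma> where \<sigma>: "\<sigma> > 0" "\<And>\<xi> g U s. \<lbrakk>curve L 0 t \<xi> g U; \<And>r. r \<in> {0..t} \<Longrightarrow> \<bar>U r\<bar> \<le> B; s \<in> {0..t}; t - s \<le> \<sigma>\<rbrakk>
    \<Longrightarrow> integral {s..t} (\<lambda>r. norm (g r)) \<le> m"
    using curve_equicontinuous[OF less_imp_le[OF t] m, of B] by metis
  obtain c K where cK: "c \<ge> 0" "K \<ge> 0" "\<And>s x v r. s \<in> {0..t} \<Longrightarrow> 0 * norm v - c - K * \<bar>r\<bar> \<le> L s x v r"
    using lower_bound[of t 0] by metis
  define C2 where "C2 = \<delta> + c + K * \<bar>B\<bar>"
  have C2: "C2 > 0" using \<delta> cK by (simp add: C2_def add_pos_nonneg)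
  \<comment> \<open>\<open>t / 2\<close> keeps times positive, \<sigma> controls the displacement,
    \<open>\<rho> / C2\<close> the excess of \<open>U\<close> over \<open>u0\<close>, and
    \<open>1 / \<delta>\<close> makes the near-optimal value at most \<open>u0 + 1\<close>.\<close>
  define h where "h = min (min (t / 2) m) (min \<sigma> (min (\<rho> / C2) (1 / \<delta>)))"
  have h: "h > 0" "h < t" "h \<le> m" "h \<le> \<sigma>" "h \<le> \<rho> / C2" "h \<le> 1 / \<delta>"
    using t m \<sigma> C2 \<rho> \<delta> by (auto simp: h_def)
  have hC2: "h * C2 \<le> \<rho>" and h\<delta>: "h * \<delta> \<le> 1"
    using h(5,6) C2 \<delta> by (simp_all add: field_simps)
  have "u t x < u0 + h * \<delta>" using h(1) \<delta> by (simp add: u0_def)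
  then obtain z where z: "z \<in> reachable L \<phi> t x" "z < u0 + h * \<delta>"
    unfolding u_def using value_approx[OF t fin[OF t]] by metis
  then obtain \<xi> g U where cu: "curve L 0 t \<xi> g U" and \<xi>: "\<xi> t = x" "U 0 = \<phi> (\<xi> 0)" and Ut: "U t < u0 + h * \<delta>"
    by (auto simp: reachable_def)
  have "\<phi> x - \<kappa>1 - \<kappa>2 * norm (x - \<xi> 0) \<le> \<phi> (\<xi> 0)"
    using \<phi> by (auto simp: lipschitz_in_the_large_def abs_le_iff algebra_simps)
  then have UB: "\<bar>U s\<bar> \<le> B" if "s \<in> {0..t}" for s
    using B[OF cu] \<xi> Ut h\<delta> that by auto
  have \<xi>m: "norm (x - \<xi> s) \<le> m" if s: "s \<in> {t - h..t}" for s
  proof -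
    have "norm (\<xi> t - \<xi> s) \<le> integral {s..t} (\<lambda>r. norm (g r))"
      using curve_has_integral(3)[OF cu, of s t] s h by auto
    also have "\<dots> \<le> m" using s h by (intro \<sigma>(2)[OF cu UB]) auto
    finally show ?thesis using \<xi>(1) by simp
  qed
  have Ulow: "u0 - \<psi> (t, x) + \<psi> (s, \<xi> s) \<le> U s" if s: "s \<in> {t - h..t}" for s
  proof -
    have s0: "0 < s" "s \<in> {0..t}" using s h by auto
    have "u s (\<xi> s) \<le> U s"
      unfolding u_def using reachable_curve[of L t \<xi> g U \<phi> s, OF cu \<xi>(2) s0(2)] s0 fin by (intro value_le) auto
    moreover have "\<bar>t - s\<bar> + norm (x - \<xi> s) < d2" using s h \<xi>m[OF s] m m3 by auto
    ultimately show ?thesis using d2(2)[of s "\<xi> s"] by simp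
  qed
  have Unear: "\<bar>u0 - U s\<bar> \<le> \<rho>" if s: "s \<in> {t - h..t}" for s
  proof -
    have s0: "0 < s" "s \<in> {0..t}" "\<bar>t - s\<bar> \<le> m" using s h by auto
    have "\<bar>\<psi> (t, x) - \<psi> (s, \<xi> s) - ((t - s) * q + (x - \<xi> s) \<bullet> p)\<bar> \<le> \<eta> * (\<bar>t - s\<bar> + norm (x - \<xi> s))"
      using s0 \<xi>m[OF s] m m3 by (intro d1(2)) auto
    also have "\<dots> \<le> \<eta> * (2 * m)" using s0 \<xi>m[OF s] \<eta> by (intro mult_left_mono) auto
    finally have "\<bar>\<psi> (t, x) - \<psi> (s, \<xi> s) - ((t - s) * q + (x - \<xi> s) \<bullet> p)\<bar> \<le> \<eta> * (2 * m)" .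
    moreover have "\<bar>(t - s) * q\<bar> \<le> m * \<bar>q\<bar>" using s0 by (auto simp: abs_mult intro!: mult_right_mono)
    moreover have "\<bar>(x - \<xi> s) \<bullet> p\<bar> \<le> m * norm p"
      using Cauchy_Schwarz_ineq2[of "x - \<xi> s" p] mult_right_mono[OF \<xi>m[OF s], of "norm p"] by simp
    moreover have "m * \<bar>q\<bar> \<ge> 0" "m * norm p \<ge> 0" using m by auto
    ultimately have "\<psi> (t, x) - \<psi> (s, \<xi> s) \<le> 2 * m * C" by (simp add: C_def algebra_simps)
    then have low: "u0 - \<rho> \<le> U s" using Ulow[OF s] mC by linarith
    \<comment> \<open>The upper side: \<open>U\<close> falls at a rate of at most
      \<open>c + K * \<bar>B\<bar>\<close>, so a value far above \<open>u0\<close> could not come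
      down to \<open>U t\<close> in time.\<close>
    have "- (c + K * \<bar>B\<bar>) * (t - s) \<le> U t - U s"
    proof (rule ac_with_derivative_lower[OF ac_with_derivative_subset[OF curveD(3)[OF cu]]])
      show "((\<lambda>_. - (c + K * \<bar>B\<bar>)) has_integral - (c + K * \<bar>B\<bar>) * (t - s)) {s..t}"
        using has_integral_const_real[of "- (c + K * \<bar>B\<bar>)" s t] s by (simp add: mult.commute)
      show "AE r in lebesgue. r \<in> {s..t} \<longrightarrow> - (c + K * \<bar>B\<bar>) \<le> L r (\<xi> r) (g r) (U r)"
      proof (intro AE_I2 impI)
        fix r assume "r \<in> {s..t}"
        then have r: "r \<in> {0..t}" using s0 by auto
        have "K * \<bar>U r\<bar> \<le> K * \<bar>B\<bar>" using UB[OF r] cK(2) by (intro mult_left_mono) auto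
        then show "- (c + K * \<bar>B\<bar>) \<le> L r (\<xi> r) (g r) (U r)"
          using cK(3)[OF r, of "g r" "U r" "\<xi> r"] by simp
      qed
    qed (use s0 s in auto)
    moreover have "(c + K * \<bar>B\<bar>) * (t - s) \<le> (c + K * \<bar>B\<bar>) * h" using s cK by (intro mult_left_mono) auto
    ultimately have "U s \<le> u0 + h * C2" using Ut by (simp add: C2_def algebra_simps)
    with low hC2 show ?thesis by auto
  qed
  let ?y = "\<xi> (t - h)" and ?I = "integral {t - h..t} (\<lambda>r. norm (g r))"
  have ht: "t - h \<in> {t - h..t}" using h by auto
  have "((\<lambda>r. g r \<bullet> p) has_integral (x - ?y) \<bullet> p) {t - h..t}"
    using has_integral_linear[OF curve_has_integral(1)[OF cu, of "t - h" t] bounded_linear_inner_left[of p]] h \<xi>(1)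
    by (simp add: o_def)
  moreover have nI: "((\<lambda>r. norm (g r)) has_integral ?I) {t - h..t}"
    using curve_has_integral(2)[OF cu, of "t - h" t] h by (auto intro: integrable_integral)
  moreover have "((\<lambda>r. q + \<eta> + \<delta>) has_integral h * (q + \<eta> + \<delta>)) {t - h..t}"
    using has_integral_const_real[of "q + \<eta> + \<delta>" "t - h" t] h by simp
  ultimately have hi: "((\<lambda>r. (g r \<bullet> p + \<eta> * norm (g r)) + (q + \<eta> + \<delta>)) has_integral
      (((x - ?y) \<bullet> p + \<eta> * ?I) + h * (q + \<eta> + \<delta>))) {t - h..t}"
    by (intro has_integral_add has_integral_mult_right)
  have "((x - ?y) \<bullet> p + \<eta> * ?I) + h * (q + \<eta> + \<delta>) \<le> U t - U (t - h)"
  proof (rule ac_with_derivative_lower[OF ac_with_derivative_subset[OF curveD(3)[OF cu]] _ hi])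
    show "AE r in lebesgue. r \<in> {t - h..t} \<longrightarrow>
        (g r \<bullet> p + \<eta> * norm (g r)) + (q + \<eta> + \<delta>) \<le> L r (\<xi> r) (g r) (U r)"
    proof (intro AE_I2 impI)
      fix r assume r: "r \<in> {t - h..t}"
      have "q + p \<bullet> g r + \<eta> * (1 + norm (g r)) + \<delta> \<le> L r (\<xi> r) (g r) (U r)"
        using r h m m3 \<xi>m[OF r] Unear[OF r] by (intro strict) auto
      then show "(g r \<bullet> p + \<eta> * norm (g r)) + (q + \<eta> + \<delta>) \<le> L r (\<xi> r) (g r) (U r)"
        by (simp add: algebra_simps inner_commute)
    qed
  qed (use h in auto)
  moreover have "\<bar>\<psi> (t, x) - \<psi> (t - h, ?y) - (h * q + (x - ?y) \<bullet> p)\<bar> \<le> \<eta> * (h + norm (x - ?y))"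
    using d1(2)[of "t - h" ?y] h \<xi>m[OF ht] m m3 by auto
  moreover have "\<eta> * norm (x - ?y) \<le> \<eta> * ?I"
    using curve_has_integral(3)[OF cu, of "t - h" t] h \<xi>(1) \<eta> by (intro mult_left_mono) auto
  \<comment> \<open>The remainder of \<psi> is absorbed by \<open>\<eta> * (h + ?I)\<close>, which
    leaves \<open>U t \<ge> u0 + h * \<delta>\<close>, against the choice of the curve.\<close>
  ultimately show False using Ulow[OF ht] Ut by (simp add: algebra_simps)
qed

end

theorem proposition3p9:
  fixes L :: "real \<Rightarrow> real^'n \<Rightarrow> real^'n \<Rightarrow> real \<Rightarrow> real"
    and \<phi> :: "real^'n \<Rightarrow> real" and \<kappa>1 \<kappa>2 :: real
  assumes "C1_lagrangian L" and "cond_L1 L" and "cond_L2 L" and "cond_L3 L"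
    and "cond_L4 L \<or> cond_L4' L"
    and "lower_semicont \<phi>"
    and "\<kappa>1 \<ge> 0" and "\<kappa>2 \<ge> 0" and "lipschitz_in_the_large \<kappa>1 \<kappa>2 \<phi>"
  shows "(\<forall>t\<ge>0. \<forall>x. \<bar>value_function L \<phi> t x\<bar> \<noteq> \<infinity>) \<and>
    viscosity_solution_cauchy (hamiltonian L) \<phi> (\<lambda>t x. real_of_ereal (value_function L \<phi> t x))"
proof -
  interpret growth_lagrangian L
    using assms(1,3,4) by (rule growth_lagrangianI)
  note fin = value_function_finite[OF _ assms(9,8)]
  have "\<bar>value_function L \<phi> t x\<bar> \<noteq> \<infinity>" if "t \<ge> 0" for t x
    using that fin[of t x] by (cases "t = 0") (auto simp: value_function_def)
  moreover have "viscosity_solution (hamiltonian L) (\<lambda>t x. real_of_ereal (value_function L \<phi> t x))"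
    unfolding viscosity_solution_def
    using viscosity_subsolution[OF fin] viscosity_supersolution[OF assms(9,8)] by blast
  ultimately show ?thesis
    by (simp add: viscosity_solution_cauchy_def value_function_def)
qed

end
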